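(* Let $\omega>0$, let $J$ be a non-zero purely imaginary number, let $q$ be a real distribution of order $0$ on $\mathbb{R}$, and let $w$ be a non-negative but non-zero distribution of order $0$ on $\mathbb{R}$, where both $q$ and $w$ are periodic with period $\omega$. Then the linear relation $T_{\max}$ associated with the (scalar) differential equation $Ju'+qu=wf$ is self-adjoint. Its spectrum is purely continuous and fills the entire real line.
   Context: A distribution on $\mathbb{R}$ is of order $0$ if for every compact $K\subset\mathbb{R}$ there is $C\ge0$ with $|r(\phi)|\le C\|\phi\|_\infty$ for all test functions ($C^\infty$, compactly supported) $\phi$ supported in $K$; it is identified with a local complex measure $dR$, where $R$ is of locally bounded variation and $r(\phi)=\int\phi\,dR$. It is periodic with period $\omega$ if $r(\phi)=r(\phi(\cdot+\omega))$ for all test functions. It is real (non-negative) if the corresponding local measure is. The product $rf$, for $f\in L^1_{\rm loc}(|dR|)$, is $\phi\mapsto\int f\phi\,dR$. A function $u$ of locally bounded variation has right/left limits $u^\pm$ and is balanced if $u=(u^++u^-)/2$; $\mathrm{BV}^\#_{\rm loc}(\mathbb{R})$ denotes the balanced complex-valued functions of locally bounded variation. $\mathcal{L}^2(w)$ is the set of $w$-measurable $f:\mathbb{R}\to\mathbb{C}$ with $\|f\|^2=\int \bar f w f<\infty$, and $L^2(w)$ is the corresponding Hilbert space of equivalence classes $[f]$, with inner product $\langle f,g\rangle=\int \bar f w g$. Define $$T_{\max}=\{([u],[f])\in L^2(w)\times L^2(w): u,f\in\mathcal{L}^2(w),\ u\in \mathrm{BV}^\#_{\rm loc}(\mathbb{R}),\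 Ju'+qu=wf\},$$ the equation being understood in the sense of distributions. For a self-adjoint linear relation $T$ in $L^2(w)$ the resolvent set is $\varrho(T)=\{\lambda\in\mathbb{C}:\ker(T-\lambda)=\{0\},\ \operatorname{ran}(T-\lambda)=L^2(w)\}$ and the spectrum is $\sigma(T)=\mathbb{C}\setminus\varrho(T)$. The spectrum is purely continuous if $T$ has no eigenvalues, i.e. there is no $\lambda\in\mathbb{C}$ and $0\ne u\in L^2(w)$ with $(u,\lambda u)\in T$. *)

theory Defs
  imports "HOL-Analysis.Analysis"
begin

section \<open>Test functions and distributions on the real line\<close>

definition smooth :: "(real \<Rightarrow> complex) \<Rightarrow> bool" where
  "smooth \<phi> \<longleftrightarrow> (\<exists>D :: nat \<Rightarrow> real \<Rightarrow> complex. D 0 = \<phi> \<and>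
     (\<forall>n x. (D n has_vector_derivative D (Suc n) x) (at x)))"

definition supp :: "(real \<Rightarrow> complex) \<Rightarrow> real set" where
  "supp \<phi> = closure {x. \<phi> x \<noteq> 0}"

definition test_fun :: "(real \<Rightarrow> complex) \<Rightarrow> bool" where
  "test_fun \<phi> \<longleftrightarrow> smooth \<phi> \<and> compact (supp \<phi>)"

text \<open>A distribution is represented by a function on all of \<open>real \<Rightarrow> complex\<close>, whose values outside
  the test functions are irrelevant; hence equality of distributions is \<open>dist_eq\<close>.\<close>

type_synonym dist = "(real \<Rightarrow> complex) \<Rightarrow> complex"

definition dist_eq :: "dist \<Rightarrow> dist \<Rightarrow> bool" where
  "dist_eq r s \<longleftrightarrow> (\<forall>\<phi>. test_fun \<phi> \<longrightarrow> r \<phi> = s \<phi>)"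

definition order0 :: "dist \<Rightarrow> bool" where
  "order0 r \<longleftrightarrow>
     (\<forall>\<phi> \<psi>. test_fun \<phi> \<longrightarrow> test_fun \<psi> \<longrightarrow> r (\<lambda>x. \<phi> x + \<psi> x) = r \<phi> + r \<psi>) \<and>
     (\<forall>c \<phi>. test_fun \<phi> \<longrightarrow> r (\<lambda>x. c * \<phi> x) = c * r \<phi>) \<and>
     (\<forall>K. compact K \<longrightarrow> (\<exists>C\<ge>0. \<forall>\<phi>. test_fun \<phi> \<longrightarrow> supp \<phi> \<subseteq> K \<longrightarrow>
        cmod (r \<phi>) \<le> C * (SUP x. cmod (\<phi> x))))"

definition periodic_dist :: "real \<Rightarrow> dist \<Rightarrow> bool" where
  "periodic_dist \<omega> r \<longleftrightarrow> (\<forall>\<phi>. test_fun \<phi> \<longrightarrow> r \<phi> = r (\<lambda>x. \<phi> (x + \<omega>)))"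

definition dist_deriv :: "dist \<Rightarrow> dist" where
  "dist_deriv r = (\<lambda>\<phi>. - r (\<lambda>x. vector_derivative \<phi> (at x)))"

definition dist_of_fun :: "(real \<Rightarrow> complex) \<Rightarrow> dist" where
  "dist_of_fun u = (\<lambda>\<phi>. \<integral>x. u x * \<phi> x \<partial>lborel)"

definition dist_add :: "dist \<Rightarrow> dist \<Rightarrow> dist" where
  "dist_add r s = (\<lambda>\<phi>. r \<phi> + s \<phi>)"

definition dist_scale :: "complex \<Rightarrow> dist \<Rightarrow> dist" where
  "dist_scale c r = (\<lambda>\<phi>. c * r \<phi>)"

section \<open>The local measure of a distribution of order 0\<close>

text \<open>A local complex measure \<open>dR\<close> is given through its polar decomposition \<open>dR = h |dR|\<close>: here \<open>M\<close> is
  \<open>|dR|\<close>, a Borel measure finite on compact sets, and \<open>h\<close> is a Borel function with \<open>|h| = 1\<close>.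
  For a distribution of order 0 such \<open>M\<close> and \<open>h\<close> exist; \<open>M\<close> is unique and \<open>h\<close> is unique up to
  \<open>M\<close>-null sets.\<close>

definition local_measure :: "dist \<Rightarrow> real measure \<Rightarrow> (real \<Rightarrow> complex) \<Rightarrow> bool" where
  "local_measure r M h \<longleftrightarrow>
     sets M = sets borel \<and> (\<forall>K. compact K \<longrightarrow> emeasure M K < \<infinity>) \<and>
     h \<in> borel_measurable borel \<and> (\<forall>x. cmod (h x) = 1) \<and>
     (\<forall>\<phi>. test_fun \<phi> \<longrightarrow> r \<phi> = (\<integral>x. \<phi> x * h x \<partial>M))"

definition real_dist :: "dist \<Rightarrow> bool" where
  "real_dist r \<longleftrightarrow> (\<exists>M h. local_measure r M h \<and> (\<forall>x. h x \<in> \<real>))"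

definition nonneg_dist :: "dist \<Rightarrow> bool" where
  "nonneg_dist r \<longleftrightarrow> (\<exists>M. local_measure r M (\<lambda>_. 1))"

definition polar :: "dist \<Rightarrow> real measure \<times> (real \<Rightarrow> complex)" where
  "polar r = (SOME p. local_measure r (fst p) (snd p))"

text \<open>The completion makes the measurable functions of \<open>abs_measure r\<close> the \<open>|dR|\<close>-measurable ones.
  If \<open>r\<close> is non-negative, \<open>abs_measure r\<close> is \<open>r\<close> itself, viewed as a measure.\<close>

definition abs_measure :: "dist \<Rightarrow> real measure" where
  "abs_measure r = completion (fst (polar r))"

text \<open>The product \<open>r f\<close>, meaningful for \<open>f\<close> locally integrable with respect to \<open>abs_measure r\<close>.\<close>

definition dist_mult :: "dist \<Rightarrow> (real \<Rightarrow> complex) \<Rightarrow> dist" where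
  "dist_mult r f = (\<lambda>\<phi>. \<integral>x. f x * \<phi> x * snd (polar r) x \<partial>abs_measure r)"

section \<open>Balanced functions of locally bounded variation\<close>

definition bv_loc :: "(real \<Rightarrow> complex) \<Rightarrow> bool" where
  "bv_loc u \<longleftrightarrow> (\<forall>a b. \<exists>B. \<forall>n (t :: nat \<Rightarrow> real). mono t \<longrightarrow> range t \<subseteq> {a..b} \<longrightarrow>
     (\<Sum>i<n. cmod (u (t (Suc i)) - u (t i))) \<le> B)"

definition balanced :: "(real \<Rightarrow> complex) \<Rightarrow> bool" where
  "balanced u \<longleftrightarrow> (\<forall>x. \<exists>up um. (u \<longlongrightarrow> up) (at_right x) \<and> (u \<longlongrightarrow> um) (at_left x) \<and>
     u x = (up + um) / 2)"

section \<open>The Hilbert space of equivalence classes of square-integrable functions\<close>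

definition l2_funs :: "'a measure \<Rightarrow> ('a \<Rightarrow> complex) set" where
  "l2_funs N = {f \<in> borel_measurable N. integrable N (\<lambda>x. (cmod (f x))\<^sup>2)}"

definition l2_rel :: "'a measure \<Rightarrow> (('a \<Rightarrow> complex) \<times> ('a \<Rightarrow> complex)) set" where
  "l2_rel N = {(f, g). f \<in> l2_funs N \<and> g \<in> l2_funs N \<and> (AE x in N. f x = g x)}"

definition l2_class :: "'a measure \<Rightarrow> ('a \<Rightarrow> complex) \<Rightarrow> ('a \<Rightarrow> complex) set" where
  "l2_class N f = l2_rel N `` {f}"

definition l2_space :: "'a measure \<Rightarrow> ('a \<Rightarrow> complex) set set" where
  "l2_space N = l2_funs N // l2_rel N"

lemma equiv_l2_rel: "equiv (l2_funs N) (l2_rel N)"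
proof (rule equivI)
  show "l2_rel N \<subseteq> l2_funs N \<times> l2_funs N" by (auto simp: l2_rel_def)
  show "refl_on (l2_funs N) (l2_rel N)" by (auto simp: refl_on_def l2_rel_def)
  show "sym (l2_rel N)" by (auto simp: sym_def l2_rel_def)
  show "trans (l2_rel N)" by (auto simp: trans_def l2_rel_def)
qed

definition l2_rep :: "('a \<Rightarrow> complex) set \<Rightarrow> 'a \<Rightarrow> complex" where
  "l2_rep X = (SOME f. f \<in> X)"

definition l2_zero :: "'a measure \<Rightarrow> ('a \<Rightarrow> complex) set" where
  "l2_zero N = l2_class N (\<lambda>_. 0)"

definition l2_scale :: "'a measure \<Rightarrow> complex \<Rightarrow> ('a \<Rightarrow> complex) set \<Rightarrow> ('a \<Rightarrow> complex) set" where
  "l2_scale N c X = l2_class N (\<lambda>x. c * l2_rep X x)"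

definition l2_diff ::
  "'a measure \<Rightarrow> ('a \<Rightarrow> complex) set \<Rightarrow> ('a \<Rightarrow> complex) set \<Rightarrow> ('a \<Rightarrow> complex) set" where
  "l2_diff N X Y = l2_class N (\<lambda>x. l2_rep X x - l2_rep Y x)"

definition l2_inner :: "'a measure \<Rightarrow> ('a \<Rightarrow> complex) set \<Rightarrow> ('a \<Rightarrow> complex) set \<Rightarrow> complex" where
  "l2_inner N X Y = (\<integral>x. cnj (l2_rep X x) * l2_rep Y x \<partial>N)"

section \<open>Linear relations in that space\<close>

type_synonym 'a l2_relation = "(('a \<Rightarrow> complex) set \<times> ('a \<Rightarrow> complex) set) set"

definition adjoint_relation :: "'a measure \<Rightarrow> 'a l2_relation \<Rightarrow> 'a l2_relation" where
  "adjoint_relation N T = {(V, G). V \<in> l2_space N \<and> G \<in> l2_space N \<and>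
     (\<forall>(U, F)\<in>T. l2_inner N G U = l2_inner N V F)}"

definition self_adjoint :: "'a measure \<Rightarrow> 'a l2_relation \<Rightarrow> bool" where
  "self_adjoint N T \<longleftrightarrow> adjoint_relation N T = T"

definition relation_shift :: "'a measure \<Rightarrow> 'a l2_relation \<Rightarrow> complex \<Rightarrow> 'a l2_relation" where
  "relation_shift N T z = {(U, l2_diff N F (l2_scale N z U)) | U F. (U, F) \<in> T}"

definition relation_ker :: "'a measure \<Rightarrow> 'a l2_relation \<Rightarrow> ('a \<Rightarrow> complex) set set" where
  "relation_ker N T = {U. (U, l2_zero N) \<in> T}"

definition resolvent_set :: "'a measure \<Rightarrow> 'a l2_relation \<Rightarrow> complex set" where
  "resolvent_set N T = {z. relation_ker N (relation_shift N T z) = {l2_zero N} \<and>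
     Range (relation_shift N T z) = l2_space N}"

definition spectrum :: "'a measure \<Rightarrow> 'a l2_relation \<Rightarrow> complex set" where
  "spectrum N T = - resolvent_set N T"

definition eigenvalue :: "'a measure \<Rightarrow> 'a l2_relation \<Rightarrow> complex \<Rightarrow> bool" where
  "eigenvalue N T z \<longleftrightarrow> (\<exists>U\<in>l2_space N. U \<noteq> l2_zero N \<and> (U, l2_scale N z U) \<in> T)"

definition purely_continuous_spectrum :: "'a measure \<Rightarrow> 'a l2_relation \<Rightarrow> bool" where
  "purely_continuous_spectrum N T \<longleftrightarrow> (\<nexists>z. eigenvalue N T z)"

section \<open>The maximal relation of \<open>J u' + q u = w f\<close>\<close>

definition T_max :: "complex \<Rightarrow> dist \<Rightarrow> dist \<Rightarrow> real l2_relation" where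
  "T_max J q w = {(l2_class (abs_measure w) u, l2_class (abs_measure w) f) | u f.
     u \<in> l2_funs (abs_measure w) \<and> f \<in> l2_funs (abs_measure w) \<and> bv_loc u \<and> balanced u \<and>
     dist_eq (dist_add (dist_scale J (dist_deriv (dist_of_fun u))) (dist_mult q u))
             (dist_mult w f)}"

end

theory Submission
  imports Defs
begin

text \<open>Let \<open>P\<close> be the sum of the measures \<open>|q|\<close> and \<open>w\<close>, so that both are given by
  bounded densities. In terms of the left limits \<open>v\<close> of \<open>u\<close>, the equation \<open>J u' + q u = w f\<close> says \<open>dv = (w f - q u) / J dP\<close> together
  with \<open>u = v + (w f - q u) p / (2 J)\<close>, where \<open>p\<close> is the mass of the atom at the point. The product
  rule for such \<open>v\<close> gives Lagrange's identity. Periodicity makes the masses of the atoms bounded and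
  the mass of \<open>w\<close> infinite near both ends, so \<open>v\<close> is dominated by \<open>|u| + |f|\<close> and the boundary terms
  vanish at infinity: the relation is symmetric. For non-real \<open>z\<close> an energy estimate provides
  solutions of \<open>J u' + q u = w (z u + g)\<close> in \<open>L\<^sup>2(w)\<close>, so the relation is self-adjoint and its spectrum
  is real. For real \<open>z\<close> solutions of the homogeneous equation have left limits of constant modulus,
  which excludes eigenvalues and, by Lagrange's identity again, surjectivity.\<close>

text \<open>The atoms of \<open>P\<close> are the obstacle. There the balanced value of
  \<open>u\<close> enters its own jump: with \<open>m = (z w - q) / J\<close> the homogeneous
  equation gives \<open>u = v + m u p / 2\<close>, which determines \<open>u\<close> from
  \<open>v\<close> only if \<open>1 - m p / 2\<close> does not vanish. As \<open>J\<close> is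
  imaginary and \<open>q\<close>, \<open>w\<close> are real, \<open>Re m = w Im z / Im J\<close>. If
  this is at most 0, the factor has modulus at least 1; and for \<open>Im z / Im J < 0\<close> the
  energy estimate also runs from left to right. In the other half-plane the factor may vanish, but
  the reflection x -> -x turns \<open>J\<close> into \<open>- J\<close> and so exchanges the
  half-planes. Both are needed, since self-adjointness is deduced from solvability at z = i and z =
  -i.

  A second difficulty is that \<open>polar\<close> is a choice: phases are known only almost
  everywhere, and members of \<open>L\<^sup>2(w)\<close> are measurable only for a completion. The
  analysis is therefore done with Borel densities with respect to \<open>P\<close>. This loses
  nothing: changing \<open>f\<close> on a \<open>w\<close>-null set changes the density of
  \<open>v\<close> on a \<open>P\<close>-null set, and such a set contains no atom.\<close>

section \<open>Smooth cut-off functions\<close>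

text \<open>Iterating a choice of derivative inside \<open>S\<close> produces the sequence of
  derivatives, so closure of a set of functions under differentiation replaces explicit formulas for
  derivatives of higher order.\<close>

lemma smooth_coinduct:
  assumes "f \<in> S" and step: "\<And>f. f \<in> S \<Longrightarrow> \<exists>g\<in>S. \<forall>x. (f has_vector_derivative g x) (at x)"
  shows "smooth f"
proof -
  obtain d where d: "\<And>f. f \<in> S \<Longrightarrow> d f \<in> S \<and> (\<forall>x. (f has_vector_derivative d f x) (at x))"
    using step by metis
  have *: "(d ^^ n) f \<in> S" for n by (induction n) (use d assms(1) in auto)
  show ?thesis unfolding smooth_def
    by (rule exI[of _ "\<lambda>n. (d ^^ n) f"]) (use * d in auto)
qed

lemma smooth_derivE:
  assumes "smooth f"
  obtains g where "smooth g" "\<And>x. (f has_vector_derivative g x) (at x)"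
proof -
  obtain D where D: "D 0 = f" "\<And>n x. (D n has_vector_derivative D (Suc n) x) (at x)"
    using assms unfolding smooth_def by blast
  have "smooth (D (Suc 0))" unfolding smooth_def
    by (rule exI[of _ "\<lambda>n. D (Suc n)"]) (use D in auto)
  then show thesis using D by (intro that[of "D (Suc 0)"]) auto
qed

lemma smooth_antideriv:
  assumes "smooth g" "\<And>x. (f has_vector_derivative g x) (at x)"
  shows "smooth f"
proof -
  obtain D where D: "D 0 = g" "\<And>n x. (D n has_vector_derivative D (Suc n) x) (at x)"
    using assms unfolding smooth_def by blast
  show ?thesis unfolding smooth_def
    by (rule exI[of _ "\<lambda>n. case n of 0 \<Rightarrow> f | Suc m \<Rightarrow> D m"])
       (use D assms(2) in \<open>auto split: nat.split\<close>)
qed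

inductive_set alg_gen :: "(real \<Rightarrow> complex) set \<Rightarrow> (real \<Rightarrow> complex) set" for G where
  gen: "g \<in> G \<Longrightarrow> g \<in> alg_gen G"
| const: "(\<lambda>x. c) \<in> alg_gen G"
| add: "f \<in> alg_gen G \<Longrightarrow> g \<in> alg_gen G \<Longrightarrow> (\<lambda>x. f x + g x) \<in> alg_gen G"
| mult: "f \<in> alg_gen G \<Longrightarrow> g \<in> alg_gen G \<Longrightarrow> (\<lambda>x. f x * g x) \<in> alg_gen G"

text \<open>The sum and product rules keep derivatives inside the algebra, so it is closed under
  differentiation as soon as the derivatives of the generators lie in it;
  \<open>smooth_coinduct\<close> then applies to the whole algebra.\<close>

lemma smooth_alg_gen:
  assumes "\<And>f. f \<in> G \<Longrightarrow> \<exists>g\<in>alg_gen G. \<forall>x. (f has_vector_derivative g x) (at x)"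
    and "f \<in> alg_gen G"
  shows "smooth f"
proof (rule smooth_coinduct[OF assms(2)])
  fix f assume "f \<in> alg_gen G"
  then show "\<exists>g\<in>alg_gen G. \<forall>x. (f has_vector_derivative g x) (at x)"
  proof induction
    case (gen g) then show ?case using assms(1) by blast
  next
    case (const c)
    then show ?case by (intro bexI[of _ "\<lambda>x. 0"]) (auto intro: alg_gen.const)
  next
    case (add f g)
    then obtain f' g' where "f' \<in> alg_gen G" "g' \<in> alg_gen G"
      "\<forall>x. (f has_vector_derivative f' x) (at x)" "\<forall>x. (g has_vector_derivative g' x) (at x)" by blast
    then show ?case by (intro bexI[of _ "\<lambda>x. f' x + g' x"])
      (auto intro!: alg_gen.add has_vector_derivative_add)
  next
    case (mult f g)
    then obtain f' g' where h: "f' \<in> alg_gen G" "g' \<in> alg_gen G"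
      "\<forall>x. (f has_vector_derivative f' x) (at x)" "\<forall>x. (g has_vector_derivative g' x) (at x)" by blast
    then show ?case using mult by (intro bexI[of _ "\<lambda>x. f x * g' x + f' x * g x"])
      (auto intro!: alg_gen.add alg_gen.mult has_vector_derivative_mult)
  qed
qed

lemma smooth_imp_alg_gen_deriv:
  "smooth f \<Longrightarrow> \<exists>g\<in>alg_gen (Collect smooth). \<forall>x. (f has_vector_derivative g x) (at x)"
  by (metis smooth_derivE alg_gen.gen mem_Collect_eq)

lemma smooth_mult: "smooth f \<Longrightarrow> smooth g \<Longrightarrow> smooth (\<lambda>x. f x * g x)"
  by (rule smooth_alg_gen[of "Collect smooth"])
     (auto intro: smooth_imp_alg_gen_deriv alg_gen.mult alg_gen.gen)

lemma smooth_add: "smooth f \<Longrightarrow> smooth g \<Longrightarrow> smooth (\<lambda>x. f x + g x)"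
  by (rule smooth_alg_gen[of "Collect smooth"])
     (auto intro: smooth_imp_alg_gen_deriv alg_gen.add alg_gen.gen)

lemma smooth_const: "smooth (\<lambda>x. c)"
  by (rule smooth_alg_gen[of "{}"]) (auto intro: alg_gen.const)

lemma smooth_affine:
  assumes "smooth f" shows "smooth (\<lambda>x. f (a * x + b))"
proof -
  obtain D where D: "D 0 = f" "\<And>n x. (D n has_vector_derivative D (Suc n) x) (at x)"
    using assms unfolding smooth_def by blast
  have "((\<lambda>x. of_real (a ^ n) * D n (a * x + b)) has_vector_derivative
     of_real (a ^ Suc n) * D (Suc n) (a * x + b)) (at x)" for n x
  proof -
    have "((\<lambda>x. D n (a * x + b)) has_vector_derivative a *\<^sub>R D (Suc n) (a * x + b)) (at x)"
    proof -
      have "((\<lambda>x. a * x + b) has_vector_derivative a) (at x)"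
        unfolding has_real_derivative_iff_has_vector_derivative[symmetric]
        by (auto intro!: derivative_eq_intros)
      from vector_diff_chain_at[OF this D(2)] show ?thesis by (simp add: o_def)
    qed
    from has_vector_derivative_mult_right[OF this, of "of_real (a ^ n)"]
    show ?thesis by (simp add: scaleR_conv_of_real algebra_simps)
  qed
  then show ?thesis unfolding smooth_def
    by (intro exI[of _ "\<lambda>n x. of_real (a ^ n) * D n (a * x + b)"]) (use D(1) in auto)
qed

lemma smooth_continuous_on: "smooth f \<Longrightarrow> continuous_on A f"
  by (metis smooth_derivE has_vector_derivative_continuous continuous_at_imp_continuous_on)

text \<open>This is \<open>x^(-k) exp(-1/x)\<close> on the positive axis, extended by 0. The powers
  are included because differentiating \<open>exp(-1/x)\<close> produces them; with them the family
  generates an algebra closed under differentiation.\<close>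

definition flat :: "nat \<Rightarrow> real \<Rightarrow> complex" where
  "flat k x = (if x > 0 then of_real (inverse x ^ k / exp (inverse x)) else 0)"

lemma flat_tendsto_0: "(flat k \<longlongrightarrow> 0) (at 0)"
proof -
  have "((\<lambda>x. inverse x ^ k / exp (inverse x)) \<longlongrightarrow> (0::real)) (at_right 0)"
    using filterlim_compose[OF tendsto_power_div_exp_0 filterlim_inverse_at_top_right] .
  then have "((\<lambda>x. of_real (inverse x ^ k / exp (inverse x))) \<longlongrightarrow> (0::complex)) (at_right 0)"
    by (metis tendsto_of_real of_real_0)
  then have 1: "(flat k \<longlongrightarrow> 0) (at_right 0)"
    by (rule Lim_transform_eventually)
       (auto simp: flat_def eventually_at intro!: exI[of _ 1])
  have 2: "(flat k \<longlongrightarrow> 0) (at_left 0)"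
    by (rule Lim_transform_eventually[OF tendsto_const])
       (auto simp: flat_def eventually_at intro!: exI[of _ 1])
  from 1 2 show ?thesis by (simp add: filterlim_split_at)
qed

text \<open>Away from 0 this is a computation. At 0 the difference quotient of \<open>flat k\<close>
  is \<open>flat (Suc k)\<close> itself, whose limit is 0.\<close>

lemma flat_deriv:
  "(flat k has_vector_derivative (- of_nat k * flat (Suc k) x + flat (k + 2) x)) (at x)"
proof -
  consider "x > 0" | "x < 0" | "x = 0" by linarith
  then show ?thesis
  proof cases
    case 1
    have "((\<lambda>x. inverse x ^ k * exp (- inverse x)) has_real_derivative
       (- real k * (inverse x ^ Suc k / exp (inverse x)) + inverse x ^ (k + 2) / exp (inverse x))) (at x)"
      using 1 by (cases k) (auto intro!: derivative_eq_intros simp: divide_simps exp_minus power2_eq_square,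
        simp_all add: algebra_simps power_eq_if)
    then have "((\<lambda>x. inverse x ^ k / exp (inverse x)) has_real_derivative
       (- real k * (inverse x ^ Suc k / exp (inverse x)) + inverse x ^ (k + 2) / exp (inverse x))) (at x)"
      by (simp only: exp_minus divide_inverse)
    then have "((\<lambda>x. complex_of_real (inverse x ^ k / exp (inverse x))) has_vector_derivative
       complex_of_real (- real k * (inverse x ^ Suc k / exp (inverse x)) + inverse x ^ (k + 2) / exp (inverse x))) (at x)"
      by (rule has_vector_derivative_of_real)
    then have "((\<lambda>x. of_real (inverse x ^ k / exp (inverse x))) has_vector_derivative
       (- of_nat k * flat (Suc k) x + flat (k + 2) x)) (at x)"
      using 1 by (simp only: flat_def if_True of_real_add of_real_mult of_real_minus of_real_of_nat_eq)
    then show ?thesis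
      by (rule has_vector_derivative_transform_within_open[where S="{0<..}"])
         (use 1 in \<open>simp_all only: flat_def if_True greaterThan_iff open_greaterThan\<close>)
  next
    case 2
    have "((\<lambda>x. 0) has_vector_derivative (- of_nat k * flat (Suc k) x + flat (k + 2) x)) (at x)"
      using 2 by (simp add: flat_def)
    then show ?thesis
      by (rule has_vector_derivative_transform_within_open[where S="{..<0}"])
         (use 2 in \<open>auto simp: flat_def\<close>)
  next
    case 3
    have "((\<lambda>y. Re (flat (Suc k) y)) \<longlongrightarrow> Re 0) (at 0)"
      by (rule tendsto_Re[OF flat_tendsto_0])
    then have "((\<lambda>y. (Re (flat k y) - Re (flat k 0)) / (y - 0)) \<longlongrightarrow> Re 0) (at 0)"
      by (rule Lim_transform_eventually)
         (auto simp: flat_def eventually_at field_simps power2_eq_square intro!: exI[of _ 1])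
    then have "((\<lambda>y. Re (flat k y)) has_real_derivative 0) (at 0)"
      by (simp add: has_field_derivative_iff)
    then have "((\<lambda>y. complex_of_real (Re (flat k y))) has_vector_derivative of_real 0) (at 0)"
      by (rule has_vector_derivative_of_real)
    moreover have "complex_of_real (Re (flat k y)) = flat k y" for y by (simp add: flat_def)
    ultimately have "(flat k has_vector_derivative 0) (at 0)" by simp
    then show ?thesis using 3 by (simp add: flat_def)
  qed
qed

lemma smooth_flat: "smooth (flat k)"
proof (rule smooth_alg_gen[of "range flat"])
  fix f assume "f \<in> range flat"
  then obtain k where k: "f = flat k" by auto
  show "\<exists>g\<in>alg_gen (range flat). \<forall>x. (f has_vector_derivative g x) (at x)"
    unfolding k
    by (intro bexI[of _ "\<lambda>x. (- of_nat k) * flat (Suc k) x + flat (k + 2) x"] allI flat_deriv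
        alg_gen.add alg_gen.mult alg_gen.const alg_gen.gen rangeI)
qed (auto intro: alg_gen.gen)

definition bump :: "real \<Rightarrow> complex" where
  "bump x = flat 0 x * flat 0 (1 - x)"

lemma smooth_bump: "smooth bump"
  unfolding bump_def using smooth_mult[OF smooth_flat smooth_affine[OF smooth_flat, of 0 "-1" 1]] 
  by simp

lemma bump_real: "bump x = of_real (Re (bump x))" "Re (bump x) \<ge> 0"
  and bump_zero: "x \<le> 0 \<or> x \<ge> 1 \<Longrightarrow> bump x = 0"
  and bump_pos: "0 < x \<Longrightarrow> x < 1 \<Longrightarrow> Re (bump x) > 0"
  by (auto simp: bump_def flat_def)

text \<open>\<open>S\<close> is the normalised primitive of \<open>bump\<close>. Its derivative
  \<open>s\<close> is kept because it is a kernel of mass 1 on the unit interval, used below as a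
  mollifier.\<close>

lemma smooth_step_exists:
  obtains S s :: "real \<Rightarrow> real" where
    "smooth (\<lambda>x. of_real (S x))" "\<And>x. (S has_real_derivative s x) (at x)"
    "continuous_on UNIV s" "\<And>x. s x \<ge> 0" "\<And>x. x \<le> 0 \<Longrightarrow> S x = 0" "\<And>x. x \<ge> 1 \<Longrightarrow> S x = 1"
    "\<And>x. 0 \<le> S x" "\<And>x. S x \<le> 1" "\<And>x. x \<le> 0 \<or> x \<ge> 1 \<Longrightarrow> s x = 0"
proof -
  define b where "b x = Re (bump x)" for x
  have bc: "continuous_on A b" for A unfolding b_def
    by (intro continuous_intros smooth_continuous_on smooth_bump)
  have b0: "b x \<ge> 0" for x using bump_real by (simp add: b_def)
  have bz: "b x = 0" if "x \<le> 0 \<or> x \<ge> 1" for x using bump_zero that by (simp add: b_def)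
  define c where "c = integral {0..1} b"
  have bi: "b integrable_on {x..y}" for x y by (rule integrable_continuous_real[OF bc])
  have c: "c > 0"
  proof -
    have "c \<ge> 0" unfolding c_def by (intro integral_nonneg bi) (use b0 in auto)
    moreover have "c \<noteq> 0"
    proof
      assume "c = 0"
      then have "(b has_integral 0) (cbox 0 1)" using bi[of 0 1] unfolding c_def
        by (metis integrable_integral box_real(2))
      then have "b (1/2) = 0"
        using has_integral_0_cbox_imp_0[OF bc, of 0 1 "1/2"] b0 by auto
      then show False using bump_pos[of "1/2"] by (simp add: b_def)
    qed
    ultimately show ?thesis by simp
  qed
  define B where "B x = (if x \<le> 0 then 0 else integral {0..x} b)" for x
  \<comment> \<open>A base point far to the left puts any \<open>x\<close>, also a negative one,
    into the interior of an interval, as differentiating the integral requires.\<close>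
  have B: "B x = integral {-L..x} b" if "x \<ge> -L" "L \<ge> 0" for x L
  proof -
    have 0: "integral {-L..y} b = 0" if "y \<le> 0" for y
    proof -
      have "integral {-L..y} b = integral {-L..y} (\<lambda>x. 0)"
        by (rule integral_cong) (use that bz in auto)
      then show ?thesis by simp
    qed
    show ?thesis
    proof (cases "x \<le> 0")
      case True then show ?thesis using 0[of x] by (simp add: B_def)
    next
      case False
      have "integral {-L..0} b + integral {0..x} b = integral {-L..x} b"
        by (rule Henstock_Kurzweil_Integration.integral_combine) (use False that bi in auto)
      then show ?thesis using 0[of 0] False by (simp add: B_def)
    qed
  qed
  have Bd: "(B has_real_derivative b x) (at x)" for x
  proof -
    define L where "L = \<bar>x\<bar> + 1"
    have L: "-L < x" "x < L" "L \<ge> 0" unfolding L_def by linarith+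
    have "((\<lambda>u. integral {-L..u} b) has_real_derivative b x) (at x within {-L..L})"
      by (rule integral_has_real_derivative[OF bc]) (use L in auto)
    then have "((\<lambda>u. integral {-L..u} b) has_real_derivative b x) (at x)"
      by (subst (asm) at_within_interior) (use L in auto)
    then show ?thesis
      by (rule has_field_derivative_transform_within_open[where S="{-L<..<L}"])
         (use L(1,2) B[OF less_imp_le L(3)] in simp_all)
  qed
  have B1: "B x = c" if "x \<ge> 1" for x
  proof -
    have "integral {0..1} b + integral {1..x} b = integral {0..x} b"
      by (rule Henstock_Kurzweil_Integration.integral_combine) (use that bi in auto)
    moreover have "integral {1..x} b = integral {1..x} (\<lambda>x. 0)"
      by (rule integral_cong) (use that bz in auto)
    ultimately show ?thesis using that by (simp add: B_def c_def)
  qed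
  have Bmono: "B x \<le> B y" if "x \<le> y" for x y
    by (rule DERIV_nonneg_imp_nondecreasing[OF that]) (use Bd b0 in blast)
  have B0: "0 \<le> B x" for x using Bmono[of "min x 0" x] by (auto simp: B_def split: if_splits)
  have Bc: "B x \<le> c" for x using Bmono[of x "max x 1"] B1[of "max x 1"] by simp
  show thesis
  proof (rule that[of "\<lambda>x. B x / c" "\<lambda>x. b x / c"])
    have "((\<lambda>x. of_real (B x / c)) has_vector_derivative of_real (b x / c)) (at x)" for x
      by (rule has_vector_derivative_of_real)
         (use Bd[of x] c in \<open>auto intro!: derivative_eq_intros simp flip: has_real_derivative_iff_has_vector_derivative\<close>)
    moreover have "smooth (\<lambda>x. of_real (b x / c))"
      using smooth_mult[OF smooth_const[of "of_real (1/c)"] smooth_bump]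
      by (simp add: b_def mult.commute divide_inverse flip: bump_real(1))
    ultimately show "smooth (\<lambda>x. of_real (B x / c))" by (rule smooth_antideriv[rotated])
    show "((\<lambda>x. B x / c) has_real_derivative b x / c) (at x)" for x
      using Bd c by (auto intro!: derivative_eq_intros)
    show "continuous_on UNIV (\<lambda>x. b x / c)" using bc c by (intro continuous_intros) auto
  qed (use b0 bz B0 Bc B1 c in \<open>auto simp: B_def\<close>)
qed

section \<open>Test functions and their supports\<close>

lemma compact_supp: "compact (supp \<phi>) \<longleftrightarrow> bounded (supp \<phi>)"
  by (simp add: supp_def compact_eq_bounded_closed)

lemma test_fun_deriv:
  assumes "test_fun \<phi>"
  obtains \<phi>' where "test_fun \<phi>'" "\<And>x. (\<phi> has_vector_derivative \<phi>' x) (at x)"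
    "supp \<phi>' \<subseteq> supp \<phi>"
proof -
  have "smooth \<phi>" using assms by (simp add: test_fun_def)
  then obtain \<phi>' where d: "smooth \<phi>'" "\<And>x. (\<phi> has_vector_derivative \<phi>' x) (at x)"
    by (rule smooth_derivE) (rule that)
  have "\<phi>' x = 0" if "x \<notin> supp \<phi>" for x
  proof -
    have "((\<lambda>x. 0) has_vector_derivative \<phi>' x) (at x)"
      by (rule has_vector_derivative_transform_within_open[OF d(2), of "- supp \<phi>"])
         (use that closure_subset[of "{x. \<phi> x \<noteq> 0}"] in \<open>auto simp: supp_def\<close>)
    then show ?thesis by (metis has_vector_derivative_const vector_derivative_unique_at)
  qed
  then have "{x. \<phi>' x \<noteq> 0} \<subseteq> supp \<phi>" by auto
  then have *: "supp \<phi>' \<subseteq> supp \<phi>" unfolding supp_def by (rule closure_minimal) simp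
  moreover have "compact (supp \<phi>')"
    using * assms by (meson compact_supp bounded_subset test_fun_def)
  ultimately show thesis using d that by (auto simp: test_fun_def)
qed

lemma test_fun_support:
  assumes "test_fun \<phi>"
  obtains a b where "a < b" "\<And>x. x \<notin> {a<..<b} \<Longrightarrow> \<phi> x = 0"
proof -
  have "bounded (supp \<phi>)" using assms by (auto simp: test_fun_def compact_imp_bounded)
  then obtain B where B: "\<And>x. x \<in> supp \<phi> \<Longrightarrow> \<bar>x\<bar> \<le> B" unfolding bounded_iff by auto
  have "\<phi> x = 0" if "x \<notin> {- \<bar>B\<bar> - 1<..<\<bar>B\<bar> + 1}" for x
  proof (rule ccontr)
    assume "\<phi> x \<noteq> 0"
    then have "x \<in> supp \<phi>" using closure_subset[of "{x. \<phi> x \<noteq> 0}"] by (auto simp: supp_def)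
    then show False using B[of x] that by auto
  qed
  then show thesis by (intro that[of "- \<bar>B\<bar> - 1" "\<bar>B\<bar> + 1"]) auto
qed

lemma test_fun_continuous: "test_fun \<phi> \<Longrightarrow> continuous_on A \<phi>"
  by (simp add: smooth_continuous_on test_fun_def)

lemma test_fun_borel: "test_fun \<phi> \<Longrightarrow> \<phi> \<in> borel_measurable borel"
  by (simp add: borel_measurable_continuous_onI test_fun_continuous)

lemma test_fun_bounded:
  assumes "test_fun \<phi>" obtains B where "\<And>x. cmod (\<phi> x) \<le> B" "B \<ge> 0"
proof -
  obtain a b where "a < b" and ab: "\<And>x. x \<notin> {a<..<b} \<Longrightarrow> \<phi> x = 0" by (rule test_fun_support[OF assms]) (rule that)
  have "bounded (\<phi> ` {a..b})"
    by (intro compact_imp_bounded compact_continuous_image test_fun_continuous assms) auto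
  then obtain B where "\<forall>y\<in>\<phi> ` {a..b}. cmod y \<le> B" unfolding bounded_iff by blast
  then have B: "cmod (\<phi> x) \<le> B" if "x \<in> {a..b}" for x using that by blast
  have "cmod (\<phi> x) \<le> \<bar>B\<bar>" for x using B[of x] ab[of x] by (cases "x \<in> {a<..<b}") auto
  then show thesis by (intro that[of "\<bar>B\<bar>"]) auto
qed

lemma test_fun_shift: "test_fun \<phi> \<Longrightarrow> test_fun (\<lambda>x. \<phi> (x + c))"
proof -
  assume t: "test_fun \<phi>"
  obtain a b where "a < b" and ab: "\<And>x. x \<notin> {a<..<b} \<Longrightarrow> \<phi> x = 0" by (rule test_fun_support[OF t]) (rule that)
  have "supp (\<lambda>x. \<phi> (x + c)) \<subseteq> {a - c..b - c}"
    unfolding supp_def 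
  proof (rule closure_minimal)
    show "{x. \<phi> (x + c) \<noteq> 0} \<subseteq> {a - c..b - c}"
    proof
      fix x assume "x \<in> {x. \<phi> (x + c) \<noteq> 0}"
      then have "x + c \<in> {a<..<b}" using ab[of "x + c"] by auto
      then show "x \<in> {a - c..b - c}" by auto
    qed
  qed simp
  then have "compact (supp (\<lambda>x. \<phi> (x + c)))" 
    by (meson compact_supp bounded_subset bounded_closed_interval)
  then show ?thesis using t smooth_affine[of \<phi> 1 c] by (simp add: test_fun_def)
qed

text \<open>With \<open>N = Suc n\<close> the kernel \<open>N s(N (x - a) + 1)\<close> has mass 1
  and lives on the interval from \<open>a - 1/N\<close> to \<open>a\<close>, hence it sees
  \<open>u\<close> only to the left of \<open>a\<close>. Substituting
  \<open>y = N (x - a) + 1\<close> fixes the kernel and moves the scaling into the argument of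
  \<open>u\<close>, where dominated convergence applies.\<close>

lemma mollified_left_limit:
  fixes u :: "real \<Rightarrow> complex" and s :: "real \<Rightarrow> real"
  assumes s: "s \<in> borel_measurable borel" "\<And>x. s x \<ge> 0" "\<And>x. x \<le> 0 \<or> x \<ge> 1 \<Longrightarrow> s x = 0"
    and s1: "integrable lborel s" "integral\<^sup>L lborel s = 1"
    and u: "u \<in> borel_measurable borel" "\<And>x. x \<in> {a - 1..a} \<Longrightarrow> cmod (u x) \<le> B"
    and lim: "(u \<longlongrightarrow> l) (at_left a)"
  shows "integrable lborel (\<lambda>x. u x * of_real (Suc n * s (Suc n * (x - a) + 1)))"
    and "(\<lambda>n. \<integral>x. u x * of_real (Suc n * s (Suc n * (x - a) + 1)) \<partial>lborel) \<longlonglongrightarrow> l"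
proof -
  have [measurable]: "s \<in> borel_measurable borel" "u \<in> borel_measurable borel" by fact+
  define N where "N n = real (Suc n)" for n
  have N: "N n > 0" "N n \<ge> 1" "N n \<noteq> 0" for n by (auto simp: N_def)
  let ?f = "\<lambda>n y. u (a - 1 / N n + 1 / N n * y) * of_real (s y)"
  let ?g = "\<lambda>n x. u x * of_real (N n * s (N n * (x - a) + 1))"
  have shift: "a - 1 / N n + 1 / N n * y = a - (1 - y) * (1 / N n)" for n y
    by (simp add: left_diff_distrib diff_divide_distrib)
  have bnd: "cmod (?f n y) \<le> B * s y" for n y
  proof (cases "0 < y \<and> y < 1")
    case True
    have "(1 - y) * (1 / N n) \<le> 1 * 1" by (rule mult_mono) (use True N[of n] in auto)
    moreover have "0 \<le> (1 - y) * (1 / N n)" using True N[of n] by (intro mult_nonneg_nonneg) auto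
    ultimately have "a - (1 - y) * (1 / N n) \<in> {a - 1..a}" by simp
    from u(2)[OF this] show ?thesis using s(2)[of y] unfolding shift norm_mult norm_of_real
      by (simp only: abs_of_nonneg mult_right_mono)
  next
    case False then show ?thesis using s(3)[of y] by auto
  qed
  have fm: "?f n \<in> borel_measurable borel" for n by measurable
  have Bs: "integrable lborel (\<lambda>y. B * s y)" using s1 by simp
  have fi: "integrable lborel (?f n)" for n
  proof (rule Bochner_Integration.integrable_bound[OF Bs])
    show "?f n \<in> borel_measurable lborel" using fm by simp
    show "AE y in lborel. cmod (?f n y) \<le> norm (B * s y)"
      using order_trans[OF bnd abs_ge_self] by (intro AE_I2) (simp only: real_norm_def)
  qed
  have eq: "?g n (a - 1 / N n + 1 / N n * y) = N n * ?f n y" for n y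
  proof -
    have "N n * (a - 1 / N n + 1 / N n * y - a) + 1 = y"
      using N(1)[of n] by (simp add: distrib_left right_diff_distrib)
    then show ?thesis by (simp only: of_real_mult mult_ac)
  qed
  have gi: "integrable lborel (?g n)" for n
  proof -
    have "integrable lborel (\<lambda>y. ?g n (a - 1 / N n + 1 / N n * y))"
      unfolding eq using fi[of n] by (rule integrable_mult_right)
    then show ?thesis
      using lborel_integrable_real_affine_iff[of "1 / N n" "?g n" "a - 1 / N n"] N(1)[of n] by simp
  qed
  then show "integrable lborel (\<lambda>x. u x * of_real (Suc n * s (Suc n * (x - a) + 1)))"
    unfolding N_def .
  have ge: "integral\<^sup>L lborel (?g n) = integral\<^sup>L lborel (?f n)" for n
  proof -
    have "integral\<^sup>L lborel (?g n) = \<bar>1 / N n\<bar> *\<^sub>R (\<integral>y. ?g n (a - 1 / N n + 1 / N n * y) \<partial>lborel)"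
      by (rule lborel_integral_real_affine) (use N(1)[of n] in simp)
    also have "\<dots> = integral\<^sup>L lborel (?f n)" unfolding eq integral_mult_right_zero
      using N(1)[of n] by (simp add: scaleR_conv_of_real)
    finally show ?thesis .
  qed
  have "(\<lambda>n. integral\<^sup>L lborel (?f n)) \<longlonglongrightarrow> (\<integral>y. l * of_real (s y) \<partial>lborel)"
  proof (rule integral_dominated_convergence[where w="\<lambda>y. B * s y"])
    show "AE y in lborel. (\<lambda>n. ?f n y) \<longlonglongrightarrow> l * of_real (s y)"
    proof (rule AE_I2)
      fix y
      show "(\<lambda>n. ?f n y) \<longlonglongrightarrow> l * of_real (s y)"
      proof (cases "0 < y \<and> y < 1")
        case True
        have "(\<lambda>n. 1 / N n) \<longlonglongrightarrow> 0" unfolding N_def by (rule LIMSEQ_Suc[OF lim_const_over_n])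
        then have "(\<lambda>n. a - (1 - y) * (1 / N n)) \<longlonglongrightarrow> a - (1 - y) * 0"
          by (intro tendsto_intros)
        then have "filterlim (\<lambda>n. a - (1 - y) * (1 / N n)) (at_left a) sequentially"
          using True N by (auto simp: filterlim_at intro!: always_eventually)
        from filterlim_compose[OF lim this]
        show ?thesis unfolding shift by (intro tendsto_mult tendsto_const) 
      next
        case False then have "s y = 0" using s(3) by force
        then show ?thesis by simp
      qed
    qed
    show "(\<lambda>y. l * of_real (s y)) \<in> borel_measurable lborel" by simp
    show "?f n \<in> borel_measurable lborel" for n using fm by simp
    show "AE y in lborel. cmod (?f n y) \<le> B * s y" for n using bnd by (rule AE_I2)
  qed (rule Bs)
  moreover have "(\<integral>y. l * of_real (s y) \<partial>lborel) = l" using s1 by simp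
  ultimately show "(\<lambda>n. \<integral>x. u x * of_real (Suc n * s (Suc n * (x - a) + 1)) \<partial>lborel) \<longlonglongrightarrow> l"
    unfolding N_def[symmetric] ge by (simp only:)
qed

text \<open>\<open>\<phi> n\<close> is the difference of two rescaled smooth steps that rise just to
  the left of \<open>a\<close> and of \<open>b\<close>. This placement makes the limit the half-open
  interval \<open>{a..<b}\<close> and makes the derivatives pick out left limits, in accordance with
  the left-continuous primitives used below.\<close>

lemma interval_test_funs:
  fixes a b :: real
  assumes "a < b"
  obtains \<phi> :: "nat \<Rightarrow> real \<Rightarrow> complex" where
    "\<And>n. test_fun (\<phi> n)"
    "\<And>n x. cmod (\<phi> n x) \<le> indicator {a - 1..b} x"
    "\<And>x. (\<lambda>n. \<phi> n x) \<longlonglongrightarrow> indicator {a..<b} x"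
    "\<forall>u la lb B. u \<in> borel_measurable borel \<longrightarrow> (\<forall>x\<in>{a - 1..b}. cmod (u x) \<le> B) \<longrightarrow>
       (u \<longlongrightarrow> la) (at_left a) \<longrightarrow> (u \<longlongrightarrow> lb) (at_left b) \<longrightarrow>
       (\<lambda>n. \<integral>x. u x * vector_derivative (\<phi> n) (at x) \<partial>lborel) \<longlonglongrightarrow> la - lb"
proof -
  obtain S s where S: "smooth (\<lambda>x. complex_of_real (S x))" and Sd: "\<And>x. (S has_real_derivative s x) (at x)"
    and sc: "continuous_on UNIV s" and s0: "\<And>x. s x \<ge> 0" and S0: "\<And>x. x \<le> 0 \<Longrightarrow> S x = 0"
    and S1: "\<And>x. x \<ge> 1 \<Longrightarrow> S x = 1" and Sb: "\<And>x. 0 \<le> S x" "\<And>x. S x \<le> 1"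
    and sz: "\<And>x. x \<le> 0 \<or> x \<ge> 1 \<Longrightarrow> s x = 0"
    by (rule smooth_step_exists) (rule that)
  have sm[measurable]: "s \<in> borel_measurable borel" using sc by (rule borel_measurable_continuous_onI)
  have "has_bochner_integral lborel (\<lambda>x. s x * indicator {0..1} x) (S 1 - S 0)"
    by (rule has_bochner_integral_FTC_Icc_real)
       (use Sd sc in \<open>auto simp: continuous_on_eq_continuous_at\<close>)
  moreover have "(\<lambda>x. s x * indicator {0..1} x) = s" proof
    show "s x * indicator {0..1} x = s x" for x using sz[of x] by (cases "x \<in> {0..1}") auto
  qed
  ultimately have si: "integrable lborel s" "integral\<^sup>L lborel s = 1"
    using S0[of 0] S1[of 1] by (auto simp: has_bochner_integral_iff)
  define \<phi> where "\<phi> n x = complex_of_real (S (Suc n * (x - a) + 1)) - of_real (S (Suc n * (x - b) + 1))" for n x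
  have out: "\<phi> n x = 0" if "x \<notin> {a - 1..b}" for n x
  proof (cases "x > b")
    case True
    then have "Suc n * (x - a) \<ge> 0" "Suc n * (x - b) \<ge> 0" using assms by auto
    then show ?thesis by (simp add: \<phi>_def S1)
  next
    case False
    then have x: "x < a - 1" using that by auto
    have "Suc n * (x - c) + 1 \<le> 0" if "c \<ge> a" for c :: real
    proof -
      have "x - c \<le> -1" using x that by simp
      then have "Suc n * (x - c) \<le> real (Suc n) * (-1)" by (intro mult_left_mono) auto
      then show ?thesis by simp
    qed
    from this[of a] this[of b] show ?thesis using assms by (simp add: \<phi>_def S0)
  qed
  have tf: "test_fun (\<phi> n)" for n
  proof -
    have "supp (\<phi> n) \<subseteq> {a - 1..b}" unfolding supp_def
    proof (rule closure_minimal)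
      show "{x. \<phi> n x \<noteq> 0} \<subseteq> {a - 1..b}" using out by blast
    qed simp
    then have "compact (supp (\<phi> n))" 
      by (meson compact_supp bounded_subset bounded_closed_interval)
    moreover have "smooth (\<phi> n)"
    proof -
      have "smooth (\<lambda>x. complex_of_real (S (Suc n * x + (1 - Suc n * a))) + (-1) * of_real (S (Suc n * x + (1 - Suc n * b))))"
        using smooth_affine[OF S] by (intro smooth_add smooth_mult smooth_const)
      then show ?thesis by (simp add: \<phi>_def[abs_def] algebra_simps)
    qed
    ultimately show ?thesis by (simp add: test_fun_def)
  qed
  have le1: "cmod (\<phi> n x) \<le> 1" for n x
  proof -
    have "\<phi> n x = of_real (S (Suc n * (x - a) + 1) - S (Suc n * (x - b) + 1))"
      by (simp add: \<phi>_def)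
    then have "cmod (\<phi> n x) = \<bar>S (Suc n * (x - a) + 1) - S (Suc n * (x - b) + 1)\<bar>"
      using norm_of_real by metis
    then show ?thesis using Sb[of "Suc n * (x - a) + 1"] Sb[of "Suc n * (x - b) + 1"] by linarith
  qed
  have step: "(\<lambda>n. complex_of_real (S (Suc n * (x - c) + 1))) \<longlonglongrightarrow> indicator {c..} x" for x c :: real
  proof (cases "x \<ge> c")
    case True
    then have "S (Suc n * (x - c) + 1) = 1" for n by (intro S1) simp
    then show ?thesis using True by simp
  next
    case False
    then obtain N :: nat where N: "N * (c - x) > 1" using ex_less_of_nat_mult[of "c - x" 1] by auto
    have "S (Suc n * (x - c) + 1) = 0" if "n \<ge> N" for n
    proof (rule S0)
      have "N * (c - x) \<le> Suc n * (c - x)" using that False by (intro mult_right_mono) auto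
      then show "Suc n * (x - c) + 1 \<le> 0" using N by (simp add: algebra_simps)
    qed
    then have "eventually (\<lambda>n. complex_of_real (S (Suc n * (x - c) + 1)) = 0) sequentially"
      by (auto simp: eventually_sequentially intro!: exI[of _ N])
    then show ?thesis using False by (simp add: tendsto_eventually)
  qed
  have vd: "vector_derivative (\<phi> n) (at x) = of_real (Suc n * s (Suc n * (x - a) + 1)) - of_real (Suc n * s (Suc n * (x - b) + 1))" for n x
  proof (rule vector_derivative_at)
    have "((\<lambda>x. S (Suc n * (x - c) + 1)) has_real_derivative Suc n * s (Suc n * (x - c) + 1)) (at x)" for c
      by (rule DERIV_cong, rule DERIV_chain'[OF _ Sd]) (auto intro!: derivative_eq_intros)
    then show "(\<phi> n has_vector_derivative of_real (Suc n * s (Suc n * (x - a) + 1)) - of_real (Suc n * s (Suc n * (x - b) + 1))) (at x)"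
      unfolding \<phi>_def[abs_def] by (intro has_vector_derivative_diff has_vector_derivative_of_real)
  qed
  show thesis
  proof (rule that[of \<phi>])
    show "test_fun (\<phi> n)" for n by (rule tf)
    show "cmod (\<phi> n x) \<le> indicator {a - 1..b} x" for n x
      using le1[of n x] out[of x n] by (auto simp: indicator_def)
    show "(\<lambda>n. \<phi> n x) \<longlonglongrightarrow> indicator {a..<b} x" for x
    proof -
      have "(\<lambda>n. \<phi> n x) \<longlonglongrightarrow> indicator {a..} x - indicator {b..} x"
        unfolding \<phi>_def by (intro tendsto_diff step)
      moreover have "indicator {a..} x - indicator {b..} x = (indicator {a..<b} x :: complex)"
        using assms by (auto simp: indicator_def)
      ultimately show ?thesis by simp
    qed
    show "\<forall>u la lb B. u \<in> borel_measurable borel \<longrightarrow> (\<forall>x\<in>{a - 1..b}. cmod (u x) \<le> B) \<longrightarrow>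
       (u \<longlongrightarrow> la) (at_left a) \<longrightarrow> (u \<longlongrightarrow> lb) (at_left b) \<longrightarrow>
       (\<lambda>n. \<integral>x. u x * vector_derivative (\<phi> n) (at x) \<partial>lborel) \<longlonglongrightarrow> la - lb"
    proof (intro allI impI)
      fix u :: "real \<Rightarrow> complex" and la lb B
      assume u: "u \<in> borel_measurable borel" "\<forall>x\<in>{a - 1..b}. cmod (u x) \<le> B"
        and la: "(u \<longlongrightarrow> la) (at_left a)" and lb: "(u \<longlongrightarrow> lb) (at_left b)"
      have ua: "\<And>x. x \<in> {a - 1..a} \<Longrightarrow> cmod (u x) \<le> B" and ub: "\<And>x. x \<in> {b - 1..b} \<Longrightarrow> cmod (u x) \<le> B"
        using u(2) assms by auto
      note A = mollified_left_limit[OF sm s0 sz si u(1) ua la]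
      note B = mollified_left_limit[OF sm s0 sz si u(1) ub lb]
      have "(\<integral>x. u x * vector_derivative (\<phi> n) (at x) \<partial>lborel) =
        (\<integral>x. u x * of_real (Suc n * s (Suc n * (x - a) + 1)) \<partial>lborel) -
        (\<integral>x. u x * of_real (Suc n * s (Suc n * (x - b) + 1)) \<partial>lborel)" for n
      proof -
        have "(\<integral>x. u x * vector_derivative (\<phi> n) (at x) \<partial>lborel) =
          (\<integral>x. u x * of_real (Suc n * s (Suc n * (x - a) + 1)) - u x * of_real (Suc n * s (Suc n * (x - b) + 1)) \<partial>lborel)"
          unfolding vd by (rule Bochner_Integration.integral_cong[OF refl]) (rule right_diff_distrib)
        also have "\<dots> = (\<integral>x. u x * of_real (Suc n * s (Suc n * (x - a) + 1)) \<partial>lborel) -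
          (\<integral>x. u x * of_real (Suc n * s (Suc n * (x - b) + 1)) \<partial>lborel)"
          by (rule Bochner_Integration.integral_diff[OF A(1)[of n] B(1)[of n]])
        finally show ?thesis .
      qed
      then show "(\<lambda>n. \<integral>x. u x * vector_derivative (\<phi> n) (at x) \<partial>lborel) \<longlonglongrightarrow> la - lb"
        using tendsto_diff[OF A(2) B(2)] by simp
    qed
  qed
qed

section \<open>Primitives with respect to a locally finite measure\<close>

definition locally_finite :: "real measure \<Rightarrow> bool" where
  "locally_finite P \<longleftrightarrow> sets P = sets borel \<and> (\<forall>a b. emeasure P {a..b} < \<infinity>)"

definition loc_int :: "real measure \<Rightarrow> (real \<Rightarrow> 'b::{banach, second_countable_topology}) \<Rightarrow> bool" where
  "loc_int P f \<longleftrightarrow> f \<in> borel_measurable borel \<and> (\<forall>a b. set_integrable P {a..<b} f)"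

definition loc_bounded :: "(real \<Rightarrow> 'b::real_normed_vector) \<Rightarrow> bool" where
  "loc_bounded f \<longleftrightarrow> (\<forall>a b. \<exists>B. \<forall>x\<in>{a..b}. norm (f x) \<le> B)"

definition atom :: "real measure \<Rightarrow> real \<Rightarrow> real" where
  "atom P x = measure P {x}"

text \<open>The left-continuous functions \<open>v\<close> with \<open>dv = f dP\<close>.\<close>

definition prim :: "real measure \<Rightarrow> (real \<Rightarrow> complex) \<Rightarrow> (real \<Rightarrow> complex) \<Rightarrow> bool" where
  "prim P v f \<longleftrightarrow> loc_int P f \<and> (\<forall>a b. a \<le> b \<longrightarrow> v b - v a = (LINT x:{a..<b}|P. f x))"

lemma locally_finiteD:
  assumes "locally_finite P"
  shows "sets P = sets borel" "space P = UNIV" "emeasure P {a..b} < \<infinity>" "emeasure P {a..<b} < \<infinity>"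
    "emeasure P {x} < \<infinity>" "borel_measurable P = borel_measurable borel"
proof -
  show s: "sets P = sets borel" and f: "emeasure P {a..b} < \<infinity>" for a b
    using assms by (auto simp: locally_finite_def)
  show "space P = UNIV" using sets_eq_imp_space_eq[OF s] by simp
  have "emeasure P {a..<b} \<le> emeasure P {a..b}" by (rule emeasure_mono) (auto simp: s)
  then show "emeasure P {a..<b} < \<infinity>" using f[of a b] by (rule order_le_less_trans)
  show "emeasure P {x} < \<infinity>" using f[of x x] by simp
  show "borel_measurable P = borel_measurable borel"
    by (rule measurable_cong_sets) (auto simp: s)
qed

lemma locally_finite_sigma_finite:
  assumes "locally_finite P" shows "sigma_finite_measure P"
proof
  note P = locally_finiteD[OF assms]
  have "(\<Union>n::nat. {- real n..real n}) = (UNIV :: real set)"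
  proof (rule UNIV_eq_I[symmetric])
    fix x :: real
    obtain n :: nat where "\<bar>x\<bar> \<le> real n" using real_arch_simple by blast
    then show "x \<in> (\<Union>n::nat. {- real n..real n})" by (intro UN_I[of n]) auto
  qed
  moreover have "emeasure P {- real n..real n} \<noteq> \<infinity>" for n using P(3)[of "- real n" "real n"] by simp
  ultimately show "\<exists>A. countable A \<and> A \<subseteq> sets P \<and> \<Union>A = space P \<and> (\<forall>a\<in>A. emeasure P a \<noteq> \<infinity>)"
    using P by (intro exI[of _ "range (\<lambda>n::nat. {- real n..real n})"])
       auto
qed

lemma loc_int_measurable: "loc_int P f \<Longrightarrow> f \<in> borel_measurable borel"
  by (simp add: loc_int_def)

lemma loc_intD: "loc_int P f \<Longrightarrow> set_integrable P {a..<b} f"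
  by (simp add: loc_int_def)

lemma loc_int_add: "loc_int P f \<Longrightarrow> loc_int P g \<Longrightarrow> loc_int P (\<lambda>x. f x + g x)"
  by (auto simp: loc_int_def)

lemma loc_int_diff: "loc_int P f \<Longrightarrow> loc_int P g \<Longrightarrow> loc_int P (\<lambda>x. f x - g x)"
  by (auto simp: loc_int_def)

lemma loc_int_norm: "loc_int P f \<Longrightarrow> loc_int P (\<lambda>x. norm (f x))"
  by (auto simp: loc_int_def intro: set_integrable_norm)

lemma loc_int_bound:
  assumes P: "locally_finite P" and f: "loc_int P f" and g: "g \<in> borel_measurable borel"
    and le: "\<And>a b. \<exists>C. \<forall>x\<in>{a..b}. norm (g x) \<le> C * norm (f x)"
  shows "loc_int P g"
  unfolding loc_int_def
proof (intro conjI allI g)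
  fix a b :: real
  obtain C where C: "\<forall>x\<in>{a..b}. norm (g x) \<le> C * norm (f x)" using le by metis
  have "set_integrable P {a..<b} (\<lambda>x. C * norm (f x))"
    using loc_intD[OF loc_int_norm[OF f]] by simp
  then show "set_integrable P {a..<b} g"
  proof (rule set_integrable_bound)
    show "set_borel_measurable P {a..<b} g"
      using g locally_finiteD[OF P] unfolding set_borel_measurable_def by simp
    show "AE x in P. x \<in> {a..<b} \<longrightarrow> norm (g x) \<le> norm (C * norm (f x))"
    proof (intro AE_I2 impI)
      fix x assume "x \<in> {a..<b}"
      then have "norm (g x) \<le> C * norm (f x)" using C by simp
      then show "norm (g x) \<le> norm (C * norm (f x))" by simp
    qed
  qed
qed

lemma loc_int_mult:
  fixes f g :: "real \<Rightarrow> complex"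
  assumes P: "locally_finite P" and f: "loc_int P f"
    and g: "g \<in> borel_measurable borel" "loc_bounded g"
  shows "loc_int P (\<lambda>x. g x * f x)"
proof (rule loc_int_bound[OF P f])
  show "(\<lambda>x. g x * f x) \<in> borel_measurable borel"
    using g(1) loc_int_measurable[OF f] by simp
  fix a b
  obtain B where B: "\<forall>x\<in>{a..b}. norm (g x) \<le> B" using g(2) unfolding loc_bounded_def by metis
  show "\<exists>C. \<forall>x\<in>{a..b}. norm (g x * f x) \<le> C * norm (f x)"
    by (rule exI[of _ B]) (use B in \<open>auto simp: norm_mult intro!: mult_right_mono\<close>)
qed

lemma loc_int_const:
  assumes "locally_finite P" shows "loc_int P (\<lambda>x. c)"
proof -
  note P = locally_finiteD[OF assms]
  have "set_integrable P {a..<b} (\<lambda>x. c)" for a b unfolding set_integrable_def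
    using P by (intro integrable_scaleR_left integrable_real_indicator) auto
  then show ?thesis by (simp add: loc_int_def)
qed

lemma loc_int_loc_bounded:
  fixes g :: "real \<Rightarrow> complex"
  assumes P: "locally_finite P" and g: "g \<in> borel_measurable borel" "loc_bounded g"
  shows "loc_int P g"
  using loc_int_mult[OF P loc_int_const[OF P, of 1] g] by simp

lemma loc_bounded_add: "loc_bounded f \<Longrightarrow> loc_bounded g \<Longrightarrow> loc_bounded (\<lambda>x. f x + g x)"
  unfolding loc_bounded_def by (meson norm_triangle_mono)

lemma loc_bounded_mult:
  fixes f g :: "real \<Rightarrow> complex"
  assumes "loc_bounded f" "loc_bounded g" shows "loc_bounded (\<lambda>x. f x * g x)"
  unfolding loc_bounded_def
proof (intro allI)
  fix a b
  obtain B where B: "\<forall>x\<in>{a..b}. norm (f x) \<le> B" using assms unfolding loc_bounded_def by metis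
  obtain C where C: "\<forall>x\<in>{a..b}. norm (g x) \<le> C" using assms unfolding loc_bounded_def by metis
  have "norm (f x * g x) \<le> \<bar>B\<bar> * \<bar>C\<bar>" if "x \<in> {a..b}" for x
  proof -
    have "norm (f x) \<le> \<bar>B\<bar>" "norm (g x) \<le> \<bar>C\<bar>"
      using B C that by (meson order_trans abs_ge_self)+
    then show ?thesis unfolding norm_mult by (intro mult_mono) auto
  qed
  then show "\<exists>B. \<forall>x\<in>{a..b}. norm (f x * g x) \<le> B" by blast
qed

lemma loc_bounded_const: "loc_bounded (\<lambda>x. c)"
  unfolding loc_bounded_def by blast

lemma set_integral_split:
  fixes f :: "real \<Rightarrow> 'b::{banach, second_countable_topology}"
  assumes "loc_int P f" "a \<le> b" "b \<le> c"
  shows "(LINT x:{a..<c}|P. f x) = (LINT x:{a..<b}|P. f x) + (LINT x:{b..<c}|P. f x)"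
proof -
  have "{a..<c} = {a..<b} \<union> {b..<c}" using assms by auto
  then show ?thesis using set_integral_Un[of "{a..<b}" "{b..<c}" P f] loc_intD[OF assms(1)] by simp
qed

lemma norm_set_integral_le:
  fixes f :: "real \<Rightarrow> complex"
  assumes "loc_int P f"
  shows "cmod (LINT x:{a..<b}|P. f x) \<le> (LINT x:{a..<b}|P. cmod (f x))"
  by (rule set_integral_norm_bound) (rule loc_intD[OF assms])

lemma set_integral_nonneg_mono:
  fixes f :: "real \<Rightarrow> real"
  assumes f: "loc_int P f" "\<And>x. f x \<ge> 0" and P: "locally_finite P" and "a' \<le> a" "b \<le> b'"
  shows "(LINT x:{a..<b}|P. f x) \<le> (LINT x:{a'..<b'}|P. f x)"
  unfolding set_lebesgue_integral_def
proof (rule integral_mono)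
  show "integrable P (\<lambda>x. indicat_real {a..<b} x *\<^sub>R f x)" "integrable P (\<lambda>x. indicat_real {a'..<b'} x *\<^sub>R f x)"
    using loc_intD[OF f(1)] unfolding set_integrable_def by blast+
  show "indicat_real {a..<b} x *\<^sub>R f x \<le> indicat_real {a'..<b'} x *\<^sub>R f x" for x
    using f(2)[of x] assms(4,5) by (auto simp: indicator_def)
qed

lemma prim_loc_int: "prim P v f \<Longrightarrow> loc_int P f"
  by (simp add: prim_def)

lemma primD: "prim P v f \<Longrightarrow> a \<le> b \<Longrightarrow> v b - v a = (LINT x:{a..<b}|P. f x)"
  by (simp add: prim_def)

lemma prim_exists:
  assumes "loc_int P f"
  obtains v where "prim P v f" "v c = z"
proof -
  define F where "F x = (if x \<ge> c then z + (LINT t:{c..<x}|P. f t) else z - (LINT t:{x..<c}|P. f t))" for x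
  have "F b - F a = (LINT x:{a..<b}|P. f x)" if "a \<le> b" for a b
  proof -
    consider "c \<le> a" | "a < c" "c \<le> b" | "b < c" using that by linarith
    then show ?thesis
    proof cases
      case 1 then show ?thesis using set_integral_split[OF assms 1 that] that by (simp add: F_def)
    next
      case 2 then show ?thesis using set_integral_split[OF assms, of a c b] by (simp add: F_def)
    next
      case 3 then show ?thesis using set_integral_split[OF assms that, of c] that by (simp add: F_def)
    qed
  qed
  then have "prim P F f" using assms by (simp add: prim_def)
  moreover have "F c = z" by (simp add: F_def set_lebesgue_integral_def)
  ultimately show thesis by (rule that)
qed

lemma prim_add: "prim P v f \<Longrightarrow> prim P z g \<Longrightarrow> prim P (\<lambda>x. v x + z x) (\<lambda>x. f x + g x)"
  unfolding prim_def using loc_int_add by (auto simp: loc_intD set_integral_add algebra_simps)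

lemma prim_cmult: "prim P v f \<Longrightarrow> prim P (\<lambda>x. c * v x) (\<lambda>x. c * f x)"
  unfolding prim_def loc_int_def by (auto simp: right_diff_distrib[symmetric])

lemma prim_diff: "prim P v f \<Longrightarrow> prim P z g \<Longrightarrow> prim P (\<lambda>x. v x - z x) (\<lambda>x. f x - g x)"
  using prim_add[of P v f "\<lambda>x. -1 * z x" "\<lambda>x. -1 * g x"] prim_cmult[of P z g "-1"] by simp

lemma prim_cnj: "prim P v f \<Longrightarrow> prim P (\<lambda>x. cnj (v x)) (\<lambda>x. cnj (f x))"
proof -
  assume p: "prim P v f"
  have "set_integrable P {a..<b} (\<lambda>x. cnj (f x))" for a b
  proof -
    have "integrable P (\<lambda>x. cnj (indicator {a..<b} x *\<^sub>R f x))"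
      using loc_intD[OF prim_loc_int[OF p]] unfolding set_integrable_def by (simp only: complex_integrable_cnj)
    then show ?thesis unfolding set_integrable_def by simp
  qed
  moreover have "cnj (v b) - cnj (v a) = (LINT x:{a..<b}|P. cnj (f x))" if "a \<le> b" for a b
  proof -
    have "cnj (v b) - cnj (v a) = cnj (LINT x:{a..<b}|P. f x)" using primD[OF p that] by (metis complex_cnj_diff)
    also have "\<dots> = (\<integral>x. cnj (indicator {a..<b} x *\<^sub>R f x) \<partial>P)"
      unfolding set_lebesgue_integral_def by (rule Bochner_Integration.integral_cnj[symmetric])
    finally show ?thesis by (simp add: set_lebesgue_integral_def)
  qed
  moreover have "(\<lambda>x. cnj (f x)) \<in> borel_measurable borel"
    by (rule measurable_compose[OF loc_int_measurable[OF prim_loc_int[OF p]]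
          borel_measurable_continuous_onI[OF continuous_on_cnj[OF continuous_on_id]]])
  ultimately show ?thesis by (simp add: prim_def loc_int_def)
qed

lemma prim_norm_diff_le:
  "prim P v f \<Longrightarrow> a \<le> b \<Longrightarrow> cmod (v b - v a) \<le> (LINT x:{a..<b}|P. cmod (f x))"
  by (metis primD norm_set_integral_le prim_loc_int)

lemma prim_loc_bounded:
  assumes P: "locally_finite P" and p: "prim P v f" shows "loc_bounded v"
  unfolding loc_bounded_def
proof (intro allI exI ballI)
  fix a b x :: real assume x: "x \<in> {a..b}"
  have "cmod (v x) \<le> cmod (v a) + cmod (v x - v a)" by (metis add.commute diff_add_cancel norm_triangle_ineq)
  also have "cmod (v x - v a) \<le> (LINT x:{a..<x}|P. cmod (f x))" using prim_norm_diff_le[OF p] x by simp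
  also have "\<dots> \<le> (LINT x:{a..<b}|P. cmod (f x))"
    by (rule set_integral_nonneg_mono[OF loc_int_norm[OF prim_loc_int[OF p]] _ P]) (use x in auto)
  finally show "cmod (v x) \<le> cmod (v a) + (LINT x:{a..<b}|P. cmod (f x))" by simp
qed

lemma prim_left_cont:
  assumes P: "locally_finite P" and p: "prim P v f"
  shows "(v \<longlongrightarrow> v x) (at_left (x::real))"
  unfolding tendsto_at_iff_sequentially
proof (intro allI impI)
  fix X :: "nat \<Rightarrow> real" assume X: "\<forall>i. X i \<in> {..<x} - {x}" and lim: "X \<longlonglongrightarrow> x"
  note Pd = locally_finiteD[OF P]
  have "Bseq X" using lim by (metis convergentI convergent_imp_Bseq)
  then obtain K where K: "\<And>n. \<bar>X n\<bar> \<le> K" unfolding Bseq_def by auto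
  have Kx: "- K \<le> X n" for n using K[of n] by linarith
  have fm: "f \<in> borel_measurable P" using loc_int_measurable[OF prim_loc_int[OF p]] Pd by simp
  have "(\<lambda>n. \<integral>t. indicator {X n..<x} t *\<^sub>R f t \<partial>P) \<longlonglongrightarrow> (\<integral>t. 0 \<partial>P)"
  proof (rule integral_dominated_convergence[where w="\<lambda>t. indicator {-K..<x} t *\<^sub>R cmod (f t)"])
    show "integrable P (\<lambda>t. indicator {-K..<x} t *\<^sub>R cmod (f t))"
      using loc_intD[OF loc_int_norm[OF prim_loc_int[OF p]]] unfolding set_integrable_def .
    show "(\<lambda>t. indicator {X n..<x} t *\<^sub>R f t) \<in> borel_measurable P" for n
      using fm Pd(1) by (intro borel_measurable_scaleR borel_measurable_indicator) auto
    show "AE t in P. (\<lambda>n. indicator {X n..<x} t *\<^sub>R f t) \<longlonglongrightarrow> 0"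
    proof (rule AE_I2)
      fix t
      have "eventually (\<lambda>n. indicator {X n..<x} t *\<^sub>R f t = 0) sequentially"
      proof (cases "t < x")
        case True
        then have "eventually (\<lambda>n. X n > t) sequentially" by (rule order_tendstoD(1)[OF lim])
        then show ?thesis by (rule eventually_mono) auto
      qed auto
      then show "(\<lambda>n. indicator {X n..<x} t *\<^sub>R f t) \<longlonglongrightarrow> 0" by (rule tendsto_eventually)
    qed
    show "AE t in P. norm (indicator {X n..<x} t *\<^sub>R f t) \<le> indicator {-K..<x} t *\<^sub>R cmod (f t)" for n
      using Kx[of n] by (intro AE_I2) (auto simp: indicator_def)
  qed auto
  moreover have "(\<integral>t. indicator {X n..<x} t *\<^sub>R f t \<partial>P) = v x - v (X n)" for n
    using primD[OF p, of "X n" x] X unfolding set_lebesgue_integral_def by (simp add: less_imp_le)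
  ultimately have "(\<lambda>n. v x - (v x - v (X n))) \<longlonglongrightarrow> v x - 0" by (intro tendsto_diff) auto
  then show "(v \<circ> X) \<longlonglongrightarrow> v x" by (simp add: o_def)
qed

text \<open>As \<open>X n\<close> decreases to \<open>x\<close>, the intervals
  \<open>{x..<X n}\<close> shrink to \<open>{x}\<close>, so the atom at \<open>x\<close> contributes
  in full. From the left, \<open>{X n..<x}\<close> shrinks to the empty set, hence the left
  continuity in \<open>prim_left_cont\<close>.\<close>

lemma prim_right_limit:
  assumes P: "locally_finite P" and p: "prim P v f"
  shows "(v \<longlongrightarrow> v x + of_real (atom P x) * f x) (at_right x)"
  unfolding tendsto_at_iff_sequentially
proof (intro allI impI)
  fix X :: "nat \<Rightarrow> real" assume X: "\<forall>i. X i \<in> {x<..} - {x}" and lim: "X \<longlonglongrightarrow> x"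
  note Pd = locally_finiteD[OF P]
  have "Bseq X" using lim by (metis convergentI convergent_imp_Bseq)
  then obtain K where K: "\<And>n. \<bar>X n\<bar> \<le> K" unfolding Bseq_def by auto
  have Kx: "X n \<le> K" for n using K[of n] by linarith
  have fm: "f \<in> borel_measurable P" using loc_int_measurable[OF prim_loc_int[OF p]] Pd by simp
  have "(\<lambda>n. \<integral>t. indicator {x..<X n} t *\<^sub>R f t \<partial>P) \<longlonglongrightarrow> (\<integral>t. indicator {x} t *\<^sub>R f x \<partial>P)"
  proof (rule integral_dominated_convergence[where w="\<lambda>t. indicator {x..<K} t *\<^sub>R cmod (f t)"])
    show "integrable P (\<lambda>t. indicator {x..<K} t *\<^sub>R cmod (f t))"
      using loc_intD[OF loc_int_norm[OF prim_loc_int[OF p]]] unfolding set_integrable_def .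
    show "(\<lambda>t. indicator {x..<X n} t *\<^sub>R f t) \<in> borel_measurable P" for n
      using fm Pd(1) by (intro borel_measurable_scaleR borel_measurable_indicator) auto
    show "AE t in P. (\<lambda>n. indicator {x..<X n} t *\<^sub>R f t) \<longlonglongrightarrow> indicator {x} t *\<^sub>R f x"
    proof (rule AE_I2)
      fix t
      have "eventually (\<lambda>n. indicator {x..<X n} t *\<^sub>R f t = indicator {x} t *\<^sub>R f x) sequentially"
      proof (cases "t > x")
        case True
        then have "eventually (\<lambda>n. X n < t) sequentially" by (rule order_tendstoD(2)[OF lim])
        then show ?thesis by (rule eventually_mono) (use True in \<open>simp add: indicator_def\<close>)
      next
        case False
        have "indicator {x..<X n} t *\<^sub>R f t = indicator {x} t *\<^sub>R f x" for n
          using X[rule_format, of n] False by (cases "t = x") auto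
        then show ?thesis by (intro always_eventually allI)
      qed
      then show "(\<lambda>n. indicator {x..<X n} t *\<^sub>R f t) \<longlonglongrightarrow> indicator {x} t *\<^sub>R f x" by (rule tendsto_eventually)
    qed
    show "AE t in P. norm (indicator {x..<X n} t *\<^sub>R f t) \<le> indicator {x..<K} t *\<^sub>R cmod (f t)" for n
      using Kx[of n] by (intro AE_I2) (auto simp: indicator_def)
    show "(\<lambda>t. indicator {x} t *\<^sub>R f x) \<in> borel_measurable P"
      using Pd(1) by (intro borel_measurable_scaleR borel_measurable_indicator) auto
  qed
  moreover have "(\<integral>t. indicator {x} t *\<^sub>R f x \<partial>P) = of_real (atom P x) * f x"
    using Pd(1,5) by (simp add: atom_def scaleR_conv_of_real)
  moreover have "(\<integral>t. indicator {x..<X n} t *\<^sub>R f t \<partial>P) = v (X n) - v x" for n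
    using primD[OF p, of x "X n"] X unfolding set_lebesgue_integral_def by (simp add: less_imp_le)
  ultimately have "(\<lambda>n. v x + (v (X n) - v x)) \<longlonglongrightarrow> v x + of_real (atom P x) * f x" by (intro tendsto_add) auto
  then show "(v \<circ> X) \<longlonglongrightarrow> v x + of_real (atom P x) * f x" by (simp add: o_def)
qed

text \<open>The step functions \<open>v (y n x)\<close>, where \<open>y n x\<close> is a point of a
  grid of mesh \<open>1 / Suc n\<close> just below \<open>x\<close>, converge to \<open>v x\<close>
  from the left.\<close>

lemma left_continuous_borel:
  fixes v :: "real \<Rightarrow> complex"
  assumes "\<And>x. (v \<longlongrightarrow> v x) (at_left x)"
  shows "v \<in> borel_measurable borel"
proof -
  define y where "y n x = (of_int \<lceil>real (Suc n) * x\<rceil> - 1) / real (Suc n)" for n x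
  have y: "x - 1 / real (Suc n) \<le> y n x" "y n x < x" for n x
  proof -
    define N where "N = real (Suc n)"
    have N: "N > 0" by (simp add: N_def)
    have "of_int \<lceil>N * x\<rceil> - 1 < N * x" "N * x \<le> of_int \<lceil>N * x\<rceil>"
      using ceiling_correct[of "N * x"] by simp_all
    moreover have "y n x = (of_int \<lceil>N * x\<rceil> - 1) / N" by (simp add: y_def N_def)
    moreover have "x - 1 / N = (N * x - 1) / N" using N by (simp add: diff_divide_distrib)
    ultimately show "x - 1 / real (Suc n) \<le> y n x" "y n x < x"
      unfolding N_def[symmetric] using N by (simp_all add: divide_right_mono pos_divide_less_eq mult.commute)
  qed
  have "(\<lambda>n. v (y n x)) \<longlonglongrightarrow> v x" for x
  proof -
    have "(\<lambda>n. x - 1 / real (Suc n)) \<longlonglongrightarrow> x - 0"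
      by (rule tendsto_diff[OF tendsto_const LIMSEQ_Suc[OF lim_const_over_n]])
    then have lo: "(\<lambda>n. x - 1 / real (Suc n)) \<longlonglongrightarrow> x" by (simp only: diff_zero)
    have "(\<lambda>n. y n x) \<longlonglongrightarrow> x"
      by (rule tendsto_sandwich[OF always_eventually always_eventually lo tendsto_const])
         (use y(1) less_imp_le[OF y(2)] in blast)+
    moreover have "\<forall>n. y n x \<in> {..<x} - {x}" using y(2) by (simp add: less_imp_neq)
    ultimately have "(v \<circ> (\<lambda>n. y n x)) \<longlonglongrightarrow> v x"
      using assms[of x] unfolding tendsto_at_iff_sequentially by simp
    then show ?thesis by (simp add: o_def)
  qed
  moreover have "(\<lambda>x. v (y n x)) \<in> borel_measurable borel" for n
  proof -
    have "(\<lambda>x. \<lceil>real (Suc n) * x\<rceil>) \<in> borel \<rightarrow>\<^sub>M count_space UNIV" by measurable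
    from measurable_compose[OF this, of "\<lambda>k. v ((of_int k - 1) / real (Suc n))" borel]
    show ?thesis unfolding y_def by simp
  qed
  ultimately show ?thesis by (rule borel_measurable_LIMSEQ_metric[rotated])
qed

lemma right_limits_borel:
  fixes v w :: "real \<Rightarrow> complex"
  assumes "v \<in> borel_measurable borel" "\<And>x. (v \<longlongrightarrow> w x) (at_right x)"
  shows "w \<in> borel_measurable borel"
proof (rule borel_measurable_LIMSEQ_metric)
  show "(\<lambda>x. v (x + 1 / real (Suc n))) \<in> borel_measurable borel" for n
    using assms(1) by measurable
  fix x
  have "(\<lambda>n. x + 1 / real (Suc n)) \<longlonglongrightarrow> x + 0"
    by (rule tendsto_add[OF tendsto_const LIMSEQ_Suc[OF lim_const_over_n]])
  then have "(\<lambda>n. x + 1 / real (Suc n)) \<longlonglongrightarrow> x" by (simp only: add_0_right)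
  moreover have "\<forall>n. x + 1 / real (Suc n) \<in> {x<..} - {x}" by simp
  ultimately have "(v \<circ> (\<lambda>n. x + 1 / real (Suc n))) \<longlonglongrightarrow> w x"
    using assms(2)[of x] unfolding tendsto_at_iff_sequentially by simp
  then show "(\<lambda>n. v (x + 1 / real (Suc n))) \<longlonglongrightarrow> w x" by (simp add: o_def)
qed

lemma prim_borel: "locally_finite P \<Longrightarrow> prim P v f \<Longrightarrow> v \<in> borel_measurable borel"
  by (rule left_continuous_borel) (rule prim_left_cont)

text \<open>The mass of the atom is the jump of a primitive of the constant 1, and both one-sided
  limits of that primitive are Borel.\<close>

lemma atom_borel:
  assumes P: "locally_finite P" shows "atom P \<in> borel_measurable borel"
proof -
  obtain v where v: "prim P v (\<lambda>x. 1)" by (rule prim_exists[OF loc_int_const[OF P]]) (rule that)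
  have [measurable]: "v \<in> borel_measurable borel" by (rule prim_borel[OF P v])
  have "(\<lambda>x. v x + of_real (atom P x) * 1) \<in> borel_measurable borel"
    by (rule right_limits_borel[OF prim_borel[OF P v]]) (rule prim_right_limit[OF P v])
  then have "(\<lambda>x. Re ((v x + of_real (atom P x) * 1) - v x)) \<in> borel_measurable borel" by measurable
  then show ?thesis by simp
qed

lemma atom_nonneg: "atom P x \<ge> 0" by (simp add: atom_def)

text \<open>A jump is a limit of differences of \<open>v\<close>, hence at most twice a local bound
  of \<open>v\<close>, even where the density \<open>f\<close> is unbounded. The interval is
  extended by 1 because the jump at \<open>b\<close> looks at points to the right of
  \<open>b\<close>.\<close>

lemma prim_jump_bounded:
  assumes P: "locally_finite P" and p: "prim P v f"
  shows "loc_bounded (\<lambda>x. of_real (atom P x) * f x)"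
  unfolding loc_bounded_def
proof (intro allI)
  fix a b
  obtain B where B: "\<forall>x\<in>{a..b + 1}. norm (v x) \<le> B" using prim_loc_bounded[OF P p] unfolding loc_bounded_def by metis
  have "norm (of_real (atom P x) * f x) \<le> B + B" if "x \<in> {a..b}" for x
  proof -
    have "((\<lambda>y. norm (v y - v x)) \<longlongrightarrow> norm (v x + of_real (atom P x) * f x - v x)) (at_right x)"
      by (intro tendsto_intros prim_right_limit[OF P p])
    moreover have "eventually (\<lambda>y. norm (v y - v x) \<le> B + B) (at_right x)"
      unfolding eventually_at_right_field
    proof (intro exI[of _ "x + 1"] conjI allI impI)
      fix y assume "x < y" "y < x + 1"
      then have "norm (v y) \<le> B" "norm (v x) \<le> B" using B that by auto
      then show "norm (v y - v x) \<le> B + B" by (meson norm_triangle_ineq4 add_mono order_trans)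
    qed simp
    ultimately have "norm (v x + of_real (atom P x) * f x - v x) \<le> B + B"
      by (rule tendsto_upperbound) simp
    then show ?thesis by simp
  qed
  then show "\<exists>B. \<forall>x\<in>{a..b}. norm (of_real (atom P x) * f x) \<le> B" by blast
qed

lemma prim_mult_integral:
  assumes P: "locally_finite P" and Q: "locally_finite Q"
    and p: "prim P v f" and q: "prim Q z g" and "a \<le> b"
  shows "v b * z b - v a * z a =
     (LINT x:{a..<b}|P. (z x + of_real (atom Q x) * g x) * f x) + (LINT x:{a..<b}|Q. v x * g x)"
proof -
  note Pd = locally_finiteD[OF P] and Qd = locally_finiteD[OF Q]
  interpret P: sigma_finite_measure P by (rule locally_finite_sigma_finite[OF P])
  interpret Q: sigma_finite_measure Q by (rule locally_finite_sigma_finite[OF Q])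
  interpret PQ: pair_sigma_finite P Q ..
  define A where "A x = indicator {a..<b} x *\<^sub>R f x" for x
  define B where "B x = indicator {a..<b} x *\<^sub>R g x" for x
  have A: "integrable P A" and B: "integrable Q B"
    using loc_intD[OF prim_loc_int[OF p], of a b] loc_intD[OF prim_loc_int[OF q], of a b]
    unfolding set_integrable_def A_def B_def by auto
  have [measurable]: "f \<in> borel_measurable borel" "g \<in> borel_measurable borel"
    using loc_int_measurable[OF prim_loc_int[OF p]] loc_int_measurable[OF prim_loc_int[OF q]] by auto
  have [measurable]: "A \<in> borel_measurable borel" "B \<in> borel_measurable borel"
    unfolding A_def B_def by measurable
  have setsPQ: "sets (P \<Otimes>\<^sub>M Q) = sets (borel \<Otimes>\<^sub>M borel)"
    using Pd(1) Qd(1) by (rule sets_pair_measure_cong)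
  have mPQ: "borel_measurable (P \<Otimes>\<^sub>M Q) = borel_measurable (borel \<Otimes>\<^sub>M borel)"
    by (rule measurable_cong_sets[OF setsPQ refl])
  have AB: "integrable (P \<Otimes>\<^sub>M Q) (\<lambda>(t, s). A t * B s)"
  proof (rule PQ.Fubini_integrable)
    show "(\<lambda>(t, s). A t * B s) \<in> borel_measurable (P \<Otimes>\<^sub>M Q)" unfolding mPQ by measurable
    have "integrable P (\<lambda>t. cmod (A t) * (\<integral>s. cmod (B s) \<partial>Q))" using A by simp
    then show "integrable P (\<lambda>x. \<integral>y. norm (case (x, y) of (t, s) \<Rightarrow> A t * B s) \<partial>Q)"
      by (simp add: norm_mult)
    show "AE x in P. integrable Q (\<lambda>y. case (x, y) of (t, s) \<Rightarrow> A t * B s)" using B by simp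
  qed
  \<comment> \<open>The diagonal is assigned to \<open>L\<close>. This is why the atom at
    \<open>t\<close> is included in the value of \<open>z\<close> but not in that of
    \<open>v\<close>.\<close>
  define K where "K = (\<lambda>(t, s). (if t < s then A t * B s else 0))"
  define L where "L = (\<lambda>(t, s). (if s \<le> t then A t * B s else 0))"
  have mK: "K \<in> borel_measurable (P \<Otimes>\<^sub>M Q)" "L \<in> borel_measurable (P \<Otimes>\<^sub>M Q)"
    unfolding mPQ K_def L_def by measurable
  have K: "integrable (P \<Otimes>\<^sub>M Q) K"
    by (rule Bochner_Integration.integrable_bound[OF AB mK(1)]) (auto simp: K_def)
  have L: "integrable (P \<Otimes>\<^sub>M Q) L"
    by (rule Bochner_Integration.integrable_bound[OF AB mK(2)]) (auto simp: L_def)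
  have iA: "integral\<^sup>L P A = v b - v a" and iB: "integral\<^sup>L Q B = z b - z a"
    using primD[OF p \<open>a \<le> b\<close>] primD[OF q \<open>a \<le> b\<close>] unfolding A_def B_def set_lebesgue_integral_def by auto
  have vs: "v s = v a + (\<integral>t. (if t < s then A t else 0) \<partial>P)" if "s \<in> {a..<b}" for s
  proof -
    have "(\<integral>t. (if t < s then A t else 0) \<partial>P) = (LINT t:{a..<s}|P. f t)"
      unfolding set_lebesgue_integral_def A_def
      by (rule Bochner_Integration.integral_cong) (use that in \<open>auto simp: indicator_def\<close>)
    then show ?thesis using primD[OF p, of a s] that by (simp add: algebra_simps)
  qed
  have zt: "z t + of_real (atom Q t) * g t = z a + (\<integral>s. (if s \<le> t then B s else 0) \<partial>Q)" if "t \<in> {a..<b}" for t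
  proof -
    have it: "integrable Q (\<lambda>s. indicator {t} s *\<^sub>R g t)"
      using Qd by (intro integrable_scaleR_left integrable_real_indicator) auto
    have "(\<integral>s. (if s \<le> t then B s else 0) \<partial>Q) =
      (\<integral>s. indicator {a..<t} s *\<^sub>R g s + indicator {t} s *\<^sub>R g t \<partial>Q)"
      unfolding B_def
      by (rule Bochner_Integration.integral_cong) (use that in \<open>auto simp: indicator_def\<close>)
    also have "\<dots> = (\<integral>s. indicator {a..<t} s *\<^sub>R g s \<partial>Q) + (\<integral>s. indicator {t} s *\<^sub>R g t \<partial>Q)"
      using loc_intD[OF prim_loc_int[OF q], of a t] it unfolding set_integrable_def
      by (rule Bochner_Integration.integral_add)
    also have "\<dots> = (z t - z a) + of_real (atom Q t) * g t"
      using primD[OF q, of a t] that Qd(1,5) unfolding set_lebesgue_integral_def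
      by (simp add: atom_def scaleR_conv_of_real)
    finally show ?thesis by simp
  qed
  have "(LINT x:{a..<b}|Q. v x * g x) = (\<integral>s. v a * B s + (\<integral>t. K (t, s) \<partial>P) \<partial>Q)"
    unfolding set_lebesgue_integral_def
  proof (rule Bochner_Integration.integral_cong[OF refl])
    fix s
    show "indicator {a..<b} s *\<^sub>R (v s * g s) = v a * B s + (\<integral>t. K (t, s) \<partial>P)"
    proof (cases "s \<in> {a..<b}")
      case True
      have "(\<integral>t. K (t, s) \<partial>P) = (\<integral>t. (if t < s then A t else 0) * B s \<partial>P)"
        by (rule Bochner_Integration.integral_cong) (auto simp: K_def)
      then show ?thesis using vs[OF True] True by (simp add: B_def algebra_simps)
    next
      case False
      then have "B s = 0" by (simp add: B_def)
      moreover from this have "K (t, s) = 0" for t by (simp add: K_def)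
      ultimately show ?thesis using False by simp
    qed
  qed
  also have "\<dots> = v a * (z b - z a) + (\<integral>s. (\<integral>t. K (t, s) \<partial>P) \<partial>Q)"
    using PQ.integrable_snd[of "\<lambda>t s. K (t, s)"] K B iB by (subst Bochner_Integration.integral_add) auto
  also have "(\<integral>s. (\<integral>t. K (t, s) \<partial>P) \<partial>Q) = (\<integral>t. (\<integral>s. K (t, s) \<partial>Q) \<partial>P)"
    using PQ.Fubini_integral[of "\<lambda>t s. K (t, s)"] K by simp
  finally have 1: "(LINT x:{a..<b}|Q. v x * g x) = v a * (z b - z a) + (\<integral>t. (\<integral>s. K (t, s) \<partial>Q) \<partial>P)" .
  have "(LINT x:{a..<b}|P. (z x + of_real (atom Q x) * g x) * f x) = (\<integral>t. z a * A t + (\<integral>s. L (t, s) \<partial>Q) \<partial>P)"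
    unfolding set_lebesgue_integral_def
  proof (rule Bochner_Integration.integral_cong[OF refl])
    fix t
    show "indicator {a..<b} t *\<^sub>R ((z t + of_real (atom Q t) * g t) * f t) = z a * A t + (\<integral>s. L (t, s) \<partial>Q)"
    proof (cases "t \<in> {a..<b}")
      case True
      have "(\<integral>s. L (t, s) \<partial>Q) = (\<integral>s. (if s \<le> t then B s else 0) * A t \<partial>Q)"
        by (rule Bochner_Integration.integral_cong) (auto simp: L_def)
      then show ?thesis unfolding zt[OF True] using True by (simp add: A_def algebra_simps)
    next
      case False
      then have "A t = 0" by (simp add: A_def)
      moreover from this have "L (t, s) = 0" for s by (simp add: L_def)
      ultimately show ?thesis using False by simp
    qed
  qed
  also have "\<dots> = z a * (v b - v a) + (\<integral>t. (\<integral>s. L (t, s) \<partial>Q) \<partial>P)"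
    using PQ.integrable_fst[of "\<lambda>t s. L (t, s)"] L A iA by (subst Bochner_Integration.integral_add) auto
  finally have 2: "(LINT x:{a..<b}|P. (z x + of_real (atom Q x) * g x) * f x) =
     z a * (v b - v a) + (\<integral>t. (\<integral>s. L (t, s) \<partial>Q) \<partial>P)" .
  have "(\<integral>t. (\<integral>s. K (t, s) \<partial>Q) \<partial>P) + (\<integral>t. (\<integral>s. L (t, s) \<partial>Q) \<partial>P)
      = integral\<^sup>L (P \<Otimes>\<^sub>M Q) K + integral\<^sup>L (P \<Otimes>\<^sub>M Q) L"
    using PQ.integral_fst'[OF K] PQ.integral_fst'[OF L] by simp
  also have "\<dots> = integral\<^sup>L (P \<Otimes>\<^sub>M Q) (\<lambda>x. K x + L x)"
    using K L by simp
  also have "(\<lambda>x. K x + L x) = (\<lambda>(t, s). A t * B s)" by (auto simp: K_def L_def fun_eq_iff)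
  also have "integral\<^sup>L (P \<Otimes>\<^sub>M Q) \<dots> = (\<integral>t. (\<integral>s. A t * B s \<partial>Q) \<partial>P)"
    using PQ.integral_fst'[OF AB] by simp
  also have "\<dots> = (v b - v a) * (z b - z a)" using iA iB by simp
  finally show ?thesis unfolding 1 2 by (simp add: algebra_simps)
qed

text \<open>The jump of \<open>v\<close> at \<open>x\<close> is \<open>atom P x * f x\<close>, so \<open>bal P v f\<close> is the balanced function with left limits \<open>v\<close>.\<close>

definition bal :: "real measure \<Rightarrow> (real \<Rightarrow> complex) \<Rightarrow> (real \<Rightarrow> complex) \<Rightarrow> real \<Rightarrow> complex" where
  "bal P v f x = v x + of_real (atom P x) * f x / 2"

lemma bal_borel:
  assumes P: "locally_finite P" and p: "prim P v f" shows "bal P v f \<in> borel_measurable borel"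
proof -
  have [measurable]: "v \<in> borel_measurable borel" "f \<in> borel_measurable borel" "atom P \<in> borel_measurable borel"
    using prim_borel[OF P p] loc_int_measurable[OF prim_loc_int[OF p]] atom_borel[OF P] by auto
  show ?thesis unfolding bal_def by measurable
qed

lemma bal_loc_bounded:
  assumes P: "locally_finite P" and p: "prim P v f" shows "loc_bounded (bal P v f)"
  using loc_bounded_add[OF prim_loc_bounded[OF P p]
      loc_bounded_mult[OF loc_bounded_const[of "1/2"] prim_jump_bounded[OF P p]]]
  unfolding bal_def by simp

text \<open>In \<open>prim_mult_integral\<close> with \<open>Q = P\<close>, shifting half of the
  product of the two jumps from one summand to the other replaces the left and the right limits by
  balanced values.\<close>

lemma prim_mult:
  assumes P: "locally_finite P" and p: "prim P v f" and q: "prim P z g"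
  shows "prim P (\<lambda>x. v x * z x) (\<lambda>x. bal P z g x * f x + bal P v f x * g x)"
proof -
  have 1: "loc_int P (\<lambda>x. bal P z g x * f x + bal P v f x * g x)"
    by (intro loc_int_add loc_int_mult[OF P] prim_loc_int[OF p] prim_loc_int[OF q]
        bal_borel[OF P] bal_loc_bounded[OF P] p q)
  have 2: "loc_int P (\<lambda>x. v x * g x)"
    by (intro loc_int_mult[OF P] prim_loc_int[OF q] prim_borel[OF P p] prim_loc_bounded[OF P p])
  have "v b * z b - v a * z a = (LINT x:{a..<b}|P. bal P z g x * f x + bal P v f x * g x)" if "a \<le> b" for a b
  proof -
    have eq: "bal P z g x * f x + bal P v f x * g x - v x * g x = (z x + of_real (atom P x) * g x) * f x" for x
      by (simp add: bal_def algebra_simps)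
    have "(LINT x:{a..<b}|P. bal P z g x * f x + bal P v f x * g x) - (LINT x:{a..<b}|P. v x * g x)
      = (LINT x:{a..<b}|P. bal P z g x * f x + bal P v f x * g x - v x * g x)"
      by (rule set_integral_diff(2)[symmetric]) (rule loc_intD[OF 1] loc_intD[OF 2])+
    then have "(LINT x:{a..<b}|P. bal P z g x * f x + bal P v f x * g x) =
       (LINT x:{a..<b}|P. (z x + of_real (atom P x) * g x) * f x) + (LINT x:{a..<b}|P. v x * g x)"
      unfolding eq by (simp add: algebra_simps)
    then show ?thesis using prim_mult_integral[OF P P p q that] by simp
  qed
  with 1 show ?thesis by (simp add: prim_def)
qed

section \<open>The initial value problem\<close>

lemma prim_from:
  assumes f: "loc_int P f" "\<forall>x<a. f x = 0"
  shows "prim P (\<lambda>t. c + (LINT x:{a..<t}|P. f x)) f"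
  unfolding prim_def
proof (intro conjI allI impI f(1))
  fix s t :: real assume st: "s \<le> t"
  have z: "(LINT x:{u..<a}|P. f x) = 0" for u
  proof -
    have "(LINT x:{u..<a}|P. f x) = (\<integral>x. 0 \<partial>P)" unfolding set_lebesgue_integral_def
      by (rule Bochner_Integration.integral_cong) (auto simp: indicator_def f(2))
    then show ?thesis by simp
  qed
  have e: "(LINT x:{a..<u}|P. f x) = 0" if "u \<le> a" for u
    using that by (simp add: set_lebesgue_integral_def)
  consider "a \<le> s" | "s < a" "a \<le> t" | "t < a" by linarith
  then show "c + (LINT x:{a..<t}|P. f x) - (c + (LINT x:{a..<s}|P. f x)) = (LINT x:{s..<t}|P. f x)"
  proof cases
    case 1 then show ?thesis using set_integral_split[OF f(1) 1 st] by simp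
  next
    case 2 then show ?thesis using set_integral_split[OF f(1), of s a t] z[of s] e[of s] by simp
  next
    case 3 then show ?thesis
      using set_integral_split[OF f(1) st, of a] z[of s] z[of t] e[of s] e[of t] st by simp
  qed
qed

lemma prim_Re_mono:
  assumes "prim P (\<lambda>x. of_real (F x)) (\<lambda>x. of_real (f x))" "a \<le> b"
  shows "F b - F a = (LINT x:{a..<b}|P. f x)"
proof -
  have "complex_of_real (F b - F a) = of_real (LINT x:{a..<b}|P. f x)"
    using primD[OF assms] by (simp add: set_integral_complex_of_real)
  then show ?thesis by (simp only: of_real_eq_iff)
qed

lemma loc_int_of_real_iff: "loc_int P (\<lambda>x. complex_of_real (f x)) \<longleftrightarrow> loc_int P f"
proof -
  have "set_integrable P {a..<b} (\<lambda>x. complex_of_real (f x)) \<longleftrightarrow> set_integrable P {a..<b} f" for a b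
  proof -
    have "(\<lambda>x. indicator {a..<b} x *\<^sub>R complex_of_real (f x)) = (\<lambda>x. complex_of_real (indicator {a..<b} x *\<^sub>R f x))"
      by (simp add: scaleR_conv_of_real)
    then show ?thesis unfolding set_integrable_def by (simp only: complex_of_real_integrable_eq)
  qed
  moreover have "(\<lambda>x. complex_of_real (f x)) \<in> borel_measurable borel \<longleftrightarrow> f \<in> borel_measurable borel"
  proof
    assume "(\<lambda>x. complex_of_real (f x)) \<in> borel_measurable borel"
    then have "(\<lambda>x. Re (complex_of_real (f x))) \<in> borel_measurable borel" by measurable
    then show "f \<in> borel_measurable borel" by simp
  qed measurable
  ultimately show ?thesis by (simp add: loc_int_def)
qed

text \<open>Powers of a primitive of a nonnegative density grow at least as in the absolutely continuous
  case; this makes the Volterra series below converge factorially.\<close>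

lemma prim_power_density:
  assumes P: "locally_finite P" and F: "prim P (\<lambda>x. of_real (F x)) (\<lambda>x. of_real (k x))"
    and k: "\<And>x. k x \<ge> 0" and F0: "\<And>x. a \<le> x \<Longrightarrow> F x \<ge> 0"
  shows "\<exists>G. prim P (\<lambda>x. of_real (F x ^ Suc n)) (\<lambda>x. of_real (G x)) \<and>
     (\<forall>x\<ge>a. real (Suc n) * F x ^ n * k x \<le> G x)"
proof (induction n)
  case 0
  show ?case by (rule exI[of _ k]) (use F in auto)
next
  case (Suc n)
  then obtain G where G: "prim P (\<lambda>x. of_real (F x ^ Suc n)) (\<lambda>x. of_real (G x))"
    and Gk: "\<And>x. a \<le> x \<Longrightarrow> real (Suc n) * F x ^ n * k x \<le> G x" by blast
  define H where "H x = (F x ^ Suc n + atom P x * G x / 2) * k x + (F x + atom P x * k x / 2) * G x" for x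
  have "prim P (\<lambda>x. of_real (F x ^ Suc (Suc n))) (\<lambda>x. of_real (H x))"
    using prim_mult[OF P F G] by (simp add: bal_def H_def mult.commute)
  moreover have "real (Suc (Suc n)) * F x ^ Suc n * k x \<le> H x" if "a \<le> x" for x
  proof -
    have G0: "G x \<ge> 0" using Gk[OF that] F0[OF that] k[of x]
      by (meson mult_nonneg_nonneg of_nat_0_le_iff order_trans zero_le_power)
    have "F x * (real (Suc n) * F x ^ n * k x) \<le> F x * G x"
      by (rule mult_left_mono[OF Gk[OF that] F0[OF that]])
    \<comment> \<open>This product of the two jumps is the only excess over the classical derivative
      of a power, and it has the favourable sign.\<close>
    moreover have "0 \<le> atom P x * G x * k x" using G0 k[of x] atom_nonneg[of P x] by simp
    moreover have "H x = F x ^ Suc n * k x + F x * G x + atom P x * G x * k x"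
      by (simp add: H_def algebra_simps)
    moreover have "real (Suc (Suc n)) * F x ^ Suc n * k x = F x ^ Suc n * k x + F x * (real (Suc n) * F x ^ n * k x)"
      by (simp add: algebra_simps)
    ultimately show ?thesis by linarith
  qed
  ultimately show ?case by blast
qed


text \<open>The solution is the series of iterates of the integral operator with kernel
  \<open>k\<close>. The \<open>n\<close>-th iterate is bounded by
  \<open>B * F t ^ n / fact n\<close>, where \<open>F t\<close> is \<open>K\<close> times the mass
  of \<open>{a..<t}\<close>. Since \<open>k\<close> and \<open>g\<close> vanish to the left of
  \<open>a\<close>, extending by the constant \<open>c\<close> gives a solution on the whole
  line.\<close>

lemma volterra:
  assumes P: "locally_finite P"
    and k: "k \<in> borel_measurable borel" "\<And>x. cmod (k x) \<le> K" "\<forall>x<a. k x = 0"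
    and g: "loc_int P g" "\<forall>x<a. g x = 0"
  obtains v where "prim P v (\<lambda>x. k x * v x + g x)" "\<And>x. x \<le> a \<Longrightarrow> v x = c"
proof -
  have K0: "K \<ge> 0" by (rule order_trans[OF norm_ge_zero k(2)[of 0]])
  have kb: "loc_bounded k" unfolding loc_bounded_def using k(2) by blast
  define y where "y = rec_nat (\<lambda>t. c + (LINT x:{a..<t}|P. g x))
     (\<lambda>_ z t. (LINT x:{a..<t}|P. k x * z x))"
  have y0: "y 0 t = c + (LINT x:{a..<t}|P. g x)" and yS: "y (Suc n) t = (LINT x:{a..<t}|P. k x * y n x)" for n t
    by (simp_all add: y_def)
  have prim0: "prim P (y 0) g"
    using prim_from[OF g, of c] by (simp add: y0[abs_def])
  have mult: "loc_int P (\<lambda>x. k x * z x)" if "z \<in> borel_measurable borel" "loc_bounded z" for z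
    using loc_int_mult[OF P loc_int_loc_bounded[OF P that] k(1) kb] .
  have primS: "prim P (y (Suc n)) (\<lambda>x. k x * y n x) \<and> prim P (y n) (if n = 0 then g else (\<lambda>x. k x * y (n - 1) x))" for n
  proof (induction n)
    case 0
    have "loc_int P (\<lambda>x. k x * y 0 x)"
      by (rule mult[OF prim_borel[OF P prim0] prim_loc_bounded[OF P prim0]])
    from prim_from[OF this, of a 0] k(3) prim0 show ?case by (simp add: yS[abs_def])
  next
    case (Suc n)
    then have pn: "prim P (y (Suc n)) (\<lambda>x. k x * y n x)" by simp
    have "loc_int P (\<lambda>x. k x * y (Suc n) x)"
      by (rule mult[OF prim_borel[OF P pn] prim_loc_bounded[OF P pn]])
    from prim_from[OF this, of a 0] k(3) pn show ?case by (simp add: yS[abs_def])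
  qed
  then have yprim: "prim P (y (Suc n)) (\<lambda>x. k x * y n x)" for n by blast
  have ybd: "y n \<in> borel_measurable borel \<and> loc_bounded (y n)" for n
    using primS[of n] prim_borel[OF P] prim_loc_bounded[OF P] by blast
  \<comment> \<open>The density is cut off below \<open>a\<close> so that \<open>F\<close> is a
    primitive on all of the line and \<open>prim_power_density\<close> applies to it.\<close>
  define F where "F t = (LINT x:{a..<t}|P. (if x < a then 0 else K))" for t
  have lK: "loc_int P (\<lambda>x. complex_of_real (if x < a then 0 else K))"
  proof (rule loc_int_loc_bounded[OF P])
    show "loc_bounded (\<lambda>x. complex_of_real (if x < a then 0 else K))"
      unfolding loc_bounded_def by (intro allI exI[of _ "\<bar>K\<bar>"]) auto
  qed measurable
  have FF: "prim P (\<lambda>x. of_real (F x)) (\<lambda>x. of_real (if x < a then 0 else K))"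
    using prim_from[OF lK, of a 0] by (simp add: F_def[abs_def] set_integral_complex_of_real)
  have F0: "F x \<ge> 0" for x unfolding F_def set_lebesgue_integral_def
    by (rule integral_nonneg_AE) (auto simp: K0)
  have Fmono: "F s \<le> F t" if "s \<le> t" for s t
  proof -
    have "F t - F s = (LINT x:{s..<t}|P. (if x < a then 0 else K))" by (rule prim_Re_mono[OF FF that])
    also have "\<dots> \<ge> 0" unfolding set_lebesgue_integral_def
      by (rule integral_nonneg_AE) (auto simp: K0)
    finally show ?thesis by simp
  qed
  have bound: "cmod (y n t) \<le> B * F t ^ n / fact n"
    if B: "\<And>x. x \<in> {a..b} \<Longrightarrow> cmod (y 0 x) \<le> B" and "t \<in> {a..b}" for n t B b
    using \<open>t \<in> {a..b}\<close>
  proof (induction n arbitrary: t)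
    case 0 then show ?case using B by simp
  next
    case (Suc n)
    have "cmod (y 0 a) \<le> B" using Suc.prems by (intro B) auto
    then have B0: "B \<ge> 0" by (rule order_trans[OF norm_ge_zero])
    obtain G where G: "prim P (\<lambda>x. of_real (F x ^ Suc n)) (\<lambda>x. of_real (G x))"
      "\<And>x. a \<le> x \<Longrightarrow> real (Suc n) * F x ^ n * (if x < a then 0 else K) \<le> G x"
    proof -
      have "\<exists>G. prim P (\<lambda>x. of_real (F x ^ Suc n)) (\<lambda>x. of_real (G x)) \<and>
         (\<forall>x\<ge>a. real (Suc n) * F x ^ n * (if x < a then 0 else K) \<le> G x)"
        by (rule prim_power_density[OF P FF]) (use K0 F0 in auto)
      then show thesis using that by blast
    qed
    have lG: "loc_int P G" using prim_loc_int[OF G(1)] by (simp only: loc_int_of_real_iff)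
    have ly: "loc_int P (\<lambda>x. cmod (k x * y n x))"
      using ybd[of n] by (intro loc_int_norm mult) auto
    have "cmod (y (Suc n) t) \<le> (LINT x:{a..<t}|P. cmod (k x * y n x))"
      unfolding yS using ybd[of n] by (intro norm_set_integral_le mult) auto
    also have "\<dots> \<le> (LINT x:{a..<t}|P. B / fact (Suc n) * G x)"
    proof (rule set_integral_mono)
      show "set_integrable P {a..<t} (\<lambda>x. cmod (k x * y n x))" by (rule loc_intD[OF ly])
      show "set_integrable P {a..<t} (\<lambda>x. B / fact (Suc n) * G x)"
        by (intro set_integrable_mult_right loc_intD[OF lG])
      fix x assume x: "x \<in> {a..<t}"
      have "cmod (k x * y n x) \<le> K * (B * F x ^ n / fact n)"
        unfolding norm_mult using Suc.IH[of x] x Suc.prems k(2)[of x] by (intro mult_mono K0) auto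
      also have "\<dots> = B / fact (Suc n) * (real (Suc n) * F x ^ n * K)"
      proof -
        have "K * (B * X / f) = B / (s * f) * (s * X * K)" if "s \<noteq> 0" for s f X :: real
          using that by (cases "f = 0") (simp_all add: field_simps)
        from this[of "real (Suc n)" "F x ^ n" "fact n"] show ?thesis unfolding fact_Suc by simp
      qed
      also have "\<dots> \<le> B / fact (Suc n) * G x"
        using G(2)[of x] x B0 by (intro mult_left_mono) auto
      finally show "cmod (k x * y n x) \<le> B / fact (Suc n) * G x" .
    qed
    also have "\<dots> = B / fact (Suc n) * (F t ^ Suc n - F a ^ Suc n)"
      using prim_Re_mono[OF G(1), of a t] Suc.prems by simp
    also have "\<dots> = B * F t ^ Suc n / fact (Suc n)" by (simp add: F_def set_lebesgue_integral_def)
    finally show ?case .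
  qed
  have yz: "y (Suc n) t = 0" "y 0 t = c" if "t \<le> a" for n t
    using that by (simp_all add: yS y0 set_lebesgue_integral_def)
  obtain BB where BB: "\<And>b x. x \<in> {a..b} \<Longrightarrow> cmod (y 0 x) \<le> BB b"
    using prim_loc_bounded[OF P prim0] unfolding loc_bounded_def by metis
  have sumF: "summable (\<lambda>n. BB b * F b ^ n / fact n)" for b
    using summable_mult[OF summable_exp[of "F b"], of "BB b"] by (simp add: field_simps)
  have bound': "cmod (y n t) \<le> BB b * F b ^ n / fact n" if "t \<in> {a..b}" for n t b
  proof -
    have "BB b \<ge> 0" by (rule order_trans[OF norm_ge_zero BB[OF that]])
    moreover have "F t ^ n \<le> F b ^ n" using that by (intro power_mono Fmono F0) auto
    ultimately have "BB b * F t ^ n / fact n \<le> BB b * F b ^ n / fact n"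
      by (intro divide_right_mono mult_left_mono) auto
    moreover have "cmod (y n t) \<le> BB b * F t ^ n / fact n" by (rule bound[OF _ that]) (rule BB)
    ultimately show ?thesis by linarith
  qed
  have summ: "summable (\<lambda>n. cmod (y n t))" for t
  proof (cases "t \<ge> a")
    case True
    have "norm (cmod (y n t)) \<le> BB t * F t ^ n / fact n" for n
      using bound'[of t t n] True by simp
    then show ?thesis by (intro summable_comparison_test'[OF sumF[of t], of 0])
  next
    case False
    then have "cmod (y n t) = 0" if "n \<notin> {0}" for n using yz(1)[of t "n - 1"] that by simp
    then show ?thesis by (intro summable_finite[of "{0}"]) auto
  qed
  define v where "v t = (\<Sum>n. y n t)" for t
  have lim: "(\<lambda>N. \<Sum>n<N. y n t) \<longlonglongrightarrow> v t" for t
    unfolding v_def by (rule summable_LIMSEQ[OF summable_norm_cancel[OF summ]])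
  have vm: "v \<in> borel_measurable borel"
    by (rule borel_measurable_LIMSEQ_metric[OF borel_measurable_sum lim]) (use ybd in blast)
  have part_le: "cmod (\<Sum>n<N. y n t) \<le> (\<Sum>n. BB b * F b ^ n / fact n)" if "t \<in> {a..b}" for N t b
  proof -
    have nn: "0 \<le> BB b * F b ^ n / fact n" for n
      by (rule order_trans[OF norm_ge_zero bound'[OF that]])
    have "cmod (\<Sum>n<N. y n t) \<le> (\<Sum>n<N. BB b * F b ^ n / fact n)"
      by (rule order_trans[OF norm_sum sum_mono]) (rule bound'[OF that])
    also have "\<dots> \<le> (\<Sum>n. BB b * F b ^ n / fact n)"
      by (rule sum_le_suminf[OF sumF]) (use nn in auto)
    finally show ?thesis .
  qed
  have v_le: "cmod (v t) \<le> (\<Sum>n. BB b * F b ^ n / fact n)" if "t \<in> {a..b}" for t b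
    by (rule Lim_bounded[OF tendsto_norm[OF lim[of t]], of 0]) (use part_le[OF that] in auto)
  have vl: "v t = c" if "t \<le> a" for t
  proof -
    have "(\<Sum>n. y n t) = (\<Sum>n\<in>{0}. y n t)"
    proof (rule suminf_finite)
      show "y n t = 0" if "n \<notin> {0}" for n using yz(1)[OF \<open>t \<le> a\<close>, of "n - 1"] that by simp
    qed simp
    then show ?thesis using yz[OF that] by (simp add: v_def)
  qed
  have vb: "loc_bounded v" unfolding loc_bounded_def
  proof (intro allI exI ballI)
    fix s b t :: real assume "t \<in> {s..b}"
    then show "cmod (v t) \<le> max (cmod c) (\<Sum>n. BB b * F b ^ n / fact n)"
      using v_le[of t b] vl[of t] by (cases "t \<ge> a") auto
  qed
  have key: "v t = y 0 t + (LINT x:{a..<t}|P. k x * v x)" for t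
  proof -
    \<comment> \<open>The partial sums are the Picard iterates; dominated convergence in this
      recursion gives the integral equation for \<open>v\<close>.\<close>
    have 1: "(\<Sum>n<Suc N. y n t) = y 0 t + (LINT x:{a..<t}|P. k x * (\<Sum>n<N. y n x))" for N
    proof -
      have "(LINT x:{a..<t}|P. k x * (\<Sum>n<N. y n x)) = (\<Sum>n<N. (LINT x:{a..<t}|P. k x * y n x))"
      proof (induction N)
        case (Suc N)
        have "loc_int P (\<lambda>x. k x * (\<Sum>n<N. y n x))"
        proof (rule mult)
          show "loc_bounded (\<lambda>x. \<Sum>n<N. y n x)"
            by (induction N) (use ybd in \<open>auto intro: loc_bounded_add loc_bounded_const\<close>)
          show "(\<lambda>x. \<Sum>n<N. y n x) \<in> borel_measurable borel"
            by (intro borel_measurable_sum) (use ybd in blast)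
        qed
        moreover have "loc_int P (\<lambda>x. k x * y N x)" using ybd[of N] by (intro mult) auto
        ultimately show ?case using Suc.IH by (simp add: distrib_left loc_intD)
      qed simp
      then show ?thesis unfolding sum.lessThan_Suc_shift by (simp add: yS)
    qed
    have "(\<lambda>N. (LINT x:{a..<t}|P. k x * (\<Sum>n<N. y n x))) \<longlonglongrightarrow> (LINT x:{a..<t}|P. k x * v x)"
      unfolding set_lebesgue_integral_def
    proof (rule integral_dominated_convergence[where w="\<lambda>x. indicator {a..<t} x * (K * (\<Sum>n. BB t * F t ^ n / fact n))"])
      note Pd = locally_finiteD[OF P]
      have km: "k \<in> borel_measurable P" using k(1) Pd by simp
      show "(\<lambda>x. indicator {a..<t} x *\<^sub>R (k x * v x)) \<in> borel_measurable P"
        using km vm Pd by (intro borel_measurable_scaleR borel_measurable_indicator borel_measurable_times) auto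
      show "(\<lambda>x. indicator {a..<t} x *\<^sub>R (k x * (\<Sum>n<N. y n x))) \<in> borel_measurable P" for N
        using km ybd Pd by (intro borel_measurable_scaleR borel_measurable_indicator borel_measurable_times borel_measurable_sum) auto
      show "integrable P (\<lambda>x. indicator {a..<t} x * (K * (\<Sum>n. BB t * F t ^ n / fact n)))"
        using Pd by (intro integrable_mult_left integrable_real_indicator) auto
      show "AE x in P. (\<lambda>N. indicator {a..<t} x *\<^sub>R (k x * (\<Sum>n<N. y n x))) \<longlonglongrightarrow> indicator {a..<t} x *\<^sub>R (k x * v x)"
        by (intro AE_I2 tendsto_scaleR tendsto_mult tendsto_const lim)
      show "AE x in P. norm (indicator {a..<t} x *\<^sub>R (k x * (\<Sum>n<N. y n x))) \<le> indicator {a..<t} x * (K * (\<Sum>n. BB t * F t ^ n / fact n))" for N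
      proof (rule AE_I2)
        fix x
        show "norm (indicator {a..<t} x *\<^sub>R (k x * (\<Sum>n<N. y n x))) \<le> indicator {a..<t} x * (K * (\<Sum>n. BB t * F t ^ n / fact n))"
        proof (cases "x \<in> {a..<t}")
          case True
          then have "cmod (\<Sum>n<N. y n x) \<le> (\<Sum>n. BB t * F t ^ n / fact n)" by (intro part_le) auto
          then show ?thesis using True k(2)[of x] by (auto simp: norm_mult intro!: mult_mono K0)
        qed auto
      qed
    qed
    then have "(\<lambda>N. y 0 t + (LINT x:{a..<t}|P. k x * (\<Sum>n<N. y n x))) \<longlonglongrightarrow> y 0 t + (LINT x:{a..<t}|P. k x * v x)"
      by (intro tendsto_add tendsto_const)
    moreover have "(\<lambda>N. y 0 t + (LINT x:{a..<t}|P. k x * (\<Sum>n<N. y n x))) \<longlonglongrightarrow> v t"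
      using LIMSEQ_Suc[OF lim[of t]] unfolding 1 .
    ultimately show ?thesis by (rule LIMSEQ_unique[symmetric])
  qed
  have lv: "loc_int P (\<lambda>x. k x * v x)" by (rule mult[OF vm vb])
  have "prim P (\<lambda>t. (LINT x:{a..<t}|P. k x * v x)) (\<lambda>x. k x * v x)"
    using prim_from[OF lv, of a 0] k(3) by simp
  from prim_add[OF this prim0] have "prim P v (\<lambda>x. k x * v x + g x)"
    by (simp add: add.commute key[symmetric])
  then show thesis using vl by (rule that)
qed

text \<open>If \<open>Re m \<le> 0\<close> then \<open>|1 - m p / 2| \<ge> 1\<close> for the mass \<open>p\<close> of an atom, so the balanced
  value \<open>u\<close> is determined by the left limit \<open>v\<close>.\<close>

lemma initial_value_problem:
  assumes P: "locally_finite P"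
    and m: "m \<in> borel_measurable borel" "\<And>x. cmod (m x) \<le> K" "\<forall>x<a. m x = 0" "\<And>x. Re (m x) \<le> 0"
    and h: "loc_int P h" "\<forall>x<a. h x = 0"
  obtains u v where "prim P v (\<lambda>x. m x * u x + h x)" "u = bal P v (\<lambda>x. m x * u x + h x)"
    "\<And>x. x \<le> a \<Longrightarrow> v x = c" "u \<in> borel_measurable borel"
proof -
  have [measurable]: "atom P \<in> borel_measurable borel" "m \<in> borel_measurable borel" "h \<in> borel_measurable borel"
    using atom_borel[OF P] m(1) loc_int_measurable[OF h(1)] by auto
  \<comment> \<open>The balance condition \<open>u = v + p (m u + h) / 2\<close> reads
    \<open>D u = v + p h / 2\<close>. Inserting this \<open>u\<close> into \<open>m u + h\<close>
    leaves an equation for \<open>v\<close> alone, with kernel \<open>k = m / D\<close> and source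
    \<open>g\<close>.\<close>
  define D where "D x = 1 - m x * of_real (atom P x) / 2" for x
  have [measurable]: "D \<in> borel_measurable borel" unfolding D_def by measurable
  have D1: "cmod (D x) \<ge> 1" for x
  proof -
    have "Re (m x) * atom P x \<le> 0" using m(4)[of x] atom_nonneg[of P x] by (rule mult_nonpos_nonneg)
    then have "Re (D x) \<ge> 1" by (simp add: D_def)
    then show ?thesis using complex_Re_le_cmod[of "D x"] by linarith
  qed
  then have D0: "D x \<noteq> 0" for x using norm_zero not_one_le_zero by metis
  have K0: "K \<ge> 0" by (rule order_trans[OF norm_ge_zero m(2)[of 0]])
  define k where "k x = m x / D x" for x
  have k: "k \<in> borel_measurable borel" "\<And>x. cmod (k x) \<le> K" "\<forall>x<a. k x = 0"
  proof -
    show "k \<in> borel_measurable borel" unfolding k_def by measurable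
    show "\<forall>x<a. k x = 0" using m(3) by (simp add: k_def)
    have "cmod (m x) / cmod (D x) \<le> K / 1" for x using m(2)[of x] D1[of x] K0 by (intro frac_le) auto
    then show "cmod (k x) \<le> K" for x by (simp add: k_def norm_divide)
  qed
  define g where "g x = h x + k x * (of_real (atom P x) * h x / 2)" for x
  \<comment> \<open>A primitive of \<open>h\<close> is taken because its jumps \<open>p h\<close>
    are locally bounded, although \<open>h\<close> need not be; this makes the second summand of
    \<open>g\<close> locally integrable.\<close>
  obtain v0 where v0: "prim P v0 h" by (rule prim_exists[OF h(1)]) (rule that)
  have "loc_int P (\<lambda>x. k x * (of_real (atom P x) * h x / 2))"
  proof (rule loc_int_loc_bounded[OF P])
    have "loc_bounded (\<lambda>x. (k x * (1/2)) * (of_real (atom P x) * h x))"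
    proof (rule loc_bounded_mult[OF _ prim_jump_bounded[OF P v0]])
      have "loc_bounded k" unfolding loc_bounded_def using k(2) by blast
      then show "loc_bounded (\<lambda>x. k x * (1/2))" by (rule loc_bounded_mult[OF _ loc_bounded_const])
    qed
    then show "loc_bounded (\<lambda>x. k x * (of_real (atom P x) * h x / 2))" by simp
  qed (use k(1) in measurable)
  then have g: "loc_int P g" unfolding g_def by (rule loc_int_add[OF h(1)])
  have g0: "\<forall>x<a. g x = 0" using h(2) k(3) by (simp add: g_def)
  obtain v where v: "prim P v (\<lambda>x. k x * v x + g x)" "\<And>x. x \<le> a \<Longrightarrow> v x = c"
    by (rule volterra[OF P k g g0, of c]) (rule that)
  have [measurable]: "v \<in> borel_measurable borel" by (rule prim_borel[OF P v(1)])
  define u where "u x = (v x + of_real (atom P x) * h x / 2) / D x" for x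
  have eq: "k x * v x + g x = m x * u x + h x" for x
    using D0[of x] by (simp add: u_def g_def k_def field_simps)
  show thesis
  proof (rule that[of v u])
    show "prim P v (\<lambda>x. m x * u x + h x)" using v(1) unfolding eq .
    show "u = bal P v (\<lambda>x. m x * u x + h x)"
    proof
      fix x
      have "u x * D x = v x + of_real (atom P x) * h x / 2" using D0[of x] by (simp add: u_def)
      then show "u x = bal P v (\<lambda>x. m x * u x + h x) x" by (simp add: bal_def D_def algebra_simps add_divide_distrib)
    qed
    show "u \<in> borel_measurable borel" unfolding u_def by measurable
  qed (rule v(2))
qed

section \<open>The equation with real coefficients\<close>

lemma cnj_borel [measurable]:
  "f \<in> borel_measurable M \<Longrightarrow> (\<lambda>x. cnj (f x)) \<in> borel_measurable M"
  by (rule measurable_compose[OF _ borel_measurable_continuous_onI[OF continuous_on_cnj[OF continuous_on_id]]])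

text \<open>Periodicity is present only through the last three assumptions. In this form the setting
  is stable under reflection, which the section on reflection exploits. The bounds by 1 come from
  taking densities with respect to a sum of measures.\<close>

locale system =
  fixes P :: "real measure" and J :: complex and q w :: "real \<Rightarrow> real"
  assumes P: "locally_finite P"
    and q_borel[measurable]: "q \<in> borel_measurable borel" and w_borel[measurable]: "w \<in> borel_measurable borel"
    and q_le: "\<And>x. \<bar>q x\<bar> \<le> 1" and w_ge: "\<And>x. 0 \<le> w x" and w_le: "\<And>x. w x \<le> 1"
    and J: "Re J = 0" "J \<noteq> 0"
    and atom_bdd: "\<exists>C. \<forall>x. atom P x \<le> C"
    and mass_top: "\<And>M c. \<exists>b\<ge>c. M \<le> (LINT x:{c..<b}|P. w x)"
    and mass_bot: "\<And>M c. \<exists>a\<le>c. M \<le> (LINT x:{a..<c}|P. w x)"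
begin

definition dens :: "(real \<Rightarrow> complex) \<Rightarrow> (real \<Rightarrow> complex) \<Rightarrow> real \<Rightarrow> complex" where
  "dens u f x = (of_real (w x) * f x - of_real (q x) * u x) / J"

text \<open>The left limits \<open>v\<close> are an argument of their own because they, and not
  \<open>u\<close>, form a primitive. The last clause is the balance condition; at an atom it is an
  implicit equation for \<open>u\<close>, since \<open>dens u f\<close> contains
  \<open>u\<close>.\<close>

definition sol :: "(real \<Rightarrow> complex) \<Rightarrow> (real \<Rightarrow> complex) \<Rightarrow> (real \<Rightarrow> complex) \<Rightarrow> bool" where
  "sol v u f \<longleftrightarrow> u \<in> borel_measurable borel \<and> f \<in> borel_measurable borel \<and>
     prim P v (dens u f) \<and> u = bal P v (dens u f)"

text \<open>Borel functions with a weight on \<open>P\<close>, so that all integrals refer to one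
  measure; classes for the completed measure are treated only at the end.\<close>

definition l2w :: "(real \<Rightarrow> complex) \<Rightarrow> bool" where
  "l2w f \<longleftrightarrow> f \<in> borel_measurable borel \<and> integrable P (\<lambda>x. w x * (cmod (f x))\<^sup>2)"

section \<open>Square-integrable functions with weight \<open>w\<close>\<close>

lemma setsP[measurable_cong]: "sets P = sets borel"
  using locally_finiteD[OF P] by simp

lemma w_loc_int: "loc_int P w"
proof -
  have "loc_int P (\<lambda>x. complex_of_real (w x))"
    by (rule loc_int_loc_bounded[OF P])
       (use w_ge w_le in \<open>auto simp: loc_bounded_def abs_of_nonneg\<close>)
  then show ?thesis by (simp only: loc_int_of_real_iff)
qed

lemma cnj_J: "cnj J = - J"
  by (rule complex_eqI) (use J in auto)

lemma integrable_loc_int: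
  fixes f :: "real \<Rightarrow> 'b::{banach, second_countable_topology}"
  assumes "integrable P f" shows "loc_int P f"
  unfolding loc_int_def
proof (intro conjI allI)
  show "f \<in> borel_measurable borel" using borel_measurable_integrable[OF assms] by simp
  show "set_integrable P {a..<b} f" for a b unfolding set_integrable_def
    by (rule integrable_mult_indicator[OF _ assms]) simp
qed

lemma l2w_borel: "l2w f \<Longrightarrow> f \<in> borel_measurable borel"
  and l2w_int: "l2w f \<Longrightarrow> integrable P (\<lambda>x. w x * (cmod (f x))\<^sup>2)"
  by (simp_all add: l2w_def)

lemma l2w_loc_int:
  assumes "l2w f" shows "loc_int P (\<lambda>x. of_real (w x) * f x)"
proof (rule loc_int_bound[OF P loc_int_add[OF w_loc_int integrable_loc_int[OF l2w_int[OF assms]]]])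
  show "(\<lambda>x. of_real (w x) * f x) \<in> borel_measurable borel" using l2w_borel[OF assms] by measurable
  have "w x * cmod (f x) \<le> 1 * \<bar>w x + w x * (cmod (f x))\<^sup>2\<bar>" for x
  proof -
    have "cmod (f x) \<le> 1 + (cmod (f x))\<^sup>2"
      using sum_squares_bound[of 1 "cmod (f x)"] norm_ge_zero[of "f x"]
      unfolding power_one mult_1_right by linarith
    then have "w x * cmod (f x) \<le> w x * (1 + (cmod (f x))\<^sup>2)" by (rule mult_left_mono[OF _ w_ge])
    then show ?thesis by (simp add: distrib_left)
  qed
  then show "\<exists>C. \<forall>x\<in>{a..b}. norm (of_real (w x) * f x) \<le> C * norm (w x + w x * (cmod (f x))\<^sup>2)" for a b
    by (intro exI[of _ 1]) (simp add: norm_mult w_ge)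
qed

lemma l2w_prod_integrable:
  assumes "l2w f" "l2w g" shows "integrable P (\<lambda>x. of_real (w x) * (cnj (f x) * g x))"
proof (rule Bochner_Integration.integrable_bound)
  show "integrable P (\<lambda>x. w x * (cmod (f x))\<^sup>2 + w x * (cmod (g x))\<^sup>2)"
    using l2w_int assms by simp
  show "(\<lambda>x. of_real (w x) * (cnj (f x) * g x)) \<in> borel_measurable P"
    using l2w_borel[OF assms(1)] l2w_borel[OF assms(2)] by measurable
  show "AE x in P. norm (of_real (w x) * (cnj (f x) * g x)) \<le> norm (w x * (cmod (f x))\<^sup>2 + w x * (cmod (g x))\<^sup>2)"
  proof (rule AE_I2)
    fix x
    have "cmod (f x) * cmod (g x) \<le> (cmod (f x))\<^sup>2 + (cmod (g x))\<^sup>2"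
      using sum_squares_bound[of "cmod (f x)" "cmod (g x)"]
        mult_nonneg_nonneg[OF norm_ge_zero[of "f x"] norm_ge_zero[of "g x"]] by linarith
    then have "w x * (cmod (f x) * cmod (g x)) \<le> w x * ((cmod (f x))\<^sup>2 + (cmod (g x))\<^sup>2)"
      by (rule mult_left_mono[OF _ w_ge])
    then show "norm (of_real (w x) * (cnj (f x) * g x)) \<le> norm (w x * (cmod (f x))\<^sup>2 + w x * (cmod (g x))\<^sup>2)"
      by (simp add: norm_mult w_ge distrib_left)
  qed
qed

lemma l2w_add:
  assumes "l2w f" "l2w g" shows "l2w (\<lambda>x. f x + g x)"
  unfolding l2w_def
proof
  show m: "(\<lambda>x. f x + g x) \<in> borel_measurable borel" using l2w_borel assms by simp
  show "integrable P (\<lambda>x. w x * (cmod (f x + g x))\<^sup>2)"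
  proof (rule Bochner_Integration.integrable_bound)
    show "integrable P (\<lambda>x. 2 * (w x * (cmod (f x))\<^sup>2) + 2 * (w x * (cmod (g x))\<^sup>2))"
      using l2w_int assms by simp
    show "(\<lambda>x. w x * (cmod (f x + g x))\<^sup>2) \<in> borel_measurable P" using m by measurable
    show "AE x in P. norm (w x * (cmod (f x + g x))\<^sup>2) \<le> norm (2 * (w x * (cmod (f x))\<^sup>2) + 2 * (w x * (cmod (g x))\<^sup>2))"
    proof (rule AE_I2)
      fix x
      have "(cmod (f x + g x))\<^sup>2 \<le> (cmod (f x) + cmod (g x))\<^sup>2"
        by (rule power_mono[OF norm_triangle_ineq]) simp
      also have "\<dots> \<le> 2 * (cmod (f x))\<^sup>2 + 2 * (cmod (g x))\<^sup>2"
        using sum_squares_bound[of "cmod (f x)" "cmod (g x)"] by (simp add: power2_sum)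
      finally have "w x * (cmod (f x + g x))\<^sup>2 \<le> w x * (2 * (cmod (f x))\<^sup>2 + 2 * (cmod (g x))\<^sup>2)"
        by (rule mult_left_mono[OF _ w_ge])
      then show "norm (w x * (cmod (f x + g x))\<^sup>2) \<le> norm (2 * (w x * (cmod (f x))\<^sup>2) + 2 * (w x * (cmod (g x))\<^sup>2))"
        by (simp add: w_ge distrib_left)
    qed
  qed
qed

lemma l2w_cmult: "l2w f \<Longrightarrow> l2w (\<lambda>x. c * f x)"
  unfolding l2w_def
proof
  assume f: "f \<in> borel_measurable borel \<and> integrable P (\<lambda>x. w x * (cmod (f x))\<^sup>2)"
  then have [measurable]: "f \<in> borel_measurable borel" by blast
  show "(\<lambda>x. c * f x) \<in> borel_measurable borel" by measurable
  have "integrable P (\<lambda>x. (cmod c)\<^sup>2 * (w x * (cmod (f x))\<^sup>2))" using f by simp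
  then show "integrable P (\<lambda>x. w x * (cmod (c * f x))\<^sup>2)"
    by (simp add: norm_mult power_mult_distrib mult.left_commute)
qed

lemma l2w_indicator:
  assumes "l2w f" "A \<in> sets borel" shows "l2w (\<lambda>x. indicator A x * f x)"
proof -
  have "integrable P (\<lambda>x. indicator A x *\<^sub>R (w x * (cmod (f x))\<^sup>2))"
    using assms by (intro integrable_mult_indicator l2w_int) auto
  moreover have "indicator A x *\<^sub>R (w x * (cmod (f x))\<^sup>2) = w x * (cmod (indicator A x * f x))\<^sup>2" for x
    by (simp add: indicator_def)
  ultimately have "integrable P (\<lambda>x. w x * (cmod (indicator A x * f x))\<^sup>2)" by (simp only:)
  then show ?thesis using l2w_borel[OF assms(1)] assms(2) by (simp add: l2w_def)
qed

lemma l2w_sq_add: 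
  assumes "l2w u" "l2w f" shows "integrable P (\<lambda>x. w x * ((cmod (u x))\<^sup>2 + (cmod (f x))\<^sup>2))"
  using l2w_int[OF assms(1)] l2w_int[OF assms(2)] by (simp add: distrib_left)

text \<open>\<open>u\<close> and \<open>v\<close> differ by half a jump, and the jump is at most
  \<open>C (|u| + |f|) / |J|\<close> because \<open>|q|\<close> and \<open>w\<close> are at most 1.
  That one constant serves all points is the contribution of the bounded atoms.\<close>

lemma sol_left_le:
  obtains K where "K \<ge> 0" "\<And>v u f x. sol v u f \<Longrightarrow> cmod (v x) \<le> K * (cmod (u x) + cmod (f x))"
proof -
  obtain C where C: "\<And>x. atom P x \<le> C" using atom_bdd by blast
  have C0: "C \<ge> 0" using C[of 0] atom_nonneg[of P 0] by linarith
  have J0: "cmod J > 0" using J by simp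
  define K where "K = 1 + C / cmod J"
  have "cmod (v x) \<le> K * (cmod (u x) + cmod (f x))" if s: "sol v u f" for v u f x
  proof -
    let ?d = "dens u f x"
    have "u x = bal P v (dens u f) x" using s unfolding sol_def by metis
    then have v: "v x = u x - of_real (atom P x) * ?d / 2" by (simp add: bal_def)
    have "cmod (of_real (w x) * f x - of_real (q x) * u x) \<le> w x * cmod (f x) + \<bar>q x\<bar> * cmod (u x)"
      using norm_triangle_ineq4[of "of_real (w x) * f x" "of_real (q x) * u x"] by (simp add: norm_mult w_ge)
    also have "\<dots> \<le> 1 * cmod (f x) + 1 * cmod (u x)"
      by (intro add_mono mult_right_mono w_le q_le norm_ge_zero)
    finally have d: "cmod ?d \<le> (cmod (u x) + cmod (f x)) / cmod J"
      using J0 by (simp add: dens_def norm_divide divide_right_mono add.commute)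
    have "atom P x * cmod ?d \<le> C * ((cmod (u x) + cmod (f x)) / cmod J)"
      by (intro mult_mono C d C0) simp
    moreover have "0 \<le> C * ((cmod (u x) + cmod (f x)) / cmod J)" using C0 J0 by simp
    moreover have "cmod (v x) \<le> cmod (u x) + atom P x * cmod ?d / 2"
      using norm_triangle_ineq4[of "u x" "of_real (atom P x) * ?d / 2"] atom_nonneg[of P x]
      unfolding v by (simp add: norm_mult)
    ultimately have "cmod (v x) \<le> (cmod (u x) + cmod (f x)) + C * ((cmod (u x) + cmod (f x)) / cmod J)"
      using norm_ge_zero[of "f x"] by linarith
    also have "\<dots> = K * (cmod (u x) + cmod (f x))" by (simp add: K_def distrib_right)
    finally show ?thesis .
  qed
  moreover have "K \<ge> 0" using C0 J0 by (simp add: K_def)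
  ultimately show thesis using that by blast
qed

text \<open>Markov's inequality for the measure with density \<open>w\<close>, applied to a majorant
  \<open>K\<close> of \<open>|h|\<close>.\<close>

lemma mass_le:
  fixes h :: "real \<Rightarrow> complex"
  assumes K: "integrable P (\<lambda>x. w x * K x)" "\<And>x. cmod (h x) \<le> K x"
    and e: "e > 0" "\<And>x. x \<in> {a..<b} \<Longrightarrow> e < cmod (h x)"
  shows "(LINT x:{a..<b}|P. w x) \<le> integral\<^sup>L P (\<lambda>x. w x * K x) / e"
proof -
  have wK: "w x * K x \<ge> 0" for x using order_trans[OF norm_ge_zero K(2)[of x]] w_ge by simp
  have "e * (LINT x:{a..<b}|P. w x) = (\<integral>x. indicator {a..<b} x *\<^sub>R (e * w x) \<partial>P)"
    unfolding set_lebesgue_integral_def by (simp flip: integral_mult_right_zero add: mult_ac)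
  also have "\<dots> \<le> integral\<^sup>L P (\<lambda>x. w x * K x)"
  proof (rule integral_mono)
    show "integrable P (\<lambda>x. indicator {a..<b} x *\<^sub>R (e * w x))"
      by (rule set_integrable_mult_right[OF loc_intD[OF w_loc_int], unfolded set_integrable_def])
    show "indicator {a..<b} x *\<^sub>R (e * w x) \<le> w x * K x" for x
    proof (cases "x \<in> {a..<b}")
      case True
      then have "e \<le> K x" using e(2)[of x] K(2)[of x] by auto
      then have "w x * e \<le> w x * K x" by (rule mult_left_mono[OF _ w_ge])
      then show ?thesis using True by (simp add: mult.commute)
    qed (simp add: wK)
  qed (rule K(1))
  finally show ?thesis using e(1) by (simp add: pos_le_divide_eq mult.commute)
qed

text \<open>A function dominated in \<open>L\<^sup>1(w)\<close> cannot have a non-zero limit since \<open>w\<close> has infinite mass near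
  both ends.\<close>

lemma limit_top_zero:
  fixes h :: "real \<Rightarrow> complex"
  assumes lim: "(h \<longlongrightarrow> L) at_top" and K: "integrable P (\<lambda>x. w x * K x)" "\<And>x. cmod (h x) \<le> K x"
  shows "L = 0"
proof (rule ccontr)
  assume "L \<noteq> 0"
  define e where "e = cmod L / 2"
  have e: "e > 0" "e < cmod L" using \<open>L \<noteq> 0\<close> by (simp_all add: e_def)
  have "eventually (\<lambda>x. cmod (h x) > e) at_top" by (rule order_tendstoD(1)[OF tendsto_norm[OF lim] e(2)])
  then obtain c where c: "\<And>x. x \<ge> c \<Longrightarrow> cmod (h x) > e" by (auto simp: eventually_at_top_linorder)
  obtain b where "integral\<^sup>L P (\<lambda>x. w x * K x) / e + 1 \<le> (LINT x:{c..<b}|P. w x)" using mass_top by blast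
  moreover have "(LINT x:{c..<b}|P. w x) \<le> integral\<^sup>L P (\<lambda>x. w x * K x) / e"
    by (rule mass_le[OF K e(1)]) (rule c, simp)
  ultimately show False by linarith
qed

lemma limit_bot_zero:
  fixes h :: "real \<Rightarrow> complex"
  assumes lim: "(h \<longlongrightarrow> L) at_bot" and K: "integrable P (\<lambda>x. w x * K x)" "\<And>x. cmod (h x) \<le> K x"
  shows "L = 0"
proof (rule ccontr)
  assume "L \<noteq> 0"
  define e where "e = cmod L / 2"
  have e: "e > 0" "e < cmod L" using \<open>L \<noteq> 0\<close> by (simp_all add: e_def)
  have "eventually (\<lambda>x. cmod (h x) > e) at_bot" by (rule order_tendstoD(1)[OF tendsto_norm[OF lim] e(2)])
  then obtain c where c: "\<And>x. x \<le> c \<Longrightarrow> cmod (h x) > e" by (auto simp: eventually_at_bot_linorder)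
  obtain a where "integral\<^sup>L P (\<lambda>x. w x * K x) / e + 1 \<le> (LINT x:{a..<c}|P. w x)" using mass_bot by blast
  moreover have "(LINT x:{a..<c}|P. w x) \<le> integral\<^sup>L P (\<lambda>x. w x * K x) / e"
    by (rule mass_le[OF K e(1)]) (rule c, simp)
  ultimately show False by linarith
qed

lemma sol_dominated:
  assumes s: "sol v u f" "l2w u" "l2w f" and t: "sol y z g" "l2w z" "l2w g"
  obtains D where "integrable P (\<lambda>x. w x * D x)" "\<And>x. cmod (cnj (y x) * v x) \<le> D x"
proof -
  obtain K where K: "K \<ge> 0" "\<And>v u f x. sol v u f \<Longrightarrow> cmod (v x) \<le> K * (cmod (u x) + cmod (f x))"
    by (rule sol_left_le) (rule that)
  have sq: "(cmod (v x))\<^sup>2 \<le> 2 * K\<^sup>2 * ((cmod (u x))\<^sup>2 + (cmod (f x))\<^sup>2)" if "sol v u f" for v u f x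
  proof -
    have "(cmod (v x))\<^sup>2 \<le> (K * (cmod (u x) + cmod (f x)))\<^sup>2"
      by (rule power_mono[OF K(2)[OF that]]) simp
    also have "\<dots> \<le> K\<^sup>2 * (2 * ((cmod (u x))\<^sup>2 + (cmod (f x))\<^sup>2))"
      unfolding power_mult_distrib
      using sum_squares_bound[of "cmod (u x)" "cmod (f x)"] by (intro mult_left_mono) (simp_all add: power2_sum)
    also have "\<dots> = 2 * K\<^sup>2 * ((cmod (u x))\<^sup>2 + (cmod (f x))\<^sup>2)" by (simp add: algebra_simps)
    finally show ?thesis .
  qed
  let ?D = "\<lambda>x. 2 * K\<^sup>2 * ((cmod (z x))\<^sup>2 + (cmod (g x))\<^sup>2) + 2 * K\<^sup>2 * ((cmod (u x))\<^sup>2 + (cmod (f x))\<^sup>2)"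
  have "integrable P (\<lambda>x. 2 * K\<^sup>2 * (w x * ((cmod (z x))\<^sup>2 + (cmod (g x))\<^sup>2)) + 2 * K\<^sup>2 * (w x * ((cmod (u x))\<^sup>2 + (cmod (f x))\<^sup>2)))"
    using l2w_sq_add[OF s(2,3)] l2w_sq_add[OF t(2,3)] by simp
  moreover have "2 * K\<^sup>2 * (w x * ((cmod (z x))\<^sup>2 + (cmod (g x))\<^sup>2)) + 2 * K\<^sup>2 * (w x * ((cmod (u x))\<^sup>2 + (cmod (f x))\<^sup>2)) = w x * ?D x" for x
    by (simp add: algebra_simps)
  ultimately have "integrable P (\<lambda>x. w x * ?D x)" by simp
  moreover have "cmod (cnj (y x) * v x) \<le> ?D x" for x
  proof -
    have "0 \<le> cmod (y x) * cmod (v x)" by simp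
    then have "cmod (y x) * cmod (v x) \<le> (cmod (y x))\<^sup>2 + (cmod (v x))\<^sup>2"
      using sum_squares_bound[of "cmod (y x)" "cmod (v x)"] by linarith
    then show ?thesis using sq[OF s(1), of x] sq[OF t(1), of x] by (simp add: norm_mult)
  qed
  ultimately show thesis by (rule that)
qed

lemma prim_limits:
  assumes h: "prim P h d" and d: "integrable P d"
  shows "(h \<longlongrightarrow> h 0 + (LINT x:{0..}|P. d x)) at_top"
    and "(h \<longlongrightarrow> h 0 - (LINT x:{..<0}|P. d x)) at_bot"
    and "(LINT x:{..<0}|P. d x) + (LINT x:{0..}|P. d x) = integral\<^sup>L P d"
proof -
  have [measurable]: "d \<in> borel_measurable P" using d by (rule borel_measurable_integrable)
  have nd: "integrable P (\<lambda>x. norm (d x))" using d by simp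
  show "(h \<longlongrightarrow> h 0 + (LINT x:{0..}|P. d x)) at_top"
  proof (rule tendsto_at_topI_sequentially)
    fix X :: "nat \<Rightarrow> real" assume X: "filterlim X at_top sequentially"
    have "(\<lambda>n. \<integral>x. indicator {0..<X n} x *\<^sub>R d x \<partial>P) \<longlonglongrightarrow> (\<integral>x. indicator {0..} x *\<^sub>R d x \<partial>P)"
    proof (rule integral_dominated_convergence[OF _ _ nd])
      show "AE x in P. (\<lambda>n. indicator {0..<X n} x *\<^sub>R d x) \<longlonglongrightarrow> indicator {0..} x *\<^sub>R d x"
      proof (rule AE_I2)
        fix x
        have "eventually (\<lambda>n. X n > x) sequentially" using X by (simp add: filterlim_at_top_dense)
        then have "eventually (\<lambda>n. indicator {0..<X n} x *\<^sub>R d x = indicator {0..} x *\<^sub>R d x) sequentially"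
          by (rule eventually_mono) (simp add: indicator_def)
        then show "(\<lambda>n. indicator {0..<X n} x *\<^sub>R d x) \<longlonglongrightarrow> indicator {0..} x *\<^sub>R d x"
          by (rule tendsto_eventually)
      qed
      show "AE x in P. norm (indicator {0..<X n} x *\<^sub>R d x) \<le> norm (d x)" for n
        by (rule AE_I2) (simp add: indicator_def)
    qed measurable
    then have "(\<lambda>n. h 0 + (LINT x:{0..<X n}|P. d x)) \<longlonglongrightarrow> h 0 + (LINT x:{0..}|P. d x)"
      unfolding set_lebesgue_integral_def by (rule tendsto_add[OF tendsto_const])
    moreover have "eventually (\<lambda>n. X n > 0) sequentially" using X by (simp add: filterlim_at_top_dense)
    then have "eventually (\<lambda>n. h 0 + (LINT x:{0..<X n}|P. d x) = h (X n)) sequentially"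
      by (rule eventually_mono) (simp add: primD[OF h, symmetric])
    ultimately show "(\<lambda>n. h (X n)) \<longlonglongrightarrow> h 0 + (LINT x:{0..}|P. d x)"
      by (rule Lim_transform_eventually)
  qed
  show "(h \<longlongrightarrow> h 0 - (LINT x:{..<0}|P. d x)) at_bot"
    unfolding filterlim_at_bot_mirror
  proof (rule tendsto_at_topI_sequentially)
    fix X :: "nat \<Rightarrow> real" assume X: "filterlim X at_top sequentially"
    have "(\<lambda>n. \<integral>x. indicator {- X n..<0} x *\<^sub>R d x \<partial>P) \<longlonglongrightarrow> (\<integral>x. indicator {..<0} x *\<^sub>R d x \<partial>P)"
    proof (rule integral_dominated_convergence[OF _ _ nd])
      show "AE x in P. (\<lambda>n. indicator {- X n..<0} x *\<^sub>R d x) \<longlonglongrightarrow> indicator {..<0} x *\<^sub>R d x"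
      proof (rule AE_I2)
        fix x
        have "eventually (\<lambda>n. X n > - x) sequentially" using X by (simp add: filterlim_at_top_dense)
        then have "eventually (\<lambda>n. indicator {- X n..<0} x *\<^sub>R d x = indicator {..<0} x *\<^sub>R d x) sequentially"
          by (rule eventually_mono) (auto simp: indicator_def)
        then show "(\<lambda>n. indicator {- X n..<0} x *\<^sub>R d x) \<longlonglongrightarrow> indicator {..<0} x *\<^sub>R d x"
          by (rule tendsto_eventually)
      qed
      show "AE x in P. norm (indicator {- X n..<0} x *\<^sub>R d x) \<le> norm (d x)" for n
        by (rule AE_I2) (simp add: indicator_def)
    qed measurable
    then have "(\<lambda>n. h 0 - (LINT x:{- X n..<0}|P. d x)) \<longlonglongrightarrow> h 0 - (LINT x:{..<0}|P. d x)"
      unfolding set_lebesgue_integral_def by (rule tendsto_diff[OF tendsto_const])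
    moreover have "eventually (\<lambda>n. X n > 0) sequentially" using X by (simp add: filterlim_at_top_dense)
    then have "eventually (\<lambda>n. h 0 - (LINT x:{- X n..<0}|P. d x) = h (- X n)) sequentially"
      by (rule eventually_mono) (simp add: primD[OF h, symmetric])
    ultimately show "(\<lambda>n. h (- X n)) \<longlonglongrightarrow> h 0 - (LINT x:{..<0}|P. d x)"
      by (rule Lim_transform_eventually)
  qed
  have "set_integrable P A d" if "A \<in> sets borel" for A
    unfolding set_integrable_def using that by (intro integrable_mult_indicator d) simp
  then have "(LINT x:{..<0} \<union> {0..}|P. d x) = (LINT x:{..<0}|P. d x) + (LINT x:{0..}|P. d x)"
    by (intro set_integral_Un) auto
  moreover have "{..<0} \<union> {0..} = (UNIV :: real set)" by auto
  ultimately show "(LINT x:{..<0}|P. d x) + (LINT x:{0..}|P. d x) = integral\<^sup>L P d"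
    by (simp add: set_lebesgue_integral_def)
qed

lemma sol_prim: "sol v u f \<Longrightarrow> prim P v (dens u f)"
  and sol_bal: "sol v u f \<Longrightarrow> bal P v (dens u f) = u"
  by (auto simp: sol_def)

text \<open>Lagrange's identity. The product rule involves the balanced values \<open>u\<close> and
  \<open>z\<close>, the same values that occur in the densities, so the \<open>q\<close> terms
  cancel at atoms as well; \<open>q\<close> is real and \<open>cnj J = - J\<close>.\<close>

lemma sol_prim_prod:
  assumes s: "sol v u f" and t: "sol y z g"
  shows "prim P (\<lambda>x. cnj (y x) * v x) (\<lambda>x. of_real (w x) * (cnj (z x) * f x - cnj (g x) * u x) / J)"
proof -
  have b: "bal P (\<lambda>x. cnj (y x)) (\<lambda>x. cnj (dens z g x)) x = cnj (z x)" for x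
  proof -
    have "bal P (\<lambda>x. cnj (y x)) (\<lambda>x. cnj (dens z g x)) x = cnj (bal P y (dens z g) x)"
      by (simp add: bal_def)
    then show ?thesis unfolding sol_bal[OF t] .
  qed
  have "prim P (\<lambda>x. cnj (y x) * v x) (\<lambda>x. u x * cnj (dens z g x) + cnj (z x) * dens u f x)"
    using prim_mult[OF P prim_cnj[OF sol_prim[OF t]] sol_prim[OF s]]
    unfolding b sol_bal[OF s] .
  moreover have "u x * cnj (dens z g x) + cnj (z x) * dens u f x
     = of_real (w x) * (cnj (z x) * f x - cnj (g x) * u x) / J" for x
    using J(2) by (simp add: dens_def cnj_J field_simps)
  ultimately show ?thesis by simp
qed

lemma sol_symmetric:
  assumes s: "sol v u f" "l2w u" "l2w f" and t: "sol y z g" "l2w z" "l2w g"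
  shows "(\<integral>x. of_real (w x) * (cnj (z x) * f x) \<partial>P) = (\<integral>x. of_real (w x) * (cnj (g x) * u x) \<partial>P)"
proof -
  let ?d = "\<lambda>x. of_real (w x) * (cnj (z x) * f x - cnj (g x) * u x) / J"
  let ?h = "\<lambda>x. cnj (y x) * v x"
  have 1: "integrable P (\<lambda>x. of_real (w x) * (cnj (z x) * f x))" "integrable P (\<lambda>x. of_real (w x) * (cnj (g x) * u x))"
    using l2w_prod_integrable s t by auto
  have deq: "?d = (\<lambda>x. (of_real (w x) * (cnj (z x) * f x) - of_real (w x) * (cnj (g x) * u x)) / J)"
    by (simp add: right_diff_distrib)
  have d: "integrable P ?d" unfolding deq using 1 by simp
  note pr = sol_prim_prod[OF s(1) t(1)]
  obtain D where D: "integrable P (\<lambda>x. w x * D x)" "\<And>x. cmod (?h x) \<le> D x"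
    by (rule sol_dominated[OF s t]) (rule that)
  have "?h 0 + (LINT x:{0..}|P. ?d x) = 0" by (rule limit_top_zero[OF prim_limits(1)[OF pr d] D])
  then have B: "(LINT x:{0..}|P. ?d x) = - ?h 0" by (rule minus_unique[symmetric])
  have "?h 0 - (LINT x:{..<0}|P. ?d x) = 0" by (rule limit_bot_zero[OF prim_limits(2)[OF pr d] D])
  then have A: "(LINT x:{..<0}|P. ?d x) = ?h 0" by (simp only: right_minus_eq)
  have "integral\<^sup>L P ?d = 0"
    unfolding prim_limits(3)[OF pr d, symmetric] A B by (rule right_minus)
  then show ?thesis unfolding deq using 1 J(2) by simp
qed

end

section \<open>Consequences of Lagrange's identity and the energy estimate\<close>

context system
begin

lemma dens_diff: "dens u f x - dens y g x = dens (\<lambda>x. u x - y x) (\<lambda>x. f x - g x) x"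
  by (simp add: dens_def algebra_simps flip: diff_divide_distrib)

lemma sol_diff:
  assumes s: "sol v u f" and t: "sol y z g"
  shows "sol (\<lambda>x. v x - y x) (\<lambda>x. u x - z x) (\<lambda>x. f x - g x)"
proof -
  have [measurable]: "u \<in> borel_measurable borel" "f \<in> borel_measurable borel"
    "z \<in> borel_measurable borel" "g \<in> borel_measurable borel"
    using s t by (simp_all add: sol_def)
  have p: "prim P (\<lambda>x. v x - y x) (dens (\<lambda>x. u x - z x) (\<lambda>x. f x - g x))"
    using prim_diff[OF sol_prim[OF s] sol_prim[OF t]] unfolding dens_diff .
  have "(\<lambda>x. u x - z x) = bal P (\<lambda>x. v x - y x) (dens (\<lambda>x. u x - z x) (\<lambda>x. f x - g x))"
  proof
    fix x
    have "u x - z x = bal P v (dens u f) x - bal P y (dens z g) x" unfolding sol_bal[OF s] sol_bal[OF t] ..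
    also have "\<dots> = (v x - y x) + of_real (atom P x) * (dens u f x - dens z g x) / 2"
      by (simp add: bal_def algebra_simps diff_divide_distrib)
    finally show "u x - z x = bal P (\<lambda>x. v x - y x) (dens (\<lambda>x. u x - z x) (\<lambda>x. f x - g x)) x"
      unfolding dens_diff by (simp add: bal_def)
  qed
  with p show ?thesis unfolding sol_def by simp
qed

lemma prim_zero_const:
  assumes "prim P h d" "\<And>x. x \<in> {a..<b} \<Longrightarrow> d x = 0" "a \<le> b" shows "h b = h a"
proof -
  have "h b - h a = (LINT x:{a..<b}|P. d x)" by (rule primD[OF assms(1,3)])
  also have "\<dots> = (\<integral>x. 0 \<partial>P)" unfolding set_lebesgue_integral_def
    by (rule Bochner_Integration.integral_cong[OF refl]) (use assms(2) in \<open>auto simp: indicator_def\<close>)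
  finally show ?thesis by simp
qed

lemma sol_vanish_top:
  assumes s: "sol v u f" "l2w u" "l2w f" and c: "\<And>x. x \<ge> c \<Longrightarrow> cnj (v x) * v x = C"
  shows "C = 0"
proof -
  obtain D where D: "integrable P (\<lambda>x. w x * D x)" "\<And>x. cmod (cnj (v x) * v x) \<le> D x"
    by (rule sol_dominated[OF s s]) (rule that)
  have "((\<lambda>x. cnj (v x) * v x) \<longlongrightarrow> C) at_top"
    by (rule tendsto_eventually) (use c in \<open>auto simp: eventually_at_top_linorder\<close>)
  then show ?thesis by (rule limit_top_zero[OF _ D])
qed

lemma sol_vanish_bot:
  assumes s: "sol v u f" "l2w u" "l2w f" and c: "\<And>x. x \<le> c \<Longrightarrow> cnj (v x) * v x = C"
  shows "C = 0"
proof -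
  obtain D where D: "integrable P (\<lambda>x. w x * D x)" "\<And>x. cmod (cnj (v x) * v x) \<le> D x"
    by (rule sol_dominated[OF s s]) (rule that)
  have "((\<lambda>x. cnj (v x) * v x) \<longlongrightarrow> C) at_bot"
    by (rule tendsto_eventually) (use c in \<open>auto simp: eventually_at_bot_linorder\<close>)
  then show ?thesis by (rule limit_bot_zero[OF _ D])
qed

text \<open>For real \<open>l\<close> the modulus of \<open>v\<close> is constant, so it vanishes as \<open>u\<close> is in \<open>L\<^sup>2(w)\<close>.\<close>

lemma sol_real_zero:
  assumes s: "sol v u (\<lambda>x. of_real l * u x)" and u: "l2w u"
  shows "u x = 0"
proof -
  have pr: "prim P (\<lambda>x. cnj (v x) * v x) (\<lambda>x. of_real (w x) * (cnj (u x) * (of_real l * u x) - cnj (of_real l * u x) * u x) / J)"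
    by (rule sol_prim_prod[OF s s])
  have const: "cnj (v b) * v b = cnj (v a) * v a" if "a \<le> b" for a b
    by (rule prim_zero_const[OF pr _ that]) simp
  have "cnj (v 0) * v 0 = 0"
    by (rule sol_vanish_top[OF s u l2w_cmult[OF u] const])
  then have "cnj (v x) * v x = 0"
    using const[of 0 x] const[of x 0] by (cases "0 \<le> x") auto
  then have "v x = 0" by simp
  \<comment> \<open>At an atom \<open>v = 0\<close> only says that \<open>u\<close> is half of its
    own jump. A non-zero \<open>u\<close> would then make \<open>J\<close> equal to a real
    number.\<close>
  then have "u x = of_real (atom P x) * dens u (\<lambda>x. of_real l * u x) x / 2"
    using fun_cong[OF sol_bal[OF s], of x] by (simp add: bal_def)
  then have "u x = of_real (atom P x * (w x * l - q x) / 2) * u x / J"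
    by (simp add: dens_def algebra_simps)
  then have "u x * J = of_real (atom P x * (w x * l - q x) / 2) * u x"
    using J(2) by (metis nonzero_divide_eq_eq)
  then have "u x = 0 \<or> J = of_real (atom P x * (w x * l - q x) / 2)"
    by (metis mult.commute mult_cancel_right)
  moreover have "J \<noteq> of_real r" for r
    using J by (metis Re_complex_of_real of_real_0)
  ultimately show ?thesis by blast
qed

lemma inner_loc_int:
  assumes "u \<in> borel_measurable borel" "loc_bounded u"
  shows "loc_int P (\<lambda>x. w x * (cmod (u x))\<^sup>2)"
proof -
  have "loc_bounded (\<lambda>x. complex_of_real (w x))"
    using w_ge w_le by (auto simp: loc_bounded_def abs_of_nonneg)
  moreover have "loc_bounded (\<lambda>x. cnj (u x))" using assms(2) by (simp add: loc_bounded_def)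
  ultimately have "loc_bounded (\<lambda>x. of_real (w x) * (cnj (u x) * u x))"
    by (intro loc_bounded_mult assms(2))
  then have "loc_int P (\<lambda>x. of_real (w x) * (cnj (u x) * u x))"
    using assms(1) by (intro loc_int_loc_bounded[OF P]) measurable
  moreover have "of_real (w x) * (cnj (u x) * u x) = complex_of_real (w x * (cmod (u x))\<^sup>2)" for x
    by (simp add: complex_norm_square[symmetric] mult.commute)
  ultimately show ?thesis by (simp only: loc_int_of_real_iff)
qed

lemma sol_loc_bounded: "sol v u f \<Longrightarrow> loc_bounded u"
  using bal_loc_bounded[OF P sol_prim] sol_bal by metis

lemma J_eq: "J = \<i> * of_real (Im J)" and ImJ: "Im J \<noteq> 0" and cmod_J: "cmod J = \<bar>Im J\<bar>"
proof -
  show e: "J = \<i> * of_real (Im J)" by (rule complex_eqI) (use J in auto)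
  then show "Im J \<noteq> 0" using J(2) by (metis mult_zero_right of_real_0)
  show "cmod J = \<bar>Im J\<bar>" by (subst e) (simp add: norm_mult)
qed

text \<open>Lagrange's identity of the solution with itself. The term with \<open>Im z\<close>
  contributes \<open>- 2 k w |u|^2\<close>; by Young's inequality the mixed term with
  \<open>g\<close> is at most \<open>k w |u|^2 + w |g|^2 / (k (Im J)^2)\<close>, so half of the good
  term absorbs it and the other half remains on the left-hand side.\<close>

lemma energy:
  assumes s: "sol v u (\<lambda>x. z * u x + g x)" and g: "l2w g" and k: "k = - (Im z / Im J)" "k > 0" and "a \<le> b"
  shows "(cmod (v b))\<^sup>2 + k * (LINT x:{a..<b}|P. w x * (cmod (u x))\<^sup>2)
    \<le> (cmod (v a))\<^sup>2 + (LINT x:{a..<b}|P. w x * (cmod (g x))\<^sup>2) / (k * (Im J)\<^sup>2)"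
proof -
  define E where "E x = w x * ((2 * Im z * (cmod (u x))\<^sup>2 + 2 * Im (cnj (u x) * g x)) / Im J)" for x
  have pr: "prim P (\<lambda>x. of_real ((cmod (v x))\<^sup>2)) (\<lambda>x. of_real (E x))"
  proof -
    have "cnj (v x) * v x = of_real ((cmod (v x))\<^sup>2)" for x
      by (simp only: complex_norm_square mult.commute)
    moreover have "of_real (w x) * (cnj (u x) * (z * u x + g x) - cnj (z * u x + g x) * u x) / J = of_real (E x)" for x
    proof -
      have "cnj (u x) * (z * u x + g x) - cnj (z * u x + g x) * u x
        = (z - cnj z) * (u x * cnj (u x)) + (cnj (u x) * g x - cnj (cnj (u x) * g x))"
        by (simp add: algebra_simps)
      also have "\<dots> = \<i> * of_real (2 * Im z * (cmod (u x))\<^sup>2 + 2 * Im (cnj (u x) * g x))"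
        unfolding complex_diff_cnj complex_norm_square[symmetric] by (simp add: algebra_simps)
      finally have 1: "cnj (u x) * (z * u x + g x) - cnj (z * u x + g x) * u x
        = \<i> * of_real (2 * Im z * (cmod (u x))\<^sup>2 + 2 * Im (cnj (u x) * g x))" .
      show ?thesis unfolding 1 by (subst J_eq) (simp add: E_def)
    qed
    ultimately show ?thesis using sol_prim_prod[OF s s] by (simp only:)
  qed
  have u: "u \<in> borel_measurable borel" "loc_bounded u"
    using s sol_loc_bounded[OF s] by (simp_all add: sol_def)
  have lu: "loc_int P (\<lambda>x. w x * (cmod (u x))\<^sup>2)" by (rule inner_loc_int[OF u])
  have lg: "loc_int P (\<lambda>x. w x * (cmod (g x))\<^sup>2)" by (rule integrable_loc_int[OF l2w_int[OF g]])
  have lE: "loc_int P E" using prim_loc_int[OF pr] by (simp only: loc_int_of_real_iff)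
  let ?c = "1 / (k * (Im J)\<^sup>2)"
  have Ele: "E x \<le> ?c * (w x * (cmod (g x))\<^sup>2) - k * (w x * (cmod (u x))\<^sup>2)" for x
  proof -
    have "2 * Im (cnj (u x) * g x) / Im J \<le> 2 * (cmod (u x) * cmod (g x)) / \<bar>Im J\<bar>"
    proof -
      have "\<bar>Im (cnj (u x) * g x)\<bar> \<le> cmod (u x) * cmod (g x)"
        using abs_Im_le_cmod[of "cnj (u x) * g x"] by (simp add: norm_mult)
      then have "2 * \<bar>Im (cnj (u x) * g x)\<bar> / \<bar>Im J\<bar> \<le> 2 * (cmod (u x) * cmod (g x)) / \<bar>Im J\<bar>"
        by (intro divide_right_mono) auto
      moreover have "2 * y / Im J \<le> 2 * \<bar>y\<bar> / \<bar>Im J\<bar>" for y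
        using abs_ge_self[of "2 * y / Im J"] by (simp add: abs_mult)
      ultimately show ?thesis by (rule order_trans[rotated])
    qed
    also have "\<dots> \<le> k * (cmod (u x))\<^sup>2 + ?c * (cmod (g x))\<^sup>2"
    proof -
      have "2 * (sqrt k * cmod (u x)) * (cmod (g x) / (sqrt k * \<bar>Im J\<bar>)) \<le>
        (sqrt k * cmod (u x))\<^sup>2 + (cmod (g x) / (sqrt k * \<bar>Im J\<bar>))\<^sup>2" by (rule sum_squares_bound)
      then show ?thesis using k(2) by (simp add: power_mult_distrib power_divide)
    qed
    finally have "2 * Im (cnj (u x) * g x) / Im J \<le> k * (cmod (u x))\<^sup>2 + ?c * (cmod (g x))\<^sup>2" .
    moreover have "(2 * Im z * (cmod (u x))\<^sup>2 + 2 * Im (cnj (u x) * g x)) / Im J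
       = - (2 * k * (cmod (u x))\<^sup>2) + 2 * Im (cnj (u x) * g x) / Im J"
      by (simp add: k(1) add_divide_distrib)
    ultimately have "(2 * Im z * (cmod (u x))\<^sup>2 + 2 * Im (cnj (u x) * g x)) / Im J \<le> ?c * (cmod (g x))\<^sup>2 - k * (cmod (u x))\<^sup>2"
      by linarith
    then have "E x \<le> w x * (?c * (cmod (g x))\<^sup>2 - k * (cmod (u x))\<^sup>2)"
      unfolding E_def by (rule mult_left_mono[OF _ w_ge])
    then show ?thesis by (simp only: right_diff_distrib mult.left_commute)
  qed
  have "(cmod (v b))\<^sup>2 - (cmod (v a))\<^sup>2 = (LINT x:{a..<b}|P. E x)"
    by (rule prim_Re_mono[OF pr \<open>a \<le> b\<close>])
  also have "\<dots> \<le> (LINT x:{a..<b}|P. ?c * (w x * (cmod (g x))\<^sup>2) - k * (w x * (cmod (u x))\<^sup>2))"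
    by (intro set_integral_mono loc_intD[OF lE] set_integral_diff(1) set_integrable_mult_right loc_intD[OF lu] loc_intD[OF lg] Ele)
  also have "\<dots> = ?c * (LINT x:{a..<b}|P. w x * (cmod (g x))\<^sup>2) - k * (LINT x:{a..<b}|P. w x * (cmod (u x))\<^sup>2)"
    by (subst set_integral_diff(2)) (auto intro!: set_integrable_mult_right loc_intD[OF lu] loc_intD[OF lg])
  finally show ?thesis by simp
qed

lemma set_integral_le_integral:
  fixes f :: "real \<Rightarrow> real"
  assumes "integrable P f" "\<And>x. f x \<ge> 0" "A \<in> sets borel"
  shows "(LINT x:A|P. f x) \<le> integral\<^sup>L P f"
  unfolding set_lebesgue_integral_def
proof (rule integral_mono[OF _ assms(1)])
  show "integrable P (\<lambda>x. indicator A x *\<^sub>R f x)"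
    using assms by (intro integrable_mult_indicator) auto
  show "indicator A x *\<^sub>R f x \<le> f x" for x using assms(2)[of x] by (simp add: indicator_def)
qed

lemma energy_from_zero:
  assumes s: "sol v u (\<lambda>x. z * u x + g x)" and g: "l2w g" and k: "k = - (Im z / Im J)" "k > 0"
    and a: "\<And>x. x \<le> a \<Longrightarrow> v x = 0"
  shows "(cmod (v b))\<^sup>2 \<le> (\<integral>x. w x * (cmod (g x))\<^sup>2 \<partial>P) / (k * (Im J)\<^sup>2)"
proof -
  \<comment> \<open>Starting at \<open>min a b\<close> also covers \<open>b \<le> a\<close>, where
    the interval is empty and \<open>v b = 0\<close>.\<close>
  let ?m = "min a b"
  have kJ: "k * (Im J)\<^sup>2 > 0" using k(2) ImJ by simp
  have "0 \<le> k * (LINT x:{?m..<b}|P. w x * (cmod (u x))\<^sup>2)"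
    unfolding set_lebesgue_integral_def using k(2) w_ge by (intro mult_nonneg_nonneg integral_nonneg_AE) auto
  moreover have "(LINT x:{?m..<b}|P. w x * (cmod (g x))\<^sup>2) \<le> (\<integral>x. w x * (cmod (g x))\<^sup>2 \<partial>P)"
    by (rule set_integral_le_integral[OF l2w_int[OF g]]) (use w_ge in auto)
  then have "(LINT x:{?m..<b}|P. w x * (cmod (g x))\<^sup>2) / (k * (Im J)\<^sup>2) \<le> (\<integral>x. w x * (cmod (g x))\<^sup>2 \<partial>P) / (k * (Im J)\<^sup>2)"
    using kJ by (intro divide_right_mono) auto
  moreover have "v ?m = 0" by (rule a) simp
  moreover have "?m \<le> b" by simp
  note energy[OF s g k this]
  ultimately show ?thesis by simp
qed

lemma integrable_of_bounded:
  fixes f :: "real \<Rightarrow> real"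
  assumes f: "loc_int P f" "\<And>x. f x \<ge> 0" and le: "\<And>a b. a \<le> b \<Longrightarrow> (LINT x:{a..<b}|P. f x) \<le> R"
  shows "integrable P f"
proof -
  have [measurable]: "f \<in> borel_measurable P" using loc_int_measurable[OF f(1)] by simp
  have "(\<integral>\<^sup>+x. ennreal (f x) \<partial>P) \<le> ennreal R"
  proof -
    have eq: "ennreal (f x) = (SUP n::nat. ennreal (indicator {- real n..<real n} x * f x))" for x
    proof (rule antisym)
      obtain n :: nat where n: "\<bar>x\<bar> < real n" using reals_Archimedean2 by blast
      then have "x \<in> {- real n..<real n}" by auto
      then have "ennreal (f x) = ennreal (indicator {- real n..<real n} x * f x)" by simp
      also have "\<dots> \<le> (SUP n::nat. ennreal (indicator {- real n..<real n} x * f x))" by (rule SUP_upper) simp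
      finally show "ennreal (f x) \<le> (SUP n::nat. ennreal (indicator {- real n..<real n} x * f x))" .
      show "(SUP n::nat. ennreal (indicator {- real n..<real n} x * f x)) \<le> ennreal (f x)"
        by (rule SUP_least) (use f(2)[of x] in \<open>auto simp: indicator_def\<close>)
    qed
    have "(\<integral>\<^sup>+x. ennreal (f x) \<partial>P) = (\<integral>\<^sup>+x. (SUP n::nat. ennreal (indicator {- real n..<real n} x * f x)) \<partial>P)"
      by (simp only: eq[symmetric])
    also have "\<dots> = (SUP n::nat. (\<integral>\<^sup>+x. ennreal (indicator {- real n..<real n} x * f x) \<partial>P))"
    proof (rule nn_integral_monotone_convergence_SUP)
      show "incseq (\<lambda>n x. ennreal (indicator {- real n..<real n} x * f x))"
        unfolding mono_def le_fun_def
        by (intro allI impI ennreal_leI mult_right_mono f(2)) (auto simp: indicator_def)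
    qed measurable
    also have "\<dots> \<le> ennreal R"
    proof (rule SUP_least)
      fix n :: nat
      have "(\<integral>\<^sup>+x. ennreal (indicator {- real n..<real n} x * f x) \<partial>P) = ennreal (\<integral>x. indicator {- real n..<real n} x * f x \<partial>P)"
        using loc_intD[OF f(1), of "- real n" "real n"] f(2) unfolding set_integrable_def
        by (intro nn_integral_eq_integral) auto
      also have "\<dots> \<le> ennreal R"
        using le[of "- real n" "real n"] by (intro ennreal_leI) (simp add: set_lebesgue_integral_def)
      finally show "(\<integral>\<^sup>+x. ennreal (indicator {- real n..<real n} x * f x) \<partial>P) \<le> ennreal R" .
    qed
    finally show ?thesis .
  qed
  then have "(\<integral>\<^sup>+x. ennreal (f x) \<partial>P) < \<infinity>" by (rule order_le_less_trans) simp
  then show ?thesis using f(2) by (intro integrableI_nonneg) auto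
qed

end

section \<open>Solvability of the equation for non-real and for real parameters\<close>

context system
begin

definition coef :: "complex \<Rightarrow> real \<Rightarrow> complex" where
  "coef z x = (z * of_real (w x) - of_real (q x)) / J"

lemma coef_borel[measurable]: "coef z \<in> borel_measurable borel"
  unfolding coef_def[abs_def] by measurable

lemma coef_le: "cmod (coef z x) \<le> (cmod z + 1) / cmod J"
proof -
  have "cmod (z * of_real (w x) - of_real (q x)) \<le> cmod z * w x + \<bar>q x\<bar>"
    using norm_triangle_ineq4[of "z * of_real (w x)" "of_real (q x)"] by (simp add: norm_mult w_ge)
  also have "\<dots> \<le> cmod z * 1 + 1" by (intro add_mono mult_left_mono w_le q_le) simp
  finally show ?thesis by (simp add: coef_def norm_divide divide_right_mono)
qed

text \<open>After division by the imaginary \<open>J\<close>, both \<open>q\<close> and the real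
  part of \<open>z\<close> give imaginary contributions. Hence the sign condition of
  \<open>initial_value_problem\<close> depends only on the half-plane of \<open>z\<close>.\<close>

lemma Re_coef: "Re (coef z x) = w x * (Im z / Im J)"
proof -
  have "coef z x = - \<i> * (z * of_real (w x) - of_real (q x)) / of_real (Im J)"
    unfolding coef_def by (subst J_eq) (simp add: divide_simps ImJ)
  then show ?thesis by (simp add: Re_divide_of_real)
qed

lemma dens_coef: "dens u (\<lambda>x. z * u x + g x) x = coef z x * u x + of_real (w x) * g x / J"
  by (simp add: dens_def coef_def algebra_simps add_divide_distrib diff_divide_distrib)

lemma l2w_loc_int_J: "l2w g \<Longrightarrow> loc_int P (\<lambda>x. of_real (w x) * g x / J)"
  using l2w_loc_int[of g] by (auto simp: loc_int_def)

text \<open>\<open>initial_value_problem\<close> wants coefficients that vanish to the left of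
  \<open>a\<close>, so \<open>coef z\<close> is cut off there too. This does not change the
  equation: left of \<open>a\<close> both \<open>v\<close> and the cut-off density vanish, hence so
  does \<open>u\<close>, and the full coefficient multiplies zero.\<close>

lemma truncated_solution:
  assumes z: "Im z / Im J \<le> 0" and g: "l2w g"
  obtains v u where "sol v u (\<lambda>x. z * u x + indicator {a..} x * g x)" "\<And>x. x \<le> a \<Longrightarrow> v x = 0"
    "\<And>x. x < a \<Longrightarrow> u x = 0"
proof -
  let ?m = "\<lambda>x. indicator {a..} x * coef z x"
  let ?h = "\<lambda>x. of_real (w x) * (indicator {a..} x * g x) / J"
  have g': "l2w (\<lambda>x. indicator {a..} x * g x)" by (rule l2w_indicator[OF g]) simp
  have m: "?m \<in> borel_measurable borel" by measurable
  have m_le: "cmod (?m x) \<le> (cmod z + 1) / cmod J" for x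
    using coef_le[of z x] by (auto simp: indicator_def)
  have m_Re: "Re (?m x) \<le> 0" for x
    using mult_nonneg_nonpos[OF w_ge z, of x] Re_coef[of z x] by (auto simp: indicator_def)
  obtain u v where uv: "prim P v (\<lambda>x. ?m x * u x + ?h x)" "u = bal P v (\<lambda>x. ?m x * u x + ?h x)"
    "\<And>x. x \<le> a \<Longrightarrow> v x = 0" "u \<in> borel_measurable borel"
    by (rule initial_value_problem[OF P m m_le _ m_Re l2w_loc_int_J[OF g'], of a 0]) (auto intro: that)
  have u0: "u x = 0" if "x < a" for x
    using fun_cong[OF uv(2), of x] uv(3)[of x] that by (simp add: bal_def)
  have "(\<lambda>x. ?m x * u x + ?h x) = dens u (\<lambda>x. z * u x + indicator {a..} x * g x)"
  proof
    show "?m x * u x + ?h x = dens u (\<lambda>x. z * u x + indicator {a..} x * g x) x" for x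
      unfolding dens_coef using u0[of x] by (cases "x < a") auto
  qed
  then have "sol v u (\<lambda>x. z * u x + indicator {a..} x * g x)"
    unfolding sol_def using uv l2w_borel[OF g] by simp
  then show thesis using uv(3) u0 by (rule that)
qed

text \<open>The truncations of \<open>g\<close> to \<open>[-n, \<infinity>)\<close> are solved forward from \<open>-n\<close>; by the energy estimate the
  left limits of these solutions converge.\<close>

lemma range_lower:
  assumes z: "Im z / Im J < 0" and g: "l2w g"
  shows "\<exists>v u. sol v u (\<lambda>x. z * u x + g x) \<and> l2w u"
proof -
  note [measurable] = l2w_borel[OF g] atom_borel[OF P]
  define k where "k = - (Im z / Im J)"
  have k: "k > 0" using z by (simp add: k_def)
  define c where "c = k * (Im J)\<^sup>2"
  have c: "c > 0" using k ImJ by (simp add: c_def)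
  define gn where "gn n x = indicator {- real n..} x * g x" for n x
  have gn: "l2w (gn n)" for n unfolding gn_def[abs_def] by (rule l2w_indicator[OF g]) simp
  have "\<exists>v u. sol v u (\<lambda>x. z * u x + gn n x) \<and> (\<forall>x. x \<le> - real n \<longrightarrow> v x = 0) \<and>
    (\<forall>x. x < - real n \<longrightarrow> u x = 0)" for n
    unfolding gn_def by (rule truncated_solution[OF less_imp_le[OF z] g, of "- real n"]) blast
  then obtain V U where VU: "\<And>n. sol (V n) (U n) (\<lambda>x. z * U n x + gn n x)"
    "\<And>n x. x \<le> - real n \<Longrightarrow> V n x = 0" "\<And>n x. x < - real n \<Longrightarrow> U n x = 0" by metis
  define R where "R = (\<integral>x. w x * (cmod (g x))\<^sup>2 \<partial>P) / c"
  have gnle: "(\<integral>x. w x * (cmod (gn n x))\<^sup>2 \<partial>P) \<le> (\<integral>x. w x * (cmod (g x))\<^sup>2 \<partial>P)" for n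
    by (rule integral_mono[OF l2w_int[OF gn] l2w_int[OF g]]) (auto simp: gn_def indicator_def w_ge)
  have VR: "(cmod (V n x))\<^sup>2 \<le> R" for n x
  proof -
    have "(cmod (V n x))\<^sup>2 \<le> (\<integral>x. w x * (cmod (gn n x))\<^sup>2 \<partial>P) / c"
      unfolding c_def by (rule energy_from_zero[OF VU(1) gn k_def k, of "- real n"]) (rule VU(2))
    also have "\<dots> \<le> R" unfolding R_def using c gnle by (intro divide_right_mono) auto
    finally show ?thesis .
  qed
  \<comment> \<open>For \<open>m \<le> n\<close> the difference of the \<open>n\<close>-th and the
    \<open>m\<close>-th solution solves the equation with \<open>g\<close> restricted to
    \<open>{- real n..<- real m}\<close> and starts from 0. The energy estimate bounds it uniformly
    in \<open>x\<close> by a tail of the norm of \<open>g\<close>.\<close>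
  define T where "T m = (\<integral>x. w x * (cmod (indicator {..<- real m} x * g x))\<^sup>2 \<partial>P) / c" for m :: nat
  have VT: "(cmod (V n x - V m x))\<^sup>2 \<le> T m" if "m \<le> n" for m n x
  proof -
    have s: "sol (\<lambda>x. V n x - V m x) (\<lambda>x. U n x - U m x) (\<lambda>x. z * (U n x - U m x) + (gn n x - gn m x))"
      using sol_diff[OF VU(1)[of n] VU(1)[of m]] by (simp add: algebra_simps)
    have gd: "l2w (\<lambda>x. gn n x - gn m x)"
      using l2w_add[OF gn[of n] l2w_cmult[OF gn[of m], of "-1"]] by simp
    have "(cmod (V n x - V m x))\<^sup>2 \<le> (\<integral>x. w x * (cmod (gn n x - gn m x))\<^sup>2 \<partial>P) / c"
      unfolding c_def by (rule energy_from_zero[OF s gd k_def k, of "- real n"]) (use VU(2) that in auto)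
    also have "\<dots> \<le> T m"
    proof -
      have "(\<integral>x. w x * (cmod (gn n x - gn m x))\<^sup>2 \<partial>P) \<le> (\<integral>x. w x * (cmod (indicator {..<- real m} x * g x))\<^sup>2 \<partial>P)"
      proof (rule integral_mono[OF l2w_int[OF gd] l2w_int[OF l2w_indicator[OF g]]])
        show "w x * (cmod (gn n x - gn m x))\<^sup>2 \<le> w x * (cmod (indicator {..<- real m} x * g x))\<^sup>2" for x
          using that w_ge[of x] by (auto simp: gn_def indicator_def)
      qed simp
      then show ?thesis unfolding T_def using c by (intro divide_right_mono) auto
    qed
    finally show ?thesis .
  qed
  have T0: "T \<longlonglongrightarrow> 0"
  proof -
    have "(\<lambda>m. \<integral>x. w x * (cmod (indicator {..<- real m} x * g x))\<^sup>2 \<partial>P) \<longlonglongrightarrow> (\<integral>x. 0 \<partial>P)"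
    proof (rule integral_dominated_convergence[OF _ _ l2w_int[OF g]])
      show "AE x in P. (\<lambda>m. w x * (cmod (indicator {..<- real m} x * g x))\<^sup>2) \<longlonglongrightarrow> 0"
      proof (rule AE_I2)
        fix x
        obtain N :: nat where N: "- x \<le> real N" using real_arch_simple by blast
        have "eventually (\<lambda>m. w x * (cmod (indicator {..<- real m} x * g x))\<^sup>2 = 0) sequentially"
          unfolding eventually_sequentially
        proof (intro exI[of _ N] allI impI)
          fix m assume "N \<le> m"
          then have "- x \<le> real m" using N by (meson of_nat_mono order_trans)
          then show "w x * (cmod (indicator {..<- real m} x * g x))\<^sup>2 = 0" by (simp add: indicator_def)
        qed
        then show "(\<lambda>m. w x * (cmod (indicator {..<- real m} x * g x))\<^sup>2) \<longlonglongrightarrow> 0" by (rule tendsto_eventually)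
      qed
      show "AE x in P. norm (w x * (cmod (indicator {..<- real m} x * g x))\<^sup>2) \<le> w x * (cmod (g x))\<^sup>2" for m
        by (rule AE_I2) (simp add: indicator_def w_ge)
    qed measurable
    from tendsto_divide[OF this tendsto_const, of c] c show ?thesis unfolding T_def by simp
  qed
  have "Cauchy (\<lambda>n. V n x)" for x
  proof (rule metric_CauchyI)
    fix e :: real assume e: "e > 0"
    have "eventually (\<lambda>m. T m < (e / 2)\<^sup>2) sequentially"
      by (rule order_tendstoD(2)[OF T0]) (use e in simp)
    then obtain M where M: "T M < (e / 2)\<^sup>2" by (auto simp: eventually_sequentially)
    have "cmod (V n x - V M x) < e / 2" if "n \<ge> M" for n
    proof -
      have "(cmod (V n x - V M x))\<^sup>2 < (e / 2)\<^sup>2" using VT[OF that, of x] M by linarith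
      then show ?thesis by (rule power_less_imp_less_base) (use e in simp)
    qed
    then have "dist (V m x) (V n x) < e" if "m \<ge> M" "n \<ge> M" for m n
      using that dist_triangle_half_l[of "V m x" "V M x" e "V n x"] by (simp add: dist_norm)
    then show "\<exists>M. \<forall>m\<ge>M. \<forall>n\<ge>M. dist (V m x) (V n x) < e" by blast
  qed
  then have "\<exists>l. (\<lambda>n. V n x) \<longlonglongrightarrow> l" for x using Cauchy_convergent convergent_def by blast
  then obtain v where v: "\<And>x. (\<lambda>n. V n x) \<longlonglongrightarrow> v x" by metis
  have vR: "(cmod (v x))\<^sup>2 \<le> R" for x
    by (rule Lim_bounded[OF tendsto_power[OF tendsto_norm[OF v]], of 0]) (use VR in auto)
  define h where "h x = of_real (w x) * g x / J" for x
  have h: "loc_int P h" unfolding h_def[abs_def] by (rule l2w_loc_int_J[OF g])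
  have [measurable]: "h \<in> borel_measurable borel" by (rule loc_int_measurable[OF h])
  \<comment> \<open>As in \<open>initial_value_problem\<close>, dividing by \<open>D\<close>
    recovers balanced values from left limits, so convergence of \<open>V n\<close> implies that of
    \<open>U n\<close>.\<close>
  define D where "D x = 1 - of_real (atom P x) * coef z x / 2" for x
  have D1: "cmod (D x) \<ge> 1" for x
  proof -
    have "Re (coef z x) \<le> 0" unfolding Re_coef using mult_nonneg_nonpos[OF w_ge less_imp_le[OF z]] .
    then have "atom P x * Re (coef z x) \<le> 0" using atom_nonneg[of P x] by (intro mult_nonneg_nonpos)
    then have "Re (D x) \<ge> 1" by (simp add: D_def)
    then show ?thesis using complex_Re_le_cmod[of "D x"] by linarith
  qed
  have D0: "D x \<noteq> 0" for x
  proof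
    assume "D x = 0"
    then show False using D1[of x] by simp
  qed
  define u where "u x = (v x + of_real (atom P x) * h x / 2) / D x" for x
  have Un: "U n x = (V n x + of_real (atom P x) * h x / 2) / D x" if "x \<ge> - real n" for n x
  proof -
    have "U n x = bal P (V n) (dens (U n) (\<lambda>x. z * U n x + gn n x)) x" unfolding sol_bal[OF VU(1)] ..
    also have "\<dots> = V n x + of_real (atom P x) * (coef z x * U n x + h x) / 2"
      unfolding bal_def dens_coef using that by (simp add: gn_def h_def)
    finally have "U n x * D x = V n x + of_real (atom P x) * h x / 2"
      by (simp add: D_def algebra_simps add_divide_distrib)
    then show ?thesis using D0[of x] by (simp add: nonzero_eq_divide_eq)
  qed
  have Nx: "\<exists>N. \<forall>n\<ge>N. x \<ge> - real n" for x
  proof -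
    obtain N :: nat where N: "- x \<le> real N" using real_arch_simple by blast
    have "x \<ge> - real n" if "n \<ge> N" for n
    proof -
      have "real N \<le> real n" using that by simp
      then show ?thesis using N by linarith
    qed
    then show ?thesis by blast
  qed
  have Ulim: "(\<lambda>n. U n x) \<longlonglongrightarrow> u x" for x
  proof (rule Lim_transform_eventually)
    show "(\<lambda>n. (V n x + of_real (atom P x) * h x / 2) / D x) \<longlonglongrightarrow> u x"
      unfolding u_def using D0 by (intro tendsto_intros v)
    show "eventually (\<lambda>n. (V n x + of_real (atom P x) * h x / 2) / D x = U n x) sequentially"
      unfolding eventually_sequentially using Nx[of x] Un[of _ x] by metis
  qed
  have vm[measurable]: "v \<in> borel_measurable borel"
    by (rule borel_measurable_LIMSEQ_metric[OF prim_borel[OF P sol_prim[OF VU(1)]] v])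
  have Um: "U n \<in> borel_measurable borel" for n using VU(1)[of n] by (simp add: sol_def)
  have um[measurable]: "u \<in> borel_measurable borel"
    by (rule borel_measurable_LIMSEQ_metric[OF Um Ulim])
  obtain vh where vh: "prim P vh h" by (rule prim_exists[OF h]) (rule that)
  have hb: "loc_bounded (\<lambda>x. of_real (atom P x) * h x)" by (rule prim_jump_bounded[OF P vh])
  have Ule: "cmod (U n x) \<le> sqrt R + cmod (of_real (atom P x) * h x) / 2" for n x
  proof (cases "x \<ge> - real n")
    case True
    have "cmod (V n x) \<le> sqrt R" using real_le_rsqrt[OF VR] .
    then have "cmod (V n x + of_real (atom P x) * h x / 2) \<le> sqrt R + cmod (of_real (atom P x) * h x) / 2"
      using norm_triangle_ineq[of "V n x" "of_real (atom P x) * h x / 2"] by simp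
    moreover have "cmod (V n x + of_real (atom P x) * h x / 2) / cmod (D x) \<le> cmod (V n x + of_real (atom P x) * h x / 2) / 1"
      using D1[of x] by (intro divide_left_mono) auto
    moreover have "cmod (U n x) = cmod (V n x + of_real (atom P x) * h x / 2) / cmod (D x)"
      unfolding Un[OF True] by (rule norm_divide)
    ultimately show ?thesis by linarith
  next
    case False
    have "0 \<le> R" using VR[of 0 0] by (rule order_trans[OF zero_le_power2])
    then have "0 \<le> sqrt R + cmod (of_real (atom P x) * h x) / 2" by (intro add_nonneg_nonneg) auto
    moreover have "U n x = 0" using VU(3)[of x n] False by simp
    ultimately show ?thesis by (simp only: norm_zero)
  qed
  define f where "f x = z * u x + g x" for x
  have df: "dens u f x = coef z x * u x + h x" for x
    unfolding f_def[abs_def] dens_coef h_def ..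
  have cb: "loc_bounded (coef z)" unfolding loc_bounded_def using coef_le by blast
  \<comment> \<open>A majorant of all the densities that does not depend on \<open>n\<close>. It is
    locally integrable because \<open>h\<close> is and its jumps are locally bounded, so the
    integral equation passes to the limit.\<close>
  define B where "B x = (cmod z + 1) / cmod J * (sqrt R + cmod (of_real (atom P x) * h x) / 2) + cmod (h x)" for x
  have Bl: "loc_int P B"
  proof -
    have "loc_int P (\<lambda>x. of_real (atom P x) * h x)" by (rule loc_int_loc_bounded[OF P _ hb]) measurable
    from loc_int_norm[OF this] have 1: "loc_int P (\<lambda>x. cmod (of_real (atom P x) * h x))" .
    have "loc_int P (\<lambda>x. (cmod z + 1) / cmod J * (sqrt R + cmod (of_real (atom P x) * h x) * (1/2)) + cmod (h x))"
    proof (rule loc_int_add[OF _ loc_int_norm[OF h]])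
      have "loc_int P (\<lambda>x. sqrt R + cmod (of_real (atom P x) * h x) * (1/2))"
        by (rule loc_int_add[OF loc_int_const[OF P]]) (use 1 in \<open>auto simp: loc_int_def\<close>)
      then show "loc_int P (\<lambda>x. (cmod z + 1) / cmod J * (sqrt R + cmod (of_real (atom P x) * h x) * (1/2)))"
        by (auto simp: loc_int_def)
    qed
    then show ?thesis by (simp add: B_def[abs_def])
  qed
  have denB: "cmod (dens (U n) (\<lambda>x. z * U n x + gn n x) x) \<le> B x" for n x
  proof -
    have "cmod (coef z x * U n x) \<le> (cmod z + 1) / cmod J * (sqrt R + cmod (of_real (atom P x) * h x) / 2)"
      unfolding norm_mult[of "coef z x" "U n x"] by (intro mult_mono coef_le Ule) auto
    moreover have "cmod (of_real (w x) * gn n x / J) \<le> cmod (h x)"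
      by (simp add: gn_def h_def indicator_def)
    ultimately show ?thesis unfolding dens_coef B_def
      using norm_triangle_ineq[of "coef z x * U n x" "of_real (w x) * gn n x / J"] by linarith
  qed
  have denlim: "(\<lambda>n. dens (U n) (\<lambda>x. z * U n x + gn n x) x) \<longlonglongrightarrow> dens u f x" for x
  proof -
    have "eventually (\<lambda>n. coef z x * U n x + h x = dens (U n) (\<lambda>x. z * U n x + gn n x) x) sequentially"
    proof -
      obtain N where N: "\<forall>n\<ge>N. x \<ge> - real n" using Nx by blast
      show ?thesis unfolding eventually_sequentially dens_coef
        by (rule exI[of _ N]) (use N in \<open>auto simp: gn_def h_def\<close>)
    qed
    moreover have "(\<lambda>n. coef z x * U n x + h x) \<longlonglongrightarrow> coef z x * u x + h x"
      by (intro tendsto_intros Ulim)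
    ultimately show ?thesis unfolding df by (rule Lim_transform_eventually[rotated])
  qed
  have dm: "dens u f \<in> borel_measurable borel" unfolding df[abs_def] by measurable
  have dens_le: "cmod (dens u f x) \<le> B x" for x
    by (rule Lim_bounded[OF tendsto_norm[OF denlim], of 0]) (use denB in auto)
  have dl: "loc_int P (dens u f)"
  proof (rule loc_int_bound[OF P Bl dm])
    show "\<exists>C. \<forall>x\<in>{a..b}. norm (dens u f x) \<le> C * norm (B x)" for a b
      by (rule exI[of _ 1]) (use dens_le order_trans[OF dens_le abs_ge_self] in auto)
  qed
  have "v b - v a = (LINT x:{a..<b}|P. dens u f x)" if "a \<le> b" for a b
  proof (rule LIMSEQ_unique)
    show "(\<lambda>n. V n b - V n a) \<longlonglongrightarrow> v b - v a" by (intro tendsto_diff v)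
    have "(\<lambda>n. (LINT x:{a..<b}|P. dens (U n) (\<lambda>x. z * U n x + gn n x) x)) \<longlonglongrightarrow> (LINT x:{a..<b}|P. dens u f x)"
      unfolding set_lebesgue_integral_def
    proof (rule integral_dominated_convergence[where w="\<lambda>x. indicator {a..<b} x *\<^sub>R B x"])
      show "integrable P (\<lambda>x. indicator {a..<b} x *\<^sub>R B x)" using loc_intD[OF Bl] unfolding set_integrable_def .
      show "(\<lambda>x. indicator {a..<b} x *\<^sub>R dens u f x) \<in> borel_measurable P" using dm by measurable
      show "(\<lambda>x. indicator {a..<b} x *\<^sub>R dens (U n) (\<lambda>x. z * U n x + gn n x) x) \<in> borel_measurable P" for n
        using loc_int_measurable[OF prim_loc_int[OF sol_prim[OF VU(1)[of n]]]] by measurable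
      show "AE x in P. (\<lambda>n. indicator {a..<b} x *\<^sub>R dens (U n) (\<lambda>x. z * U n x + gn n x) x) \<longlonglongrightarrow> indicator {a..<b} x *\<^sub>R dens u f x"
        by (intro AE_I2 tendsto_scaleR tendsto_const denlim)
      show "AE x in P. norm (indicator {a..<b} x *\<^sub>R dens (U n) (\<lambda>x. z * U n x + gn n x) x) \<le> indicator {a..<b} x *\<^sub>R B x" for n
        by (rule AE_I2) (simp add: indicator_def denB)
    qed
    then show "(\<lambda>n. V n b - V n a) \<longlonglongrightarrow> (LINT x:{a..<b}|P. dens u f x)"
      unfolding primD[OF sol_prim[OF VU(1)] that] .
  qed
  then have prv: "prim P v (dens u f)" using dl by (simp add: prim_def)
  have "u = bal P v (dens u f)"
  proof
    fix x
    have "u x * D x = v x + of_real (atom P x) * h x / 2" using D0[of x] by (simp add: u_def)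
    then show "u x = bal P v (dens u f) x"
      unfolding bal_def df by (simp add: D_def algebra_simps add_divide_distrib)
  qed
  then have s: "sol v u f" unfolding sol_def using prv by (simp add: f_def[abs_def])
  have "l2w u"
  proof -
    have lu: "loc_int P (\<lambda>x. w x * (cmod (u x))\<^sup>2)" by (rule inner_loc_int[OF um sol_loc_bounded[OF s]])
    have "integrable P (\<lambda>x. w x * (cmod (u x))\<^sup>2)"
    proof (rule integrable_of_bounded[OF lu])
      show "0 \<le> w x * (cmod (u x))\<^sup>2" for x using w_ge by simp
      fix a b :: real assume ab: "a \<le> b"
      \<comment> \<open>The boundary term at \<open>a\<close> is at most \<open>R\<close>, a bound
        inherited from the approximants, so the resulting bound on the norm of \<open>u\<close> is
        the same for all intervals.\<close>
      have "(cmod (v b))\<^sup>2 + k * (LINT x:{a..<b}|P. w x * (cmod (u x))\<^sup>2)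
          \<le> (cmod (v a))\<^sup>2 + (LINT x:{a..<b}|P. w x * (cmod (g x))\<^sup>2) / c"
        unfolding c_def by (rule energy[OF s[unfolded f_def[abs_def]] g k_def k ab])
      moreover have "(LINT x:{a..<b}|P. w x * (cmod (g x))\<^sup>2) / c \<le> R"
        unfolding R_def using c w_ge by (intro divide_right_mono set_integral_le_integral l2w_int[OF g]) auto
      ultimately have "k * (LINT x:{a..<b}|P. w x * (cmod (u x))\<^sup>2) \<le> R + R"
        using vR[of a] zero_le_power2[of "cmod (v b)"] by linarith
      then show "(LINT x:{a..<b}|P. w x * (cmod (u x))\<^sup>2) \<le> (R + R) / k"
        using k by (simp add: pos_le_divide_eq mult.commute)
    qed
    then show ?thesis by (simp add: l2w_def)
  qed
  with s show ?thesis unfolding f_def[abs_def] by blast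
qed

text \<open>With a solution \<open>U\<close> of the homogeneous equation on \<open>[0, b)\<close> take \<open>g = U\<close> there and \<open>g = 0\<close>
  elsewhere. The left limits of an \<open>L\<^sup>2(w)\<close> solution would vanish at \<open>0\<close> and \<open>b\<close>, but the Lagrange
  identity with \<open>U\<close> gives \<open>\<integral> |U|\<^sup>2 w\<close> over \<open>[0, b)\<close>.\<close>

lemma real_not_surjective:
  "\<exists>g. l2w g \<and> \<not> (\<exists>v u. l2w u \<and> sol v u (\<lambda>x. of_real l * u x + g x))"
proof -
  obtain b where b: "0 \<le> b" "1 \<le> (LINT x:{0..<b}|P. w x)" using mass_top[of 0 1] by blast
  \<comment> \<open>The cut-off below 0 fits the initial value problem; only the values of the
    solution on \<open>{0..<b}\<close> enter \<open>g\<close>.\<close>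
  let ?m = "\<lambda>x. indicator {0..} x * coef (of_real l) x"
  have m: "?m \<in> borel_measurable borel" by measurable
  have m_le: "cmod (?m x) \<le> (\<bar>l\<bar> + 1) / cmod J" for x
    using coef_le[of "of_real l" x] by (auto simp: indicator_def)
  have m_Re: "Re (?m x) = 0" for x
    using Re_coef[of "of_real l" x] by (auto simp: indicator_def)
  obtain U V where UV: "prim P V (\<lambda>x. ?m x * U x + 0)" "U = bal P V (\<lambda>x. ?m x * U x + 0)"
    "\<And>x. x \<le> 0 \<Longrightarrow> V x = 1" "U \<in> borel_measurable borel"
    by (rule initial_value_problem[OF P m m_le _ eq_refl[OF m_Re] loc_int_const[OF P, of 0], of 0 1]) (auto intro: that)
  let ?d = "\<lambda>x. ?m x * U x"
  have prV: "prim P V ?d" using UV(1) by simp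
  have balU: "bal P V ?d = U" using UV(2) by simp
  have balUc: "bal P (\<lambda>x. cnj (V x)) (\<lambda>x. cnj (?d x)) x = cnj (U x)" for x
  proof -
    have "bal P (\<lambda>x. cnj (V x)) (\<lambda>x. cnj (?d x)) x = cnj (bal P V ?d x)" by (simp add: bal_def)
    then show ?thesis unfolding balU .
  qed
  have mc: "cnj (?m x) = - ?m x" for x
    by (rule complex_eqI) (use m_Re[of x] in auto)
  have cd: "cnj (?d x) = - (?m x * cnj (U x))" for x
    unfolding complex_cnj_mult[of "?m x" "U x"] mc by simp
  have Vconst: "V x * cnj (V x) = 1" if "x \<ge> 0" for x
  proof -
    have "prim P (\<lambda>x. V x * cnj (V x)) (\<lambda>x. cnj (U x) * ?d x + U x * cnj (?d x))"
      using prim_mult[OF P prV prim_cnj[OF prV]] unfolding balUc balU .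
    moreover have "cnj (U x) * ?d x + U x * cnj (?d x) = 0" for x
      unfolding cd by (simp add: algebra_simps)
    ultimately have "V x * cnj (V x) = V 0 * cnj (V 0)"
      by (intro prim_zero_const[OF _ _ that]) auto
    then show ?thesis using UV(3)[of 0] by simp
  qed
  obtain C where C: "\<And>x. atom P x \<le> C" using atom_bdd by blast
  have C0: "C \<ge> 0" using C[of 0] atom_nonneg[of P 0] by linarith
  \<comment> \<open>\<open>|V| = 1\<close> on the positive axis, but \<open>U\<close> may be smaller
    at atoms. From \<open>V = U (1 - p m / 2)\<close> and the bounds on \<open>p\<close> and
    \<open>m\<close> one gets \<open>|V| \<le> K |U|\<close> uniformly, so \<open>U\<close> stays
    away from 0.\<close>
  define K where "K = 1 + C * ((\<bar>l\<bar> + 1) / cmod J) / 2"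
  have K0: "K \<ge> 1" using C0 by (simp add: K_def)
  have Ulow: "1 \<le> K * cmod (U x)" if "x \<ge> 0" for x
  proof -
    have "U x = V x + of_real (atom P x) * ?d x / 2" using fun_cong[OF balU, of x] by (simp add: bal_def)
    then have "V x = U x * (1 - of_real (atom P x) * ?m x / 2)" by (simp add: algebra_simps)
    then have "cmod (V x) = cmod (U x) * cmod (1 - of_real (atom P x) * ?m x / 2)" by (simp only: norm_mult)
    also have "\<dots> \<le> cmod (U x) * K"
    proof (rule mult_left_mono)
      have "cmod (1 - of_real (atom P x) * ?m x / 2) \<le> 1 + atom P x * cmod (?m x) / 2"
        using norm_triangle_ineq4[of 1 "of_real (atom P x) * ?m x / 2"] atom_nonneg[of P x] by (simp add: norm_mult)
      moreover have "atom P x * cmod (?m x) \<le> C * ((\<bar>l\<bar> + 1) / cmod J)"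
        by (intro mult_mono C m_le C0) simp
      moreover have "A \<le> 1 + B / 2 \<Longrightarrow> B \<le> D \<Longrightarrow> A \<le> 1 + D / 2" for A B D :: real by linarith
      ultimately show "cmod (1 - of_real (atom P x) * ?m x / 2) \<le> K" unfolding K_def by blast
    qed simp
    finally have "cmod (V x) \<le> K * cmod (U x)" by (simp add: mult.commute)
    moreover have "cmod (V x) = 1"
    proof -
      have "(cmod (V x))\<^sup>2 = 1" using Vconst[OF that] complex_norm_square[of "V x"]
        by (metis of_real_1 of_real_eq_iff)
      then show ?thesis using norm_ge_zero[of "V x"] unfolding power2_eq_1_iff by linarith
    qed
    ultimately show ?thesis by simp
  qed
  define g where "g x = indicator {0..<b} x * U x" for x
  have Ub: "loc_bounded U" using bal_loc_bounded[OF P prV] unfolding balU .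
  have Ui: "loc_int P (\<lambda>x. w x * (cmod (U x))\<^sup>2)" by (rule inner_loc_int[OF UV(4) Ub])
  have g: "l2w g"
  proof -
    have "integrable P (\<lambda>x. indicator {0..<b} x *\<^sub>R (w x * (cmod (U x))\<^sup>2))"
      using loc_intD[OF Ui, of 0 b] unfolding set_integrable_def .
    moreover have "indicator {0..<b} x *\<^sub>R (w x * (cmod (U x))\<^sup>2) = w x * (cmod (g x))\<^sup>2" for x
      by (simp add: g_def indicator_def)
    ultimately have "integrable P (\<lambda>x. w x * (cmod (g x))\<^sup>2)" by (simp only:)
    moreover have "g \<in> borel_measurable borel" unfolding g_def using UV(4) by measurable
    ultimately show ?thesis by (simp add: l2w_def)
  qed
  have "\<not> (\<exists>v u. l2w u \<and> sol v u (\<lambda>x. of_real l * u x + g x))"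
  proof
    assume "\<exists>v u. l2w u \<and> sol v u (\<lambda>x. of_real l * u x + g x)"
    then obtain v u where u: "l2w u" and s: "sol v u (\<lambda>x. of_real l * u x + g x)" by blast
    have f: "l2w (\<lambda>x. of_real l * u x + g x)" by (rule l2w_add[OF l2w_cmult[OF u] g])
    have pr: "prim P (\<lambda>x. cnj (v x) * v x) (\<lambda>x. of_real (w x) * (cnj (u x) * (of_real l * u x + g x) - cnj (of_real l * u x + g x) * u x) / J)"
      by (rule sol_prim_prod[OF s s])
    \<comment> \<open>The source \<open>g\<close> vanishes outside \<open>{0..<b}\<close>, so
      \<open>|v|^2\<close> is constant on each of the two half-lines. Their end points
      \<open>0\<close> and \<open>b\<close> are included since \<open>v\<close> consists of left
      limits.\<close>
    have const: "cnj (v d) * v d = cnj (v c) * v c" if "c \<le> d" "d \<le> 0 \<or> b \<le> c" for c d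
    proof (rule prim_zero_const[OF pr _ that(1)])
      fix x assume "x \<in> {c..<d}"
      then have "g x = 0" using that(2) by (auto simp: g_def)
      then show "of_real (w x) * (cnj (u x) * (of_real l * u x + g x) - cnj (of_real l * u x + g x) * u x) / J = 0"
        by simp
    qed
    have vb: "v b = 0"
    proof -
      have "cnj (v b) * v b = 0"
      proof (rule sol_vanish_top[OF s u f])
        fix y :: real assume "y \<ge> b"
        from const[OF this] show "cnj (v y) * v y = cnj (v b) * v b" by simp
      qed
      then show ?thesis by simp
    qed
    have v0: "v 0 = 0"
    proof -
      have "cnj (v 0) * v 0 = 0"
      proof (rule sol_vanish_bot[OF s u f])
        fix y :: real assume "y \<le> 0"
        from const[OF this] show "cnj (v y) * v y = cnj (v 0) * v 0" by simp
      qed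
      then show ?thesis by simp
    qed
    let ?f = "\<lambda>x. of_real l * u x + g x"
    have p2: "prim P (\<lambda>x. cnj (V x) * v x) (\<lambda>x. u x * cnj (?d x) + cnj (U x) * dens u ?f x)"
      using prim_mult[OF P prim_cnj[OF prV] sol_prim[OF s]] unfolding balUc sol_bal[OF s] .
    \<comment> \<open>The terms with \<open>q\<close> and \<open>l\<close> cancel because
      \<open>?m\<close> is imaginary on the interval, and only the source \<open>g = U\<close>
      remains.\<close>
    have e2: "u x * cnj (?d x) + cnj (U x) * dens u ?f x = of_real (w x * (cmod (U x))\<^sup>2) / J" if "x \<in> {0..<b}" for x
    proof -
      have "u x * cnj (?d x) + cnj (U x) * dens u ?f x = of_real (w x) * (cnj (U x) * U x) / J"
        unfolding cd dens_coef using that by (simp add: g_def algebra_simps)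
      then show ?thesis by (simp add: complex_norm_square[symmetric] mult.commute)
    qed
    have "0 = (LINT x:{0..<b}|P. u x * cnj (?d x) + cnj (U x) * dens u ?f x)"
      using primD[OF p2 b(1)] vb v0 by simp
    also have "\<dots> = (LINT x:{0..<b}|P. of_real (w x * (cmod (U x))\<^sup>2) / J)"
      by (rule set_lebesgue_integral_cong) (use e2 in \<open>auto simp: setsP\<close>)
    also have "\<dots> = of_real (LINT x:{0..<b}|P. w x * (cmod (U x))\<^sup>2) / J"
      unfolding set_integral_divide_zero set_integral_complex_of_real ..
    finally have z: "(LINT x:{0..<b}|P. w x * (cmod (U x))\<^sup>2) = 0" using J(2) by simp
    have "1 \<le> (LINT x:{0..<b}|P. w x)" by (rule b(2))
    also have "\<dots> \<le> (LINT x:{0..<b}|P. K\<^sup>2 * (w x * (cmod (U x))\<^sup>2))"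
    proof (rule set_integral_mono[OF loc_intD[OF w_loc_int] set_integrable_mult_right[OF loc_intD[OF Ui]]])
      fix x assume "x \<in> {0..<b}"
      then have "1\<^sup>2 \<le> (K * cmod (U x))\<^sup>2" using Ulow[of x] by (intro power_mono) auto
      then have "w x * 1 \<le> w x * (K * cmod (U x))\<^sup>2" by (intro mult_left_mono w_ge) simp
      then show "w x \<le> K\<^sup>2 * (w x * (cmod (U x))\<^sup>2)" by (simp add: power_mult_distrib mult.left_commute)
    qed
    also have "\<dots> = K\<^sup>2 * (LINT x:{0..<b}|P. w x * (cmod (U x))\<^sup>2)" by simp
    also have "\<dots> = 0" unfolding z by simp
    finally show False by simp
  qed
  with g show ?thesis by blast
qed

end

section \<open>Reflection\<close>

lemma distr_uminus_locally_finite: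
  assumes P: "locally_finite P" shows "locally_finite (distr P borel uminus)"
proof -
  note Pd = locally_finiteD[OF P]
  have m: "uminus \<in> P \<rightarrow>\<^sub>M (borel :: real measure)"
    unfolding measurable_cong_sets[OF Pd(1) refl] by measurable
  have "emeasure (distr P borel uminus) {a..b} < \<infinity>" for a b
  proof -
    have "uminus -` {a..b} \<inter> space P = {-b..-a}" using Pd(2) by auto
    then have "emeasure (distr P borel uminus) {a..b} = emeasure P {-b..-a}"
      by (subst emeasure_distr[OF m]) auto
    then show ?thesis using Pd(3) by simp
  qed
  then show ?thesis by (simp add: locally_finite_def)
qed

lemma integral_distr_uminus:
  fixes f :: "real \<Rightarrow> 'b::{banach, second_countable_topology}"
  assumes P: "locally_finite P" and f: "f \<in> borel_measurable borel"
  shows "integral\<^sup>L (distr P borel uminus) f = (\<integral>x. f (- x) \<partial>P)"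
    and "integrable (distr P borel uminus) f \<longleftrightarrow> integrable P (\<lambda>x. f (- x))"
proof -
  have m: "uminus \<in> P \<rightarrow>\<^sub>M (borel :: real measure)"
    unfolding measurable_cong_sets[OF locally_finiteD(1)[OF P] refl] by measurable
  show "integral\<^sup>L (distr P borel uminus) f = (\<integral>x. f (- x) \<partial>P)"
    "integrable (distr P borel uminus) f \<longleftrightarrow> integrable P (\<lambda>x. f (- x))"
    using integral_distr[OF m f] integrable_distr_eq[OF m f] by simp_all
qed

lemma atom_distr_uminus:
  assumes P: "locally_finite P" shows "atom (distr P borel uminus) x = atom P (- x)"
proof -
  note Pd = locally_finiteD[OF P]
  have m: "uminus \<in> P \<rightarrow>\<^sub>M (borel :: real measure)"
    unfolding measurable_cong_sets[OF Pd(1) refl] by measurable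
  have "uminus -` {x} \<inter> space P = {- x}" using Pd(2) by (auto simp: minus_equation_iff)
  then show ?thesis unfolding atom_def by (subst measure_distr[OF m]) auto
qed

text \<open>Reflection exchanges left and right limits. The left-continuous function on the
  reflected line is therefore built from the right limits \<open>v + p d\<close>, and its derivative
  changes sign.\<close>

lemma prim_reflect:
  assumes P: "locally_finite P" and p: "prim (distr P borel uminus) v d"
  shows "prim P (\<lambda>t. v (- t) + of_real (atom P t) * d (- t)) (\<lambda>t. - d (- t))"
proof -
  let ?P = "distr P borel uminus"
  have P': "locally_finite ?P" by (rule distr_uminus_locally_finite[OF P])
  note Pd = locally_finiteD[OF P] and Pd' = locally_finiteD[OF P']
  have [measurable]: "d \<in> borel_measurable borel" by (rule loc_int_measurable[OF prim_loc_int[OF p]])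
  have i1: "integrable ?P (\<lambda>x. indicator {a..<b} x *\<^sub>R d x)" for a b
    using loc_intD[OF prim_loc_int[OF p]] unfolding set_integrable_def .
  have i2: "integrable ?P (\<lambda>x. indicator {c} x *\<^sub>R d c)" for c
    using Pd' by (intro integrable_scaleR_left integrable_real_indicator) auto
  have e2: "(\<integral>x. indicator {c} x *\<^sub>R d c \<partial>?P) = of_real (atom P (- c)) * d c" for c
  proof -
    have "(\<integral>x. indicator {c} x *\<^sub>R d c \<partial>?P) = of_real (atom ?P c) * d c"
      using Pd'(1,5) by (simp add: atom_def scaleR_conv_of_real)
    then show ?thesis unfolding atom_distr_uminus[OF P] .
  qed
  \<comment> \<open>The reflection of \<open>{a..<b}\<close> is open at the left and closed at the
    right; the correction consists of the atoms at the two end points.\<close>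
  have split: "indicator {-b<..-a} x *\<^sub>R d x = indicator {-b..<-a} x *\<^sub>R d x - indicator {-b} x *\<^sub>R d (-b) + indicator {-a} x *\<^sub>R d (-a)"
    if "a \<le> b" for a b x
    using that by (auto simp: indicator_def)
  have i3: "integrable ?P (\<lambda>x. indicator {-b<..-a} x *\<^sub>R d x)" if "a \<le> b" for a b
    unfolding split[OF that] by (intro Bochner_Integration.integrable_add Bochner_Integration.integrable_diff i1 i2)
  have ind: "indicator {-b<..-a} (- x) = (indicator {a..<b} x :: real)" for a b x :: real
    by (auto simp: indicator_def)
  have i4: "integrable P (\<lambda>x. indicator {a..<b} x *\<^sub>R d (- x))" if "a \<le> b" for a b
  proof -
    have "(\<lambda>x. indicator {-b<..-a} x *\<^sub>R d x) \<in> borel_measurable borel" by measurable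
    from integral_distr_uminus(2)[OF P this] i3[OF that] show ?thesis unfolding ind by blast
  qed
  have "set_integrable P {a..<b} (\<lambda>t. - d (- t))" for a b
  proof (cases "a \<le> b")
    case True
    have "integrable P (\<lambda>x. - (indicator {a..<b} x *\<^sub>R d (- x)))" using i4[OF True] by simp
    then show ?thesis unfolding set_integrable_def by simp
  qed (simp add: set_integrable_def)
  moreover have "(\<lambda>t. - d (- t)) \<in> borel_measurable borel" by measurable
  moreover have "v (- b) + of_real (atom P b) * d (- b) - (v (- a) + of_real (atom P a) * d (- a)) = (LINT x:{a..<b}|P. - d (- x))"
    if ab: "a \<le> b" for a b
  proof -
    have "(LINT x:{a..<b}|P. - d (- x)) = - (\<integral>x. indicator {-b<..-a} (- x) *\<^sub>R d (- x) \<partial>P)"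
      unfolding ind set_lebesgue_integral_def by simp
    also have "(\<integral>x. indicator {-b<..-a} (- x) *\<^sub>R d (- x) \<partial>P) = (\<integral>x. indicator {-b<..-a} x *\<^sub>R d x \<partial>?P)"
      by (rule integral_distr_uminus(1)[OF P, symmetric]) measurable
    also have "\<dots> = (\<integral>x. indicator {-b..<-a} x *\<^sub>R d x - indicator {-b} x *\<^sub>R d (-b) \<partial>?P) + (\<integral>x. indicator {-a} x *\<^sub>R d (-a) \<partial>?P)"
      unfolding split[OF ab] by (intro Bochner_Integration.integral_add Bochner_Integration.integrable_diff i1 i2)
    also have "(\<integral>x. indicator {-b..<-a} x *\<^sub>R d x - indicator {-b} x *\<^sub>R d (-b) \<partial>?P) =
      (\<integral>x. indicator {-b..<-a} x *\<^sub>R d x \<partial>?P) - (\<integral>x. indicator {-b} x *\<^sub>R d (-b) \<partial>?P)"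
      by (intro Bochner_Integration.integral_diff i1 i2)
    also have "(\<integral>x. indicator {-b..<-a} x *\<^sub>R d x \<partial>?P) = v (- a) - v (- b)"
      using primD[OF p, of "-b" "-a"] ab unfolding set_lebesgue_integral_def by simp
    finally show ?thesis unfolding e2 by (simp add: algebra_simps)
  qed
  ultimately show ?thesis unfolding prim_def loc_int_def by blast
qed

section \<open>Solvability in the opposite half-plane\<close>

context system
begin

text \<open>The sign of \<open>J\<close> changes because differentiation changes sign under
  reflection. The bounds and the mass conditions are symmetric in the two ends of the line.\<close>

lemma reflected: "system (distr P borel uminus) (- J) (\<lambda>x. q (- x)) (\<lambda>x. w (- x))"
proof
  let ?P = "distr P borel uminus"
  show P': "locally_finite ?P" by (rule distr_uminus_locally_finite[OF P])
  show "(\<lambda>x. q (- x)) \<in> borel_measurable borel" "(\<lambda>x. w (- x)) \<in> borel_measurable borel" by measurable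
  show "\<bar>q (- x)\<bar> \<le> 1" "0 \<le> w (- x)" "w (- x) \<le> 1" for x using q_le w_ge w_le by auto
  show "Re (- J) = 0" "- J \<noteq> 0" using J by auto
  show "\<exists>C. \<forall>x. atom ?P x \<le> C" using atom_bdd by (auto simp: atom_distr_uminus[OF P])
  have eq: "(LINT x:{a..<b}|?P. w (- x)) = (LINT x:{-b<..-a}|P. w x)" for a b
  proof -
    have "(LINT x:{a..<b}|?P. w (- x)) = (\<integral>x. indicator {a..<b} (- x) *\<^sub>R w (- (- x)) \<partial>P)"
      unfolding set_lebesgue_integral_def by (rule integral_distr_uminus(1)[OF P]) measurable
    also have "\<dots> = (LINT x:{-b<..-a}|P. w x)" unfolding set_lebesgue_integral_def
      by (rule Bochner_Integration.integral_cong[OF refl]) (auto simp: indicator_def)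
    finally show ?thesis .
  qed
  have le: "(LINT x:{c..<d}|P. w x) \<le> (LINT x:{a<..b}|P. w x)" if "a < c" "d \<le> b" for a b c d
    unfolding set_lebesgue_integral_def
  proof (rule integral_mono)
    show "integrable P (\<lambda>x. indicator {c..<d} x *\<^sub>R w x)"
      using loc_intD[OF w_loc_int] unfolding set_integrable_def .
    have "set_integrable P {a<..b} w"
      by (rule set_integrable_subset[OF loc_intD[OF w_loc_int, of a "b + 1"]]) auto
    then show "integrable P (\<lambda>x. indicator {a<..b} x *\<^sub>R w x)" unfolding set_integrable_def .
    show "indicator {c..<d} x *\<^sub>R w x \<le> indicator {a<..b} x *\<^sub>R w x" for x
      using that w_ge[of x] by (auto simp: indicator_def)
  qed
  show "\<exists>b\<ge>c. M \<le> (LINT x:{c..<b}|?P. w (- x))" for M c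
  proof -
    \<comment> \<open>The reflected interval is open at its left end, so it is enlarged by 1 to
      contain \<open>{a..<- c}\<close>. In the next claim the starting point is moved by 1 for the
      same reason.\<close>
    obtain a where a: "a \<le> - c" "M \<le> (LINT x:{a..<-c}|P. w x)" using mass_bot by blast
    then show ?thesis unfolding eq
      by (intro exI[of _ "1 - a"] conjI order_trans[OF a(2) le]) auto
  qed
  show "\<exists>a\<le>c. M \<le> (LINT x:{a..<c}|?P. w (- x))" for M c
  proof -
    obtain b where b: "b \<ge> - c + 1" "M \<le> (LINT x:{-c+1..<b}|P. w x)" using mass_top by blast
    then show ?thesis unfolding eq
      by (intro exI[of _ "- b"] conjI order_trans[OF b(2) le]) auto
  qed
qed

text \<open>Since \<open>Im z / Im (- J) < 0\<close>, \<open>range_lower\<close> solves the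
  reflected system with the reflected source; reflecting back, the right limits of that solution
  become left limits, while the balanced values are simply mirrored.\<close>

lemma range_upper:
  assumes z: "Im z / Im J > 0" and g: "l2w g"
  shows "\<exists>v u. sol v u (\<lambda>x. z * u x + g x) \<and> l2w u"
proof -
  interpret R: system "distr P borel uminus" "- J" "\<lambda>x. q (- x)" "\<lambda>x. w (- x)" by (rule reflected)
  have l2: "R.l2w f \<longleftrightarrow> l2w (\<lambda>x. f (- x))" for f
  proof (cases "f \<in> borel_measurable borel")
    case True
    then have [measurable]: "f \<in> borel_measurable borel" .
    have "(\<lambda>x. w (- x) * (cmod (f x))\<^sup>2) \<in> borel_measurable borel"
      "(\<lambda>x. f (- x)) \<in> borel_measurable borel" by measurable
    then show ?thesis using True integral_distr_uminus(2)[OF P, of "\<lambda>x. w (- x) * (cmod (f x))\<^sup>2"]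
      unfolding R.l2w_def l2w_def by simp
  next
    case False
    have "f \<in> borel_measurable borel" if [measurable]: "(\<lambda>x. f (- x)) \<in> borel_measurable borel"
    proof -
      have "(\<lambda>x. (\<lambda>x. f (- x)) (- x)) \<in> borel_measurable borel"
        by (rule measurable_compose[OF _ that]) measurable
      then show ?thesis by simp
    qed
    then show ?thesis using False by (auto simp: R.l2w_def l2w_def)
  qed
  have "R.l2w (\<lambda>x. g (- x))" unfolding l2 using g by simp
  moreover have "Im z / Im (- J) < 0" using z by simp
  ultimately obtain v u where s: "R.sol v u (\<lambda>x. z * u x + g (- x))" and u: "R.l2w u"
    using R.range_lower[of z "\<lambda>x. g (- x)"] by blast
  define d where "d = R.dens u (\<lambda>x. z * u x + g (- x))"
  let ?v = "\<lambda>t. v (- t) + of_real (atom P t) * d (- t)"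
  have um[measurable]: "u \<in> borel_measurable borel" using R.l2w_borel[OF u] .
  have [measurable]: "g \<in> borel_measurable borel" using l2w_borel[OF g] .
  have p: "prim P ?v (\<lambda>t. - d (- t))"
    using prim_reflect[OF P R.sol_prim[OF s]] unfolding d_def .
  have "(\<lambda>t. - d (- t)) = dens (\<lambda>x. u (- x)) (\<lambda>x. z * u (- x) + g x)"
    by (rule ext) (simp add: d_def R.dens_def dens_def)
  note deq = this[symmetric]
  have p': "prim P ?v (dens (\<lambda>x. u (- x)) (\<lambda>x. z * u (- x) + g x))"
    unfolding deq by (rule p)
  have dd: "dens (\<lambda>x. u (- x)) (\<lambda>x. z * u (- x) + g x) t = - d (- t)" for t
    unfolding deq ..
  have "(\<lambda>x. u (- x)) = bal P ?v (dens (\<lambda>x. u (- x)) (\<lambda>x. z * u (- x) + g x))"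
  proof
    fix x
    have "u (- x) = bal (distr P borel uminus) v d (- x)" unfolding d_def R.sol_bal[OF s] ..
    also have "\<dots> = v (- x) + of_real (atom P x) * d (- x) / 2"
      unfolding bal_def atom_distr_uminus[OF P] by simp
    finally show "u (- x) = bal P ?v (dens (\<lambda>x. u (- x)) (\<lambda>x. z * u (- x) + g x)) x"
      unfolding bal_def dd by simp
  qed
  then have "sol ?v (\<lambda>x. u (- x)) (\<lambda>x. z * u (- x) + g x)" unfolding sol_def using p' by simp
  then show ?thesis using u unfolding l2 by blast
qed

lemma range_nonreal:
  assumes "Im z \<noteq> 0" "l2w g" shows "\<exists>v u. sol v u (\<lambda>x. z * u x + g x) \<and> l2w u"
proof (cases "Im z / Im J < 0")
  case True then show ?thesis using range_lower assms(2) by blast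
next
  case False
  then have "Im z / Im J > 0" using assms(1) ImJ by (simp add: less_le)
  then show ?thesis using range_upper assms(2) by blast
qed

end

section \<open>The local measure determined by a distribution\<close>

lemma local_measure_locally_finite: "local_measure r M h \<Longrightarrow> locally_finite M"
  by (simp add: local_measure_def locally_finite_def)

lemma local_measure_loc_int:
  assumes "local_measure r M h" shows "loc_int M h"
proof (rule loc_int_loc_bounded)
  show "locally_finite M" by (rule local_measure_locally_finite[OF assms])
  show "h \<in> borel_measurable borel" "loc_bounded h"
    using assms by (auto simp: local_measure_def loc_bounded_def)
qed

lemma set_integral_limit_test:
  fixes h :: "real \<Rightarrow> complex"
  assumes h: "loc_int M h" and M: "locally_finite M"
    and \<phi>: "\<And>n. \<phi> n \<in> borel_measurable borel" "\<And>n x. cmod (\<phi> n x) \<le> indicator {a'..b'} x"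
      "\<And>x. (\<lambda>n. \<phi> n x) \<longlonglongrightarrow> indicator {a..<b} x"
  shows "(\<lambda>n. \<integral>x. \<phi> n x * h x \<partial>M) \<longlonglongrightarrow> (LINT x:{a..<b}|M. h x)"
proof -
  note Md = locally_finiteD[OF M]
  have hm: "h \<in> borel_measurable M" using loc_int_measurable[OF h] Md by simp
  have "(\<lambda>n. \<integral>x. \<phi> n x * h x \<partial>M) \<longlonglongrightarrow> (\<integral>x. indicator {a..<b} x * h x \<partial>M)"
  proof (rule integral_dominated_convergence[where w="\<lambda>x. indicator {a'..<b' + 1} x *\<^sub>R cmod (h x)"])
    show "integrable M (\<lambda>x. indicator {a'..<b' + 1} x *\<^sub>R cmod (h x))"
      using loc_intD[OF loc_int_norm[OF h]] unfolding set_integrable_def .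
    show "(\<lambda>x. indicator {a..<b} x * h x) \<in> borel_measurable M"
      using hm Md(1) by (intro borel_measurable_times borel_measurable_indicator) auto
    show "(\<lambda>x. \<phi> n x * h x) \<in> borel_measurable M" for n
      using hm \<phi>(1) Md by (intro borel_measurable_times) auto
    show "AE x in M. (\<lambda>n. \<phi> n x * h x) \<longlonglongrightarrow> indicator {a..<b} x * h x"
      by (intro AE_I2 tendsto_mult tendsto_const \<phi>(3))
    show "AE x in M. norm (\<phi> n x * h x) \<le> indicator {a'..<b' + 1} x *\<^sub>R cmod (h x)" for n
    proof (rule AE_I2)
      fix x
      have "cmod (\<phi> n x) \<le> indicator {a'..<b' + 1} x"
        by (rule order_trans[OF \<phi>(2)]) (simp add: indicator_def)
      then show "norm (\<phi> n x * h x) \<le> indicator {a'..<b' + 1} x *\<^sub>R cmod (h x)"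
        by (simp add: norm_mult mult_right_mono)
    qed
  qed
  moreover have "(\<integral>x. indicator {a..<b} x * h x \<partial>M) = (LINT x:{a..<b}|M. h x)"
    unfolding set_lebesgue_integral_def
    by (rule Bochner_Integration.integral_cong[OF refl]) (simp add: indicator_def)
  ultimately show ?thesis by simp
qed

text \<open>\<open>polar\<close> picks some representation of the distribution, while reality and
  non-negativity are given for possibly another one. Test functions approximating half-open
  intervals let the two be compared.\<close>

lemma local_measures_agree_on_intervals:
  assumes r: "local_measure r M h" and s: "local_measure r N g"
  shows "(LINT x:{a..<b}|M. h x) = (LINT x:{a..<b}|N. g x)"
proof (cases "a < b")
  case True
  obtain \<phi> :: "nat \<Rightarrow> real \<Rightarrow> complex" where \<phi>: "\<And>n. test_fun (\<phi> n)"
    "\<And>n x. cmod (\<phi> n x) \<le> indicator {a - 1..b} x" "\<And>x. (\<lambda>n. \<phi> n x) \<longlonglongrightarrow> indicator {a..<b} x"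
    by (rule interval_test_funs[OF True]) (rule that)
  have "(\<lambda>n. \<integral>x. \<phi> n x * h x \<partial>M) \<longlonglongrightarrow> (LINT x:{a..<b}|M. h x)"
    by (rule set_integral_limit_test[OF local_measure_loc_int[OF r] local_measure_locally_finite[OF r] test_fun_borel[OF \<phi>(1)] \<phi>(2,3)])
  moreover have "(\<lambda>n. \<integral>x. \<phi> n x * g x \<partial>N) \<longlonglongrightarrow> (LINT x:{a..<b}|N. g x)"
    by (rule set_integral_limit_test[OF local_measure_loc_int[OF s] local_measure_locally_finite[OF s] test_fun_borel[OF \<phi>(1)] \<phi>(2,3)])
  moreover have "(\<integral>x. \<phi> n x * h x \<partial>M) = (\<integral>x. \<phi> n x * g x \<partial>N)" for n
    using r s \<phi>(1)[of n] by (metis local_measure_def)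
  ultimately show ?thesis using LIMSEQ_unique by (simp only:)
qed (simp add: set_lebesgue_integral_def)

lemma local_measure_shift:
  assumes r: "local_measure r M h" and per: "periodic_dist \<omega> r"
  shows "(LINT x:{a..<b}|M. h x) = (LINT x:{a - \<omega>..<b - \<omega>}|M. h x)"
proof (cases "a < b")
  case True
  obtain \<phi> :: "nat \<Rightarrow> real \<Rightarrow> complex" where \<phi>: "\<And>n. test_fun (\<phi> n)"
    "\<And>n x. cmod (\<phi> n x) \<le> indicator {a - 1..b} x" "\<And>x. (\<lambda>n. \<phi> n x) \<longlonglongrightarrow> indicator {a..<b} x"
    by (rule interval_test_funs[OF True]) (rule that)
  have "(\<lambda>n. \<integral>x. \<phi> n x * h x \<partial>M) \<longlonglongrightarrow> (LINT x:{a..<b}|M. h x)"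
    by (rule set_integral_limit_test[OF local_measure_loc_int[OF r] local_measure_locally_finite[OF r] test_fun_borel[OF \<phi>(1)] \<phi>(2,3)])
  moreover have "(\<lambda>n. \<integral>x. \<phi> n (x + \<omega>) * h x \<partial>M) \<longlonglongrightarrow> (LINT x:{a - \<omega>..<b - \<omega>}|M. h x)"
  proof (rule set_integral_limit_test[OF local_measure_loc_int[OF r] local_measure_locally_finite[OF r] test_fun_borel[OF test_fun_shift[OF \<phi>(1)]]])
    show "cmod (\<phi> n (x + \<omega>)) \<le> indicator {a - 1 - \<omega>..b - \<omega>} x" for n x
      using \<phi>(2)[of n "x + \<omega>"] by (auto simp: indicator_def split: if_splits)
    have "(indicator {a..<b} (x + \<omega>) :: complex) = indicator {a - \<omega>..<b - \<omega>} x" for x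
      by (auto simp: indicator_def)
    then show "(\<lambda>n. \<phi> n (x + \<omega>)) \<longlonglongrightarrow> indicator {a - \<omega>..<b - \<omega>} x" for x
      using \<phi>(3)[of "x + \<omega>"] by (simp only:)
  qed
  moreover have "(\<integral>x. \<phi> n x * h x \<partial>M) = (\<integral>x. \<phi> n (x + \<omega>) * h x \<partial>M)" for n
  proof -
    have "(\<integral>x. \<phi> n x * h x \<partial>M) = r (\<phi> n)" using r \<phi>(1)[of n] by (simp add: local_measure_def)
    also have "\<dots> = r (\<lambda>x. \<phi> n (x + \<omega>))" using per \<phi>(1)[of n] by (simp add: periodic_dist_def)
    also have "\<dots> = (\<integral>x. \<phi> n (x + \<omega>) * h x \<partial>M)"
      using r test_fun_shift[OF \<phi>(1)[of n]] by (simp add: local_measure_def)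
    finally show ?thesis .
  qed
  ultimately show ?thesis using LIMSEQ_unique by (simp only:)
qed (simp add: set_lebesgue_integral_def)

text \<open>Half-open intervals are stable under intersection and generate the Borel sets, so
  Dynkin's argument applies. The fixed window \<open>{c..<d}\<close> keeps the integrals finite, as
  is needed to subtract for complements.\<close>

lemma set_integral_determined_by_intervals:
  fixes h g :: "real \<Rightarrow> complex"
  assumes M: "locally_finite M" "loc_int M h" and N: "locally_finite N" "loc_int N g"
    and eq: "\<And>a b. (LINT x:{a..<b}|M. h x) = (LINT x:{a..<b}|N. g x)"
    and "A \<in> sets borel"
  shows "(LINT x:A \<inter> {c..<d}|M. h x) = (LINT x:A \<inter> {c..<d}|N. g x)"
proof -
  have int: "set_integrable M (A \<inter> {c..<d}) h" "set_integrable N (A \<inter> {c..<d}) g" if "A \<in> sets borel" for A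
    using locally_finiteD(1)[OF M(1)] locally_finiteD(1)[OF N(1)] that
      set_integrable_subset[OF loc_intD[OF M(2), of c d], of "A \<inter> {c..<d}"]
      set_integrable_subset[OF loc_intD[OF N(2), of c d], of "A \<inter> {c..<d}"] by auto
  have Int: "Int_stable (range (\<lambda>(a, b). {a..<b::real}))"
  proof (rule Int_stableI)
    fix A B assume "A \<in> range (\<lambda>(a, b). {a..<b::real})" "B \<in> range (\<lambda>(a, b). {a..<b::real})"
    then obtain a b c d where "A = {a..<b}" "B = {c..<d}" by auto
    then have "A \<inter> B = (\<lambda>(a, b). {a..<b}) (max a c, min b d)" by auto
    then show "A \<inter> B \<in> range (\<lambda>(a, b). {a..<b::real})" by (rule range_eqI)
  qed
  have subset_Pow: "range (\<lambda>(a, b). {a..<b::real}) \<subseteq> Pow UNIV" by auto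
  have "A \<in> sigma_sets UNIV (range (\<lambda>(a, b). {a..<b::real}))"
    using \<open>A \<in> sets borel\<close> unfolding borel_eq_atLeastLessThan by simp
  with Int subset_Pow show ?thesis
  proof (induction rule: sigma_sets_induct_disjoint)
    case (basic A)
    then obtain a b where "A = {a..<b}" by auto
    then have "A \<inter> {c..<d} = {max a c..<min b d}" by auto
    then show ?case using eq by simp
  next
    case empty then show ?case by (simp add: set_lebesgue_integral_def)
  next
    case (compl A)
    then have A: "A \<in> sets borel" unfolding borel_eq_atLeastLessThan by simp
    have dec: "{c..<d} = (A \<inter> {c..<d}) \<union> ((UNIV - A) \<inter> {c..<d})" by auto
    have "(LINT x:{c..<d}|M. h x) = (LINT x:A \<inter> {c..<d}|M. h x) + (LINT x:(UNIV - A) \<inter> {c..<d}|M. h x)"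
      by (subst dec, rule set_integral_Un) (use A in \<open>auto intro!: int\<close>)
    moreover have "(LINT x:{c..<d}|N. g x) = (LINT x:A \<inter> {c..<d}|N. g x) + (LINT x:(UNIV - A) \<inter> {c..<d}|N. g x)"
      by (subst dec, rule set_integral_Un) (use A in \<open>auto intro!: int\<close>)
    ultimately show ?case using eq[of c d] compl.IH by simp
  next
    case (union A)
    then have A: "A i \<in> sets borel" for i unfolding borel_eq_atLeastLessThan by auto
    have un: "(\<Union>i. A i) \<inter> {c..<d} = (\<Union>i. A i \<inter> {c..<d})" by auto
    have dis: "A i \<inter> {c..<d} \<inter> (A j \<inter> {c..<d}) = {}" if "i \<noteq> j" for i j
      using union.hyps(1) that by (auto simp: disjoint_family_on_def)
    have 1: "(LINT x:(\<Union>i. A i \<inter> {c..<d})|M. h x) = (\<Sum>i. (LINT x:A i \<inter> {c..<d}|M. h x))"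
    proof (rule lebesgue_integral_countable_add[OF _ dis])
      show "A i \<inter> {c..<d} \<in> sets M" for i using A locally_finiteD(1)[OF M(1)] by simp
      show "set_integrable M (\<Union>i. A i \<inter> {c..<d}) h"
        unfolding un[symmetric] using A by (intro int sets.countable_UN) auto
    qed auto
    have 2: "(LINT x:(\<Union>i. A i \<inter> {c..<d})|N. g x) = (\<Sum>i. (LINT x:A i \<inter> {c..<d}|N. g x))"
    proof (rule lebesgue_integral_countable_add[OF _ dis])
      show "A i \<inter> {c..<d} \<in> sets N" for i using A locally_finiteD(1)[OF N(1)] by simp
      show "set_integrable N (\<Union>i. A i \<inter> {c..<d}) g"
        unfolding un[symmetric] using A by (intro int sets.countable_UN) auto
    qed auto
    show ?case unfolding un 1 2 using union.IH by simp
  qed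
qed

lemma AE_from_intervals:
  assumes "\<And>n::nat. AE x in M. x \<in> {- real n..<real n} \<longrightarrow> Q x" shows "AE x in M. Q x"
proof -
  have "AE x in M. \<forall>n::nat. x \<in> {- real n..<real n} \<longrightarrow> Q x" unfolding AE_all_countable using assms by blast
  then show ?thesis
  proof (rule eventually_mono)
    fix x assume x: "\<forall>n::nat. x \<in> {- real n..<real n} \<longrightarrow> Q x"
    obtain n :: nat where "\<bar>x\<bar> < real n" using reals_Archimedean2 by blast
    then have "x \<in> {- real n..<real n}" by auto
    then show "Q x" using x by blast
  qed
qed

lemma AE_zero_of_set_integrals:
  fixes f :: "real \<Rightarrow> real"
  assumes M: "locally_finite M" "loc_int M f"
    and z: "\<And>A c d. A \<in> sets borel \<Longrightarrow> (LINT x:A \<inter> {c..<d}|M. f x) = 0"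
  shows "AE x in M. f x = 0"
proof (rule AE_from_intervals)
  fix n :: nat
  let ?f = "\<lambda>x. indicator {- real n..<real n} x *\<^sub>R f x"
  have "AE x in M. ?f x = 0"
  proof (rule density_unique_real)
    show "integrable M ?f" using loc_intD[OF M(2)] unfolding set_integrable_def .
    show "integrable M (\<lambda>x. 0 :: real)" by simp
    fix A assume "A \<in> sets M"
    then have A: "A \<in> sets borel" using locally_finiteD(1)[OF M(1)] by simp
    have "set_lebesgue_integral M A ?f = (LINT x:A \<inter> {- real n..<real n}|M. f x)"
      unfolding set_lebesgue_integral_def
      by (rule Bochner_Integration.integral_cong[OF refl]) (simp add: indicator_def)
    then show "set_lebesgue_integral M A ?f = (LINT x:A|M. 0)" using z[OF A] by simp
  qed
  then show "AE x in M. x \<in> {- real n..<real n} \<longrightarrow> f x = 0" by (rule eventually_mono) (auto simp: indicator_def)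
qed

lemma set_integral_Re_Im:
  assumes "set_integrable M A (h :: real \<Rightarrow> complex)"
  shows "Re (LINT x:A|M. h x) = (LINT x:A|M. Re (h x))" "Im (LINT x:A|M. h x) = (LINT x:A|M. Im (h x))"
    "set_integrable M A (\<lambda>x. Re (h x))" "set_integrable M A (\<lambda>x. Im (h x))"
proof -
  have i: "integrable M (\<lambda>x. indicator A x *\<^sub>R h x)" using assms unfolding set_integrable_def .
  show "Re (LINT x:A|M. h x) = (LINT x:A|M. Re (h x))" "Im (LINT x:A|M. h x) = (LINT x:A|M. Im (h x))"
    using integral_Re[OF i] integral_Im[OF i] unfolding set_lebesgue_integral_def by simp_all
  show "set_integrable M A (\<lambda>x. Re (h x))" "set_integrable M A (\<lambda>x. Im (h x))"
    using integrable_Re[OF i] integrable_Im[OF i] unfolding set_integrable_def by simp_all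
qed

lemma local_measure_real_AE:
  assumes r: "local_measure r M h" and s: "local_measure r N g" and g: "\<And>x. g x \<in> \<real>"
  shows "AE x in M. Im (h x) = 0"
proof (rule AE_zero_of_set_integrals)
  note lM = local_measure_locally_finite[OF r] and lN = local_measure_locally_finite[OF s]
  note ih = local_measure_loc_int[OF r] and ig = local_measure_loc_int[OF s]
  show "locally_finite M" by (rule lM)
  show "loc_int M (\<lambda>x. Im (h x))"
    unfolding loc_int_def using set_integral_Re_Im(4)[OF loc_intD[OF ih]] loc_int_measurable[OF ih] by simp
  fix A :: "real set" and c d assume A: "A \<in> sets borel"
  have eq: "(LINT x:A \<inter> {c..<d}|M. h x) = (LINT x:A \<inter> {c..<d}|N. g x)"
    by (rule set_integral_determined_by_intervals[OF lM ih lN ig local_measures_agree_on_intervals[OF r s] A])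
  have i: "set_integrable M (A \<inter> {c..<d}) h" "set_integrable N (A \<inter> {c..<d}) g"
    using A locally_finiteD(1)[OF lM] locally_finiteD(1)[OF lN]
      set_integrable_subset[OF loc_intD[OF ih, of c d], of "A \<inter> {c..<d}"]
      set_integrable_subset[OF loc_intD[OF ig, of c d], of "A \<inter> {c..<d}"] by auto
  have "(LINT x:A \<inter> {c..<d}|M. Im (h x)) = (LINT x:A \<inter> {c..<d}|N. Im (g x))"
    using set_integral_Re_Im(2)[OF i(1)] set_integral_Re_Im(2)[OF i(2)] eq by simp
  also have "\<dots> = 0" using g by (simp add: complex_is_Real_iff)
  finally show "(LINT x:A \<inter> {c..<d}|M. Im (h x)) = 0" .
qed

text \<open>On the set \<open>B\<close> where \<open>Re h < 0\<close>, the integral of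
  \<open>Re h\<close> equals the mass of \<open>B\<close> for \<open>N\<close> and is thus
  non-negative, which forces \<open>B\<close> to be a null set. With vanishing imaginary part and
  modulus 1 only \<open>h = 1\<close> remains.\<close>

lemma local_measure_nonneg_AE:
  assumes r: "local_measure r M h" and s: "local_measure r N (\<lambda>_. 1)"
  shows "AE x in M. h x = 1"
proof -
  note lM = local_measure_locally_finite[OF r] and lN = local_measure_locally_finite[OF s]
  note ih = local_measure_loc_int[OF r] and ig = local_measure_loc_int[OF s]
  have [measurable]: "h \<in> borel_measurable borel" by (rule loc_int_measurable[OF ih])
  have iR: "loc_int M (\<lambda>x. Re (h x))"
    unfolding loc_int_def using set_integral_Re_Im(3)[OF loc_intD[OF ih]] by simp
  define B where "B = {x. Re (h x) < 0}"
  have B: "B \<in> sets borel" unfolding B_def by measurable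
  have "AE x in M. indicator B x * Re (h x) = 0"
  proof (rule AE_from_intervals)
    fix n :: nat
    let ?I = "B \<inter> {- real n..<real n}"
    let ?f = "\<lambda>x. indicator ?I x *\<^sub>R Re (h x)"
    have i: "set_integrable M ?I h" "set_integrable N ?I (\<lambda>_. 1 :: complex)"
      using B locally_finiteD(1)[OF lM] locally_finiteD(1)[OF lN]
        set_integrable_subset[OF loc_intD[OF ih, of "- real n" "real n"], of ?I]
        set_integrable_subset[OF loc_intD[OF ig, of "- real n" "real n"], of ?I] by auto
    have "(LINT x:?I|M. h x) = (LINT x:?I|N. (1 :: complex))"
      by (rule set_integral_determined_by_intervals[OF lM ih lN ig local_measures_agree_on_intervals[OF r s] B])
    then have "(LINT x:?I|M. Re (h x)) = (LINT x:?I|N. 1)"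
      using set_integral_Re_Im(1)[OF i(1)] set_integral_Re_Im(1)[OF i(2)] by simp
    also have "\<dots> \<ge> 0" unfolding set_lebesgue_integral_def by (rule integral_nonneg_AE) simp
    finally have ge: "integral\<^sup>L M (\<lambda>x. - ?f x) \<le> 0" unfolding set_lebesgue_integral_def by simp
    have nn: "AE x in M. 0 \<le> - ?f x" by (rule AE_I2) (simp add: B_def indicator_def)
    have fi: "integrable M (\<lambda>x. - ?f x)" using set_integral_Re_Im(3)[OF i(1)] unfolding set_integrable_def by simp
    have "integral\<^sup>L M (\<lambda>x. - ?f x) = 0" using ge integral_nonneg_AE[OF nn] by linarith
    then have "AE x in M. - ?f x = 0" using integral_nonneg_eq_0_iff_AE[OF fi nn] by blast
    then show "AE x in M. x \<in> {- real n..<real n} \<longrightarrow> indicator B x * Re (h x) = 0"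
      by (rule eventually_mono) (auto simp: indicator_def split: if_splits)
  qed
  then have "AE x in M. Re (h x) \<ge> 0"
    by (rule eventually_mono) (auto simp: B_def indicator_def split: if_splits)
  moreover have "AE x in M. Im (h x) = 0" by (rule local_measure_real_AE[OF r s]) simp
  ultimately show ?thesis
  proof eventually_elim
    case (elim x)
    have "cmod (h x) = 1" using r by (simp add: local_measure_def)
    then have "\<bar>Re (h x)\<bar> = 1" using elim by (simp add: cmod_def)
    then show ?case using elim by (simp add: complex_eq_iff)
  qed
qed

text \<open>Periodicity concerns \<open>h\<close> times \<open>M\<close>, so it gives equality of
  the jumps \<open>atom M x * h x\<close> of a primitive of \<open>h\<close>. Taking moduli removes
  the phase.\<close>

lemma atom_periodic:
  assumes r: "local_measure r M h" and per: "periodic_dist \<omega> r"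
  shows "atom M x = atom M (x - \<omega>)"
proof -
  note lM = local_measure_locally_finite[OF r] and ih = local_measure_loc_int[OF r]
  obtain v where v: "prim M v h" by (rule prim_exists[OF ih]) (rule that)
  define X where "X n = x + 1 / real (Suc n)" for n
  define Y where "Y n = x - \<omega> + 1 / real (Suc n)" for n
  have l: "(\<lambda>n. c + 1 / real (Suc n)) \<longlonglongrightarrow> c" for c
    using tendsto_add[OF tendsto_const[of c] LIMSEQ_Suc[OF lim_const_over_n[of 1]]] by (simp only: add_0_right)
  have lim: "(\<lambda>n. v (c + 1 / real (Suc n))) \<longlonglongrightarrow> v c + of_real (atom M c) * h c" for c
  proof -
    have "(v \<circ> (\<lambda>n. c + 1 / real (Suc n))) \<longlonglongrightarrow> v c + of_real (atom M c) * h c"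
      using prim_right_limit[OF lM v, of c] l[of c] unfolding tendsto_at_iff_sequentially by simp
    then show ?thesis by (simp add: o_def)
  qed
  have "(\<lambda>n. v (X n) - v x) \<longlonglongrightarrow> v x + of_real (atom M x) * h x - v x"
    unfolding X_def by (intro tendsto_diff lim tendsto_const)
  moreover have "(\<lambda>n. v (Y n) - v (x - \<omega>)) \<longlonglongrightarrow> v (x - \<omega>) + of_real (atom M (x - \<omega>)) * h (x - \<omega>) - v (x - \<omega>)"
    unfolding Y_def by (intro tendsto_diff lim tendsto_const)
  moreover have "v (X n) - v x = v (Y n) - v (x - \<omega>)" for n
  proof -
    have "v (X n) - v x = (LINT t:{x..<X n}|M. h t)" by (rule primD[OF v]) (simp add: X_def)
    also have "\<dots> = (LINT t:{x - \<omega>..<X n - \<omega>}|M. h t)" by (rule local_measure_shift[OF r per])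
    also have "X n - \<omega> = Y n" by (simp add: X_def Y_def)
    also have "(LINT t:{x - \<omega>..<Y n}|M. h t) = v (Y n) - v (x - \<omega>)"
      by (rule primD[OF v, symmetric]) (simp add: Y_def)
    finally show ?thesis .
  qed
  ultimately have "v x + of_real (atom M x) * h x - v x = v (x - \<omega>) + of_real (atom M (x - \<omega>)) * h (x - \<omega>) - v (x - \<omega>)"
    using LIMSEQ_unique by (simp only:)
  then have "cmod (of_real (atom M x) * h x) = cmod (of_real (atom M (x - \<omega>)) * h (x - \<omega>))" by simp
  then show ?thesis using r atom_nonneg[of M] by (simp add: norm_mult local_measure_def)
qed

text \<open>Every point can be moved by multiples of the period into \<open>{0..\<omega>}\<close>,
  and the mass of this interval bounds all its atoms.\<close>

lemma atoms_bounded: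
  assumes r: "local_measure r M h" and per: "periodic_dist \<omega> r" and "\<omega> > 0"
  shows "\<exists>C. \<forall>x. atom M x \<le> C"
proof (intro exI allI)
  fix x
  note lM = local_measure_locally_finite[OF r]
  have nat: "atom M (x - real n * \<omega>) = atom M x" for n x
  proof (induction n)
    case (Suc n)
    have "x - real (Suc n) * \<omega> = (x - real n * \<omega>) - \<omega>" by (simp add: algebra_simps)
    moreover have "atom M (x - real n * \<omega> - \<omega>) = atom M (x - real n * \<omega>)"
      by (rule atom_periodic[OF r per, symmetric])
    ultimately show ?case using Suc by (simp only:)
  qed simp
  have int: "atom M (x - of_int k * \<omega>) = atom M x" for k
  proof (cases "k \<ge> 0")
    case True then show ?thesis using nat[of x "nat k"] by simp
  next
    case False then show ?thesis using nat[of "x - of_int k * \<omega>" "nat (- k)"] by simp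
  qed
  define k where "k = \<lfloor>x / \<omega>\<rfloor>"
  have "of_int k \<le> x / \<omega>" "x / \<omega> < of_int k + 1" unfolding k_def by linarith+
  then have "of_int k * \<omega> \<le> x" "x < (of_int k + 1) * \<omega>"
    using \<open>\<omega> > 0\<close> by (simp_all add: pos_le_divide_eq pos_divide_less_eq)
  then have "x - of_int k * \<omega> \<in> {0..\<omega>}" by (simp add: algebra_simps)
  then have "measure M {x - of_int k * \<omega>} \<le> measure M {0..\<omega>}"
    using locally_finiteD[OF lM] by (intro measure_mono_fmeasurable) (auto simp: fmeasurable_def)
  then show "atom M x \<le> measure M {0..\<omega>}" using int[of k] by (simp add: atom_def)
qed

text \<open>\<open>G\<close> is a distribution function of \<open>M\<close>. By periodicity its
  increment \<open>m\<close> over one period does not depend on the starting point. If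
  \<open>m\<close> were 0, then \<open>M\<close> and with it \<open>r\<close> would vanish;
  otherwise \<open>n\<close> periods in either direction carry the mass \<open>n m\<close>.\<close>

lemma mass_infinite:
  assumes r: "local_measure r M (\<lambda>_. 1)" and per: "periodic_dist \<omega> r" and \<omega>: "\<omega> > 0"
    and nz: "\<not> dist_eq r (\<lambda>_. 0)"
  shows "\<exists>b\<ge>c. K \<le> measure M {c..<b}" "\<exists>a\<le>c. K \<le> measure M {a..<c}"
proof -
  note lM = local_measure_locally_finite[OF r]
  note Md = locally_finiteD[OF lM]
  have I: "(LINT x:{a..<b}|M. (1::complex)) = of_real (measure M {a..<b})" for a b
    using Md by (simp add: set_lebesgue_integral_def scaleR_conv_of_real)
  obtain v where v: "prim M v (\<lambda>_. 1)" by (rule prim_exists[OF loc_int_const[OF lM]]) (rule that)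
  define G where "G x = Re (v x)" for x
  have G: "G b - G a = measure M {a..<b}" if "a \<le> b" for a b
  proof -
    have "Re (v b - v a) = Re (of_real (measure M {a..<b}))" using primD[OF v that] unfolding I by (simp only:)
    then show ?thesis by (simp add: G_def)
  qed
  have shift: "measure M {a..<b} = measure M {a - \<omega>..<b - \<omega>}" for a b
    using local_measure_shift[OF r per, of a b] unfolding I by (simp only: of_real_eq_iff)
  define m where "m = G \<omega> - G 0"
  have step: "G (s + \<omega>) - G s = m" for s
  proof -
    have 1: "G (t + \<omega>) - G (s + \<omega>) = G t - G s" if "s \<le> t" for s t
      using G[of "s + \<omega>" "t + \<omega>"] G[OF that] shift[of "s + \<omega>" "t + \<omega>"] that by simp
    show ?thesis using 1[of 0 s] 1[of s 0] by (cases "0 \<le> s") (simp_all add: m_def)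
  qed
  have steps: "G (s + real n * \<omega>) = G s + real n * m" for s n
  proof (induction n)
    case (Suc n)
    have "s + real (Suc n) * \<omega> = s + real n * \<omega> + \<omega>" by (simp add: algebra_simps)
    then show ?case using step[of "s + real n * \<omega>"] Suc by (simp add: algebra_simps)
  qed simp
  have "m > 0"
  proof (rule ccontr)
    assume "\<not> m > 0"
    moreover have "m \<ge> 0" using G[of 0 \<omega>] \<omega> by (simp add: m_def)
    ultimately have m: "m = 0" by simp
    have zero: "measure M {a..<b} = 0" for a b
    proof (cases "a \<le> b")
      case True
      obtain n :: nat where n: "(b - a) / \<omega> \<le> real n" using real_arch_simple by blast
      then have "b \<le> a + real n * \<omega>" using \<omega> by (simp add: pos_divide_le_eq)
      then have "G (a + real n * \<omega>) - G b = measure M {b..<a + real n * \<omega>}" by (rule G)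
      moreover have "G (a + real n * \<omega>) = G a" using steps[of a n] m by simp
      ultimately show ?thesis using G[OF True] measure_nonneg[of M "{a..<b}"]
          measure_nonneg[of M "{b..<a + real n * \<omega>}"] by linarith
    qed simp
    have "emeasure M UNIV = 0"
    proof -
      have e: "emeasure M {- real n..<real n} = 0" for n :: nat
        using zero[of "- real n" "real n"] Md(4)[of "- real n" "real n"]
        by (auto simp: measure_def enn2real_eq_0_iff)
      have "(\<Union>n::nat. {- real n..<real n}) = (UNIV :: real set)"
      proof (rule UNIV_eq_I[symmetric])
        fix x :: real
        obtain n :: nat where "\<bar>x\<bar> < real n" using reals_Archimedean2 by blast
        then show "x \<in> (\<Union>n::nat. {- real n..<real n})" by (intro UN_I[of n]) auto
      qed
      moreover have "emeasure M (\<Union>n::nat. {- real n..<real n}) = 0"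
        by (rule emeasure_UN_eq_0) (use e Md(1) in auto)
      ultimately show ?thesis by simp
    qed
    then have AE: "AE x in M. Q x" for Q
      by (intro AE_I[of _ _ UNIV]) (use Md in auto)
    have "r \<phi> = 0" if "test_fun \<phi>" for \<phi>
    proof -
      have "r \<phi> = (\<integral>x. \<phi> x * 1 \<partial>M)" using r that by (simp add: local_measure_def)
      also have "\<dots> = (\<integral>x. 0 \<partial>M)"
        by (rule integral_cong_AE) (use test_fun_borel[OF that] Md AE in auto)
      finally show ?thesis by simp
    qed
    then show False using nz by (simp add: dist_eq_def)
  qed
  obtain n :: nat where n: "K / m \<le> real n" using real_arch_simple by blast
  then have Kn: "K \<le> real n * m" using \<open>m > 0\<close> by (simp add: pos_divide_le_eq)
  have "G (c + real n * \<omega>) - G c = measure M {c..<c + real n * \<omega>}" using \<omega> by (intro G) simp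
  then show "\<exists>b\<ge>c. K \<le> measure M {c..<b}"
    using Kn steps[of c n] \<omega> by (intro exI[of _ "c + real n * \<omega>"]) simp
  have "G c - G (c - real n * \<omega>) = measure M {c - real n * \<omega>..<c}" using \<omega> by (intro G) simp
  then show "\<exists>a\<le>c. K \<le> measure M {a..<c}"
    using Kn steps[of "c - real n * \<omega>" n] \<omega> by (intro exI[of _ "c - real n * \<omega>"]) simp
qed

section \<open>A common dominating measure\<close>

definition sum_measure :: "real measure \<Rightarrow> real measure \<Rightarrow> real measure" where
  "sum_measure M N = measure_of UNIV (sets borel) (\<lambda>A. emeasure M A + emeasure N A)"

lemma sum_measure:
  assumes M: "sets M = sets borel" and N: "sets N = sets borel"
  shows "sets (sum_measure M N) = sets borel"
    "A \<in> sets borel \<Longrightarrow> emeasure (sum_measure M N) A = emeasure M A + emeasure N A"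
proof -
  show "sets (sum_measure M N) = sets borel"
    unfolding sum_measure_def using sets.sigma_sets_eq[of "borel :: real measure"] by (simp add: sets_measure_of_conv)
  assume A: "A \<in> sets borel"
  show "emeasure (sum_measure M N) A = emeasure M A + emeasure N A"
    unfolding sum_measure_def
  proof (rule emeasure_measure_of_sigma[OF _ _ _ A])
    show "sigma_algebra UNIV (sets (borel :: real measure))"
      using sets.sigma_algebra_axioms[of "borel :: real measure"] by simp
    show "positive (sets borel) (\<lambda>A. emeasure M A + emeasure N A)"
      by (simp add: positive_def)
    show "countably_additive (sets borel) (\<lambda>A. emeasure M A + emeasure N A)"
    proof (rule countably_additiveI)
      fix A :: "nat \<Rightarrow> real set" assume A: "range A \<subseteq> sets borel" "disjoint_family A"
      have "(\<Sum>i. emeasure M (A i) + emeasure N (A i)) = (\<Sum>i. emeasure M (A i)) + (\<Sum>i. emeasure N (A i))"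
        by (intro suminf_add[symmetric] summableI)
      then show "(\<Sum>i. emeasure M (A i) + emeasure N (A i)) = emeasure M (\<Union>i. A i) + emeasure N (\<Union>i. A i)"
        using A M N by (simp add: suminf_emeasure)
    qed
  qed
qed

lemma sum_measure_locally_finite:
  assumes "locally_finite M" "locally_finite N" shows "locally_finite (sum_measure M N)"
proof -
  have "emeasure (sum_measure M N) {a..b} < \<infinity>" for a b
    using locally_finiteD(1,3)[OF assms(1)] locally_finiteD(1,3)[OF assms(2)]
    by (subst sum_measure(2)) (auto simp: ennreal_add_less_top)
  then show ?thesis using sum_measure(1) locally_finiteD(1)[OF assms(1)] locally_finiteD(1)[OF assms(2)]
    by (simp add: locally_finite_def)
qed

text \<open>The two Radon-Nikodym derivatives add up to 1 almost everywhere, so each is at most 1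
  almost everywhere. Truncating at 1 makes the bounds hold at every point, as \<open>system\<close>
  requires.\<close>

lemma densities_exist:
  assumes lM: "locally_finite M" and lN: "locally_finite N"
  obtains f g :: "real \<Rightarrow> real" where
    "M = density (sum_measure M N) (\<lambda>x. ennreal (f x))" "N = density (sum_measure M N) (\<lambda>x. ennreal (g x))"
    "f \<in> borel_measurable borel" "g \<in> borel_measurable borel"
    "\<And>x. 0 \<le> f x" "\<And>x. f x \<le> 1" "\<And>x. 0 \<le> g x" "\<And>x. g x \<le> 1"
proof -
  define P where "P = sum_measure M N"
  note Ms = locally_finiteD(1)[OF lM] and Ns = locally_finiteD(1)[OF lN]
  have lP: "locally_finite P" unfolding P_def by (rule sum_measure_locally_finite[OF lM lN])
  note Pd = locally_finiteD[OF lP]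
  interpret sigma_finite_measure P by (rule locally_finite_sigma_finite[OF lP])
  have eP: "emeasure P A = emeasure M A + emeasure N A" if "A \<in> sets borel" for A
    unfolding P_def by (rule sum_measure(2)[OF Ms Ns that])
  have "absolutely_continuous P M" "absolutely_continuous P N"
    unfolding absolutely_continuous_def null_sets_def using Pd(1) Ms Ns eP by auto
  then obtain F G where F: "F \<in> borel_measurable P" "density P F = M" and G: "G \<in> borel_measurable P" "density P G = N"
    using Radon_Nikodym Pd(1) Ms Ns by metis
  have "density P (\<lambda>x. F x + G x) = density P (\<lambda>x. 1)"
  proof (rule measure_eqI)
    fix A assume "A \<in> sets (density P (\<lambda>x. F x + G x))"
    then have A: "A \<in> sets P" by simp
    have "emeasure (density P (\<lambda>x. F x + G x)) A = (\<integral>\<^sup>+x. F x * indicator A x + G x * indicator A x \<partial>P)"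
      using F G A by (subst emeasure_density) (auto simp: distrib_right)
    also have "\<dots> = (\<integral>\<^sup>+x. F x * indicator A x \<partial>P) + (\<integral>\<^sup>+x. G x * indicator A x \<partial>P)"
      using F(1) G(1) A by (intro nn_integral_add) auto
    also have "\<dots> = emeasure M A + emeasure N A"
      using F(1) G(1) A by (subst F(2)[symmetric], subst G(2)[symmetric]) (simp add: emeasure_density)
    also have "\<dots> = emeasure P A" using A Pd(1) eP by simp
    also have "\<dots> = emeasure (density P (\<lambda>x. 1)) A" using A by (simp add: emeasure_density)
    finally show "emeasure (density P (\<lambda>x. F x + G x)) A = emeasure (density P (\<lambda>x. 1)) A" .
  qed simp
  then have ae: "AE x in P. F x + G x = 1"
    using F(1) G(1) by (intro density_unique) auto
  have *: "H = density P (\<lambda>x. ennreal (enn2real (min (h x) 1)))"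
    if "density P h = H" "h \<in> borel_measurable P" "AE x in P. h x \<le> 1" for H h
  proof -
    have "density P h = density P (\<lambda>x. ennreal (enn2real (min (h x) 1)))"
    proof (rule density_cong)
      show "AE x in P. h x = ennreal (enn2real (min (h x) 1))"
        using that(3)
      proof eventually_elim
        case (elim x)
        then have "min (h x) 1 = h x" "h x < top" by (auto simp: min_def intro: order_le_less_trans)
        then show ?case by simp
      qed
    qed (use that(2) in auto)
    then show ?thesis using that(1) by simp
  qed
  have le1: "enn2real (min y 1) \<le> 1" for y :: ennreal
    using enn2real_mono[of "min y 1" 1] by simp
  have "AE x in P. F x \<le> 1" "AE x in P. G x \<le> 1"
    using ae by (eventually_elim, metis add.commute le_iff_add)+
  note FG = *[OF F(2,1) this(1)] *[OF G(2,1) this(2)]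
  have m: "(\<lambda>x. enn2real (min (F x) 1)) \<in> borel_measurable borel" "(\<lambda>x. enn2real (min (G x) 1)) \<in> borel_measurable borel"
    using F(1) G(1) unfolding Pd(6) by measurable
  show thesis
    by (rule that[OF FG[unfolded P_def] m[unfolded P_def] _ le1 _ le1]) auto
qed

lemma integral_real_density':
  fixes f :: "real \<Rightarrow> 'b::{banach, second_countable_topology}"
  assumes P: "sets P = sets borel" and g: "g \<in> borel_measurable borel" "\<And>x. 0 \<le> g x" and f: "f \<in> borel_measurable borel"
  shows "integral\<^sup>L (density P (\<lambda>x. ennreal (g x))) f = (\<integral>x. g x *\<^sub>R f x \<partial>P)"
    and "integrable (density P (\<lambda>x. ennreal (g x))) f \<longleftrightarrow> integrable P (\<lambda>x. g x *\<^sub>R f x)"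
proof -
  have m: "g \<in> borel_measurable P" "f \<in> borel_measurable P"
    using f g measurable_cong_sets[OF P refl] by auto
  show "integral\<^sup>L (density P (\<lambda>x. ennreal (g x))) f = (\<integral>x. g x *\<^sub>R f x \<partial>P)"
    "integrable (density P (\<lambda>x. ennreal (g x))) f \<longleftrightarrow> integrable P (\<lambda>x. g x *\<^sub>R f x)"
    using integral_density[of f P g] integrable_density[of f P g] m g(2) by auto
qed

section \<open>Functions of locally bounded variation\<close>

lemma eventually_at_left_open:
  "eventually Q (at_left (x::real)) \<Longrightarrow> eventually (\<lambda>y. eventually Q (at y)) (at_left x)"
proof -
  assume "eventually Q (at_left x)"
  then obtain b where b: "b < x" "\<And>y. b < y \<Longrightarrow> y < x \<Longrightarrow> Q y" unfolding eventually_at_left_field by blast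
  have "eventually Q (at y)" if "b < y" "y < x" for y
    by (rule eventually_at_in_open'[THEN eventually_mono, of "{b<..<x}"]) (use that b in auto)
  then show ?thesis using b(1) unfolding eventually_at_left_field by blast
qed

lemma eventually_at_right_open:
  "eventually Q (at_right (x::real)) \<Longrightarrow> eventually (\<lambda>y. eventually Q (at y)) (at_right x)"
proof -
  assume "eventually Q (at_right x)"
  then obtain b where b: "b > x" "\<And>y. x < y \<Longrightarrow> y < b \<Longrightarrow> Q y" unfolding eventually_at_right_field by blast
  have "eventually Q (at y)" if "x < y" "y < b" for y
    by (rule eventually_at_in_open'[THEN eventually_mono, of "{x<..<b}"]) (use that b in auto)
  then show ?thesis using b(1) unfolding eventually_at_right_field by blast
qed

text \<open>When \<open>y\<close> is close to the limit point, \<open>u\<close> is close to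
  \<open>l\<close> on a punctured neighbourhood of \<open>y\<close>, hence so is any one-sided limit
  of \<open>u\<close> at \<open>y\<close>. Thus the functions of left and of right limits inherit
  the one-sided limits of \<open>u\<close>.\<close>

lemma tendsto_one_sided_limits:
  fixes u r :: "real \<Rightarrow> complex"
  assumes u: "(u \<longlongrightarrow> l) F" and r: "\<And>y. (u \<longlongrightarrow> r y) (at_left y) \<or> (u \<longlongrightarrow> r y) (at_right y)"
    and F: "\<And>Q. eventually Q F \<Longrightarrow> eventually (\<lambda>y. eventually Q (at y)) F"
  shows "(r \<longlongrightarrow> l) F"
proof (rule tendstoI)
  fix e :: real assume e: "e > 0"
  have "eventually (\<lambda>y. dist (u y) l < e / 2) F" using u e by (intro tendstoD) auto
  from F[OF this] show "eventually (\<lambda>y. dist (r y) l < e) F"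
  proof (rule eventually_mono)
    fix y assume y: "eventually (\<lambda>y. dist (u y) l < e / 2) (at y)"
    have "dist (r y) l \<le> e / 2"
    proof -
      obtain G where G: "(u \<longlongrightarrow> r y) G" "G \<le> at y" "G \<noteq> bot"
        using r[of y] by (metis at_le subset_UNIV trivial_limit_at_left_real trivial_limit_at_right_real)
      have "eventually (\<lambda>y. dist (u y) l \<le> e / 2) G"
        using filter_leD[OF G(2) y] by (rule eventually_mono) simp
      then show ?thesis by (rule tendsto_upperbound[OF tendsto_dist[OF G(1) tendsto_const] _ G(3)])
    qed
    then show "dist (r y) l < e" using e by linarith
  qed
qed

lemma bv_loc_loc_bounded:
  assumes "bv_loc u" shows "loc_bounded u"
  unfolding loc_bounded_def
proof (intro allI)
  fix a b :: real
  obtain B where B: "\<And>n (t :: nat \<Rightarrow> real). mono t \<Longrightarrow> range t \<subseteq> {a..b} \<Longrightarrow>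
     (\<Sum>i<n. cmod (u (t (Suc i)) - u (t i))) \<le> B"
    using assms unfolding bv_loc_def by metis
  have "norm (u x) \<le> cmod (u a) + B" if x: "x \<in> {a..b}" for x
  proof -
    define t where "t i = (if i = 0 then a else x)" for i :: nat
    have "mono t" unfolding mono_def t_def using x by auto
    moreover have "range t \<subseteq> {a..b}" unfolding t_def using x by auto
    ultimately have "(\<Sum>i<1. cmod (u (t (Suc i)) - u (t i))) \<le> B" by (rule B)
    then have "cmod (u x - u a) \<le> B" by (simp add: t_def)
    then show ?thesis using norm_triangle_ineq2[of "u x" "u a"] by linarith
  qed
  then show "\<exists>B. \<forall>x\<in>{a..b}. norm (u x) \<le> B" by blast
qed

lemma balanced_one_sided:
  assumes "balanced u"
  obtains v r where "\<And>x. (u \<longlongrightarrow> v x) (at_left x)" "\<And>x. (u \<longlongrightarrow> r x) (at_right x)" "\<And>x. u x = (r x + v x) / 2"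
    "\<And>x. (v \<longlongrightarrow> v x) (at_left x)" "\<And>x. (v \<longlongrightarrow> r x) (at_right x)" "u \<in> borel_measurable borel"
proof -
  have "\<forall>x. \<exists>p. (u \<longlongrightarrow> fst p) (at_right x) \<and> (u \<longlongrightarrow> snd p) (at_left x) \<and> u x = (fst p + snd p) / 2"
    using assms unfolding balanced_def by auto
  then obtain p where p: "\<And>x. (u \<longlongrightarrow> fst (p x)) (at_right x)" "\<And>x. (u \<longlongrightarrow> snd (p x)) (at_left x)"
    "\<And>x. u x = (fst (p x) + snd (p x)) / 2" by metis
  define v where "v x = snd (p x)" for x
  define r where "r x = fst (p x)" for x
  have l: "\<And>x. (u \<longlongrightarrow> v x) (at_left x)" and r: "\<And>x. (u \<longlongrightarrow> r x) (at_right x)" and ub: "\<And>x. u x = (r x + v x) / 2"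
    using p by (simp_all add: v_def r_def)
  have vv: "(v \<longlongrightarrow> v x) (at_left x)" for x
    by (rule tendsto_one_sided_limits[OF l _ eventually_at_left_open]) (use l in blast)
  have vr: "(v \<longlongrightarrow> r x) (at_right x)" for x
    by (rule tendsto_one_sided_limits[OF r _ eventually_at_right_open]) (use l in blast)
  have [measurable]: "v \<in> borel_measurable borel" by (rule left_continuous_borel[OF vv])
  then have [measurable]: "r \<in> borel_measurable borel" by (rule right_limits_borel[OF _ vr])
  have "(\<lambda>x. (r x + v x) / 2) \<in> borel_measurable borel" by measurable
  then have "u \<in> borel_measurable borel" unfolding ub[symmetric] .
  with l r ub vv vr show thesis by (rule that)
qed

lemma bal_balanced:
  assumes P: "locally_finite P" and p: "prim P v d"
  shows "balanced (bal P v d)"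
  unfolding balanced_def
proof (intro allI exI conjI)
  fix x
  define r where "r x = v x + of_real (atom P x) * d x" for x
  have vr: "(v \<longlongrightarrow> r x) (at_right x)" for x unfolding r_def by (rule prim_right_limit[OF P p])
  have vl: "(v \<longlongrightarrow> v x) (at_left x)" for x by (rule prim_left_cont[OF P p])
  have rl: "(r \<longlongrightarrow> v x) (at_left x)"
    by (rule tendsto_one_sided_limits[OF vl _ eventually_at_left_open]) (use vr in blast)
  have rr: "(r \<longlongrightarrow> r x) (at_right x)"
    by (rule tendsto_one_sided_limits[OF vr _ eventually_at_right_open]) (use vr in blast)
  have eq: "bal P v d = (\<lambda>x. (v x + r x) / 2)" by (simp add: fun_eq_iff bal_def r_def add_divide_distrib)
  have "((\<lambda>x. (v x + r x) / 2) \<longlongrightarrow> (r x + r x) / 2) (at_right x)" by (intro tendsto_intros vr rr) simp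
  then show "(bal P v d \<longlongrightarrow> r x) (at_right x)" unfolding eq by simp
  have "((\<lambda>x. (v x + r x) / 2) \<longlongrightarrow> (v x + v x) / 2) (at_left x)" by (intro tendsto_intros vl rl) simp
  then show "(bal P v d \<longlongrightarrow> v x) (at_left x)" unfolding eq by simp
  show "bal P v d x = (r x + v x) / 2" unfolding eq by (simp add: add.commute)
qed

text \<open>Increments of \<open>v\<close> are dominated by those of a primitive \<open>N\<close> of
  \<open>|d|\<close>. Passing to right limits and averaging gives the same for the balanced function
  with a non-decreasing majorant \<open>B\<close>, whose increments telescope.\<close>

lemma bal_bv_loc:
  assumes P: "locally_finite P" and p: "prim P v d"
  shows "bv_loc (bal P v d)"
proof -
  have "loc_int P (\<lambda>x. complex_of_real (cmod (d x)))"
    unfolding loc_int_of_real_iff by (rule loc_int_norm[OF prim_loc_int[OF p]])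
  then obtain N where N: "prim P N (\<lambda>x. complex_of_real (cmod (d x)))" by (rule prim_exists) (rule that)
  have le: "cmod (v t - v s) \<le> Re (N t) - Re (N s)" if "s \<le> t" for s t
  proof -
    have "cmod (v t - v s) \<le> (LINT x:{s..<t}|P. cmod (d x))" by (rule prim_norm_diff_le[OF p that])
    also have "\<dots> = Re (of_real (LINT x:{s..<t}|P. cmod (d x)))" by simp
    also have "of_real (LINT x:{s..<t}|P. cmod (d x)) = N t - N s"
      using primD[OF N that] by (simp add: set_integral_complex_of_real)
    finally show ?thesis by simp
  qed
  have seq: "(\<lambda>n. c + 1 / real (Suc n)) \<longlonglongrightarrow> c" for c
    using tendsto_add[OF tendsto_const[of c] LIMSEQ_Suc[OF lim_const_over_n[of 1]]] by (simp only: add_0_right)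
  have lim: "(\<lambda>n. y (c + 1 / real (Suc n))) \<longlonglongrightarrow> y c + of_real (atom P c) * e c" if "prim P y e" for y e c
  proof -
    have "(y \<circ> (\<lambda>n. c + 1 / real (Suc n))) \<longlonglongrightarrow> y c + of_real (atom P c) * e c"
      using prim_right_limit[OF P that, of c] seq[of c] unfolding tendsto_at_iff_sequentially by simp
    then show ?thesis by (simp add: o_def)
  qed
  define r where "r x = v x + of_real (atom P x) * d x" for x
  define R where "R x = N x + of_real (atom P x) * complex_of_real (cmod (d x))" for x
  have le': "cmod (r t - r s) \<le> Re (R t) - Re (R s)" if "s \<le> t" for s t
  proof (rule tendsto_le)
    show "(\<lambda>n. cmod (v (t + 1 / real (Suc n)) - v (s + 1 / real (Suc n)))) \<longlonglongrightarrow> cmod (r t - r s)"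
      unfolding r_def by (intro tendsto_norm tendsto_diff lim[OF p])
    show "(\<lambda>n. Re (N (t + 1 / real (Suc n))) - Re (N (s + 1 / real (Suc n)))) \<longlonglongrightarrow> Re (R t) - Re (R s)"
      unfolding R_def by (intro tendsto_Re tendsto_diff lim[OF N])
    show "eventually (\<lambda>n. cmod (v (t + 1 / real (Suc n)) - v (s + 1 / real (Suc n))) \<le> Re (N (t + 1 / real (Suc n))) - Re (N (s + 1 / real (Suc n)))) sequentially"
      by (intro always_eventually allI le) (use that in simp)
  qed simp
  define B where "B x = (Re (N x) + Re (R x)) / 2" for x
  have ble: "cmod (bal P v d t - bal P v d s) \<le> B t - B s" if "s \<le> t" for s t
  proof -
    have "bal P v d t - bal P v d s = ((v t - v s) + (r t - r s)) / 2"
      by (simp add: bal_def r_def field_simps)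
    then have "cmod (bal P v d t - bal P v d s) = cmod ((v t - v s) + (r t - r s)) / 2"
      by (simp only: norm_divide norm_numeral)
    then have "cmod (bal P v d t - bal P v d s) \<le> (cmod (v t - v s) + cmod (r t - r s)) / 2"
      using norm_triangle_ineq[of "v t - v s" "r t - r s"] by simp
    then show ?thesis using le[OF that] le'[OF that] by (simp add: B_def field_simps)
  qed
  have Bmono: "B s \<le> B t" if "s \<le> t" for s t
    using order_trans[OF norm_ge_zero ble[OF that]] by simp
  show ?thesis unfolding bv_loc_def
  proof (intro allI exI impI)
    fix a b and n and t :: "nat \<Rightarrow> real"
    assume t: "mono t" "range t \<subseteq> {a..b}"
    have "(\<Sum>i<n. cmod (bal P v d (t (Suc i)) - bal P v d (t i))) \<le> (\<Sum>i<n. B (t (Suc i)) - B (t i))"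
      by (intro sum_mono ble monoD[OF t(1)]) simp
    also have "\<dots> = B (t n) - B (t 0)" by (rule sum_lessThan_telescope)
    also have "\<dots> \<le> B b - B a"
      using Bmono[of "t n" b] Bmono[of a "t 0"] t(2) by (auto simp: image_subset_iff)
    finally show "(\<Sum>i<n. cmod (bal P v d (t (Suc i)) - bal P v d (t i))) \<le> B b - B a" .
  qed
qed

lemma lborel_locally_finite: "locally_finite lborel"
  by (simp add: locally_finite_def emeasure_lborel_Icc_eq)

lemma test_fun_prim:
  assumes "test_fun \<phi>"
  obtains \<phi>' where "prim lborel \<phi> \<phi>'" "\<And>x. vector_derivative \<phi> (at x) = \<phi>' x" "test_fun \<phi>'"
proof -
  obtain \<phi>' where d: "test_fun \<phi>'" "\<And>x. (\<phi> has_vector_derivative \<phi>' x) (at x)"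
    by (rule test_fun_deriv[OF assms]) (rule that)
  have c: "continuous_on A \<phi>'" for A by (rule test_fun_continuous[OF d(1)])
  obtain B where B: "\<And>x. cmod (\<phi>' x) \<le> B" by (rule test_fun_bounded[OF d(1)]) (rule that)
  have li: "loc_int lborel \<phi>'"
    by (rule loc_int_loc_bounded[OF lborel_locally_finite test_fun_borel[OF d(1)]])
       (use B in \<open>auto simp: loc_bounded_def\<close>)
  have "\<phi> b - \<phi> a = (LINT x:{a..<b}|lborel. \<phi>' x)" if "a \<le> b" for a b
  proof -
    have "(\<integral>x. indicator {a..b} x *\<^sub>R \<phi>' x \<partial>lborel) = \<phi> b - \<phi> a"
      by (rule integral_FTC_atLeastAtMost[OF that _ c])
         (use d(2) in \<open>auto intro: has_vector_derivative_at_within\<close>)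
    moreover have "(LINT x:{a..<b}|lborel. \<phi>' x) = (\<integral>x. indicator {a..b} x *\<^sub>R \<phi>' x \<partial>lborel)"
      unfolding set_lebesgue_integral_def
    proof (rule integral_cong_AE)
      have "AE x in lborel. x \<noteq> b" by (rule AE_lborel_singleton)
      then show "AE x in lborel. indicator {a..<b} x *\<^sub>R \<phi>' x = indicator {a..b} x *\<^sub>R \<phi>' x"
        by (rule eventually_mono) (auto simp: indicator_def)
    qed (use test_fun_borel[OF d(1)] in measurable)
    ultimately show ?thesis by simp
  qed
  then have "prim lborel \<phi> \<phi>'" using li by (simp add: prim_def)
  moreover have "vector_derivative \<phi> (at x) = \<phi>' x" for x by (rule vector_derivative_at[OF d(2)])
  ultimately show thesis using d(1) by (rule that)
qed

lemma atom_lborel: "atom lborel x = 0"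
  by (simp add: atom_def)

text \<open>Integrating by parts in both orders gives the identity for the left limits and for the right
  limits of \<open>u\<close>; their average is the claim.\<close>

lemma bal_integrate_by_parts:
  assumes P: "locally_finite P" and p: "prim P v d" and \<phi>: "test_fun \<phi>"
  shows "(\<integral>x. bal P v d x * vector_derivative \<phi> (at x) \<partial>lborel) = - (\<integral>x. \<phi> x * d x \<partial>P)"
proof -
  obtain \<phi>' where f: "prim lborel \<phi> \<phi>'" "\<And>x. vector_derivative \<phi> (at x) = \<phi>' x" "test_fun \<phi>'"
    by (rule test_fun_prim[OF \<phi>]) (rule that)
  obtain a1 b1 where ab1: "a1 < b1" "\<And>x. x \<notin> {a1<..<b1} \<Longrightarrow> \<phi> x = 0" by (rule test_fun_support[OF \<phi>]) (rule that)
  obtain a2 b2 where ab2: "a2 < b2" "\<And>x. x \<notin> {a2<..<b2} \<Longrightarrow> \<phi>' x = 0" by (rule test_fun_support[OF f(3)]) (rule that)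
  define a where "a = min a1 a2"
  define b where "b = max b1 b2"
  have ab: "a \<le> b" using ab1(1) by (simp add: a_def b_def)
  have z: "\<phi> x = 0" "\<phi>' x = 0" if "x \<notin> {a..<b} \<or> x = a" for x
  proof -
    have "x \<notin> {a1<..<b1}" "x \<notin> {a2<..<b2}" using that by (auto simp: a_def b_def)
    then show "\<phi> x = 0" "\<phi>' x = 0" using ab1(2) ab2(2) by blast+
  qed
  have zb: "\<phi> a = 0" "\<phi> b = 0" using z by auto
  have set: "(LINT x:{a..<b}|M. F x) = integral\<^sup>L M F" if "\<And>x. x \<notin> {a..<b} \<Longrightarrow> F x = 0" for M and F :: "real \<Rightarrow> complex"
    unfolding set_lebesgue_integral_def
    by (rule Bochner_Integration.integral_cong[OF refl]) (use that in \<open>auto simp: indicator_def\<close>)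
  let ?r = "\<lambda>x. v x + of_real (atom P x) * d x"
  have s1: "(LINT x:{a..<b}|P. \<phi> x * d x) = (\<integral>x. \<phi> x * d x \<partial>P)"
    and s2: "(LINT x:{a..<b}|lborel. v x * \<phi>' x) = (\<integral>x. v x * \<phi>' x \<partial>lborel)"
    and s3: "(LINT x:{a..<b}|lborel. ?r x * \<phi>' x) = (\<integral>x. ?r x * \<phi>' x \<partial>lborel)"
    using z by (auto intro!: set)
  \<comment> \<open>In \<open>prim_mult_integral\<close> the first factor enters with its left
    limits and the second with its right limits. As \<open>lborel\<close> has no atoms, only the
    position of \<open>v\<close> matters.\<close>
  have 1: "0 = (\<integral>x. \<phi> x * d x \<partial>P) + (\<integral>x. v x * \<phi>' x \<partial>lborel)"
    using prim_mult_integral[OF P lborel_locally_finite p f(1) ab] zb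
    by (simp only: atom_lborel s1 s2 of_real_0 mult_zero_left mult_zero_right add_0_right diff_zero)
  have 2: "0 = (\<integral>x. ?r x * \<phi>' x \<partial>lborel) + (\<integral>x. \<phi> x * d x \<partial>P)"
    using prim_mult_integral[OF lborel_locally_finite P f(1) p ab] zb
    by (simp only: s1 s3 mult_zero_left mult_zero_right add_0_right diff_zero)
  have vb: "v \<in> borel_measurable borel" "loc_bounded v"
    by (rule prim_borel[OF P p], rule prim_loc_bounded[OF P p])
  have bb: "bal P v d \<in> borel_measurable borel" "loc_bounded (bal P v d)"
    by (rule bal_borel[OF P p], rule bal_loc_bounded[OF P p])
  have i: "integrable lborel (\<lambda>x. y x * \<phi>' x)" if "y \<in> borel_measurable borel" "loc_bounded y" for y
  proof -
    have "loc_int lborel (\<lambda>x. y x * \<phi>' x)"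
      by (rule loc_int_mult[OF lborel_locally_finite prim_loc_int[OF f(1)] that])
    from loc_intD[OF this, of a b] have "integrable lborel (\<lambda>x. indicator {a..<b} x *\<^sub>R (y x * \<phi>' x))"
      unfolding set_integrable_def .
    moreover have "(\<lambda>x. indicator {a..<b} x *\<^sub>R (y x * \<phi>' x)) = (\<lambda>x. y x * \<phi>' x)"
    proof
      show "indicator {a..<b} x *\<^sub>R (y x * \<phi>' x) = y x * \<phi>' x" for x
        using z(2)[of x] by (cases "x \<in> {a..<b}") auto
    qed
    ultimately show ?thesis by simp
  qed
  have "(\<integral>x. ?r x * \<phi>' x \<partial>lborel) = (\<integral>x. 2 * (bal P v d x * \<phi>' x) - v x * \<phi>' x \<partial>lborel)"
    by (rule Bochner_Integration.integral_cong[OF refl]) (simp add: bal_def field_simps)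
  also have "\<dots> = (\<integral>x. 2 * (bal P v d x * \<phi>' x) \<partial>lborel) - (\<integral>x. v x * \<phi>' x \<partial>lborel)"
    by (rule Bochner_Integration.integral_diff[OF integrable_mult_right[OF i[OF bb]] i[OF vb]])
  also have "\<dots> = 2 * (\<integral>x. bal P v d x * \<phi>' x \<partial>lborel) - (\<integral>x. v x * \<phi>' x \<partial>lborel)" by simp
  finally have "(\<integral>x. ?r x * \<phi>' x \<partial>lborel) + (\<integral>x. v x * \<phi>' x \<partial>lborel) = 2 * (\<integral>x. bal P v d x * \<phi>' x \<partial>lborel)"
    by (simp only: diff_add_cancel)
  moreover have "(\<integral>x. ?r x * \<phi>' x \<partial>lborel) = - (\<integral>x. \<phi> x * d x \<partial>P)"
    using 2 by (simp only: eq_neg_iff_add_eq_0)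
  moreover have "(\<integral>x. v x * \<phi>' x \<partial>lborel) = - (\<integral>x. \<phi> x * d x \<partial>P)"
    using 1 by (simp only: eq_neg_iff_add_eq_0 add.commute)
  ultimately show ?thesis unfolding f(2) by simp
qed

text \<open>Testing with the approximants of \<open>{a..<b}\<close> yields the increments of the
  left limits \<open>v\<close>. The right limits are then those of a primitive, and the balance
  condition identifies \<open>u\<close> with \<open>bal P v d\<close>.\<close>

lemma balanced_prim:
  assumes P: "locally_finite P" and u: "bv_loc u" "balanced u" and d: "loc_int P d"
    and eq: "\<And>\<phi>. test_fun \<phi> \<Longrightarrow> (\<integral>x. u x * vector_derivative \<phi> (at x) \<partial>lborel) = - (\<integral>x. \<phi> x * d x \<partial>P)"
  obtains v where "prim P v d" "u = bal P v d"
proof -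
  obtain v r where v: "\<And>x. (u \<longlongrightarrow> v x) (at_left x)" "\<And>x. (u \<longlongrightarrow> r x) (at_right x)" "\<And>x. u x = (r x + v x) / 2"
    "\<And>x. (v \<longlongrightarrow> v x) (at_left x)" "\<And>x. (v \<longlongrightarrow> r x) (at_right x)" "u \<in> borel_measurable borel"
    by (rule balanced_one_sided[OF u(2)]) (rule that)
  have "v b - v a = (LINT x:{a..<b}|P. d x)" if "a \<le> b" for a b
  proof (cases "a = b")
    case False
    then have "a < b" using that by simp
    obtain \<phi> :: "nat \<Rightarrow> real \<Rightarrow> complex" where \<phi>: "\<And>n. test_fun (\<phi> n)"
      "\<And>n x. cmod (\<phi> n x) \<le> indicator {a - 1..b} x" "\<And>x. (\<lambda>n. \<phi> n x) \<longlonglongrightarrow> indicator {a..<b} x"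
      "\<forall>u la lb B. u \<in> borel_measurable borel \<longrightarrow> (\<forall>x\<in>{a - 1..b}. cmod (u x) \<le> B) \<longrightarrow>
       (u \<longlongrightarrow> la) (at_left a) \<longrightarrow> (u \<longlongrightarrow> lb) (at_left b) \<longrightarrow>
       (\<lambda>n. \<integral>x. u x * vector_derivative (\<phi> n) (at x) \<partial>lborel) \<longlonglongrightarrow> la - lb"
      by (rule interval_test_funs[OF \<open>a < b\<close>]) (rule that)
    obtain B where B: "\<forall>x\<in>{a - 1..b}. cmod (u x) \<le> B"
      using bv_loc_loc_bounded[OF u(1)] unfolding loc_bounded_def by metis
    have "(\<lambda>n. \<integral>x. u x * vector_derivative (\<phi> n) (at x) \<partial>lborel) \<longlonglongrightarrow> v a - v b"
      using \<phi>(4) v(6) B v(1)[of a] v(1)[of b] by blast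
    then have "(\<lambda>n. - (\<integral>x. \<phi> n x * d x \<partial>P)) \<longlonglongrightarrow> v a - v b" unfolding eq[OF \<phi>(1)] .
    moreover have "(\<lambda>n. - (\<integral>x. \<phi> n x * d x \<partial>P)) \<longlonglongrightarrow> - (LINT x:{a..<b}|P. d x)"
      by (rule tendsto_minus[OF set_integral_limit_test[OF d P test_fun_borel[OF \<phi>(1)] \<phi>(2,3)]])
    ultimately have "v a - v b = - (LINT x:{a..<b}|P. d x)" by (rule LIMSEQ_unique)
    then have "- (v a - v b) = (LINT x:{a..<b}|P. d x)" by (simp only: minus_minus)
    then show ?thesis by simp
  qed (simp add: set_lebesgue_integral_def)
  then have p: "prim P v d" using d by (simp add: prim_def)
  have r: "r x = v x + of_real (atom P x) * d x" for x
    by (rule tendsto_unique[OF _ v(5) prim_right_limit[OF P p]]) simp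
  have "u = bal P v d" by (rule ext) (simp add: v(3) r bal_def add_divide_distrib)
  with p show thesis by (rule that)
qed

section \<open>Symmetric relations with full ranges\<close>

definition ip :: "'a measure \<Rightarrow> ('a \<Rightarrow> complex) \<Rightarrow> ('a \<Rightarrow> complex) \<Rightarrow> complex" where
  "ip N f g = (\<integral>x. cnj (f x) * g x \<partial>N)"

lemma l2_funs_borel: "f \<in> l2_funs N \<Longrightarrow> f \<in> borel_measurable N"
  by (simp add: l2_funs_def)

lemma l2_funs_scale:
  assumes "f \<in> l2_funs N" shows "(\<lambda>x. c * f x) \<in> l2_funs N"
proof -
  have [measurable]: "f \<in> borel_measurable N" by (rule l2_funs_borel[OF assms])
  have "integrable N (\<lambda>x. (cmod c)\<^sup>2 * (cmod (f x))\<^sup>2)" using assms by (simp add: l2_funs_def)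
  then have "integrable N (\<lambda>x. (cmod (c * f x))\<^sup>2)" by (simp add: norm_mult power_mult_distrib)
  moreover have "(\<lambda>x. c * f x) \<in> borel_measurable N" by measurable
  ultimately show ?thesis by (simp add: l2_funs_def)
qed

lemma l2_funs_add:
  assumes "f \<in> l2_funs N" "g \<in> l2_funs N" shows "(\<lambda>x. f x + g x) \<in> l2_funs N"
proof -
  have [measurable]: "f \<in> borel_measurable N" "g \<in> borel_measurable N"
    using assms l2_funs_borel by auto
  have m: "(\<lambda>x. f x + g x) \<in> borel_measurable N" by measurable
  have "integrable N (\<lambda>x. (cmod (f x + g x))\<^sup>2)"
  proof (rule Bochner_Integration.integrable_bound)
    show "integrable N (\<lambda>x. 2 * (cmod (f x))\<^sup>2 + 2 * (cmod (g x))\<^sup>2)"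
      using assms by (simp add: l2_funs_def)
    show "AE x in N. norm ((cmod (f x + g x))\<^sup>2) \<le> norm (2 * (cmod (f x))\<^sup>2 + 2 * (cmod (g x))\<^sup>2)"
    proof (rule AE_I2)
      fix x
      have "(cmod (f x + g x))\<^sup>2 \<le> (cmod (f x) + cmod (g x))\<^sup>2"
        by (rule power_mono[OF norm_triangle_ineq]) simp
      also have "\<dots> \<le> 2 * (cmod (f x))\<^sup>2 + 2 * (cmod (g x))\<^sup>2"
        using sum_squares_bound[of "cmod (f x)" "cmod (g x)"] by (simp add: power2_sum)
      finally show "norm ((cmod (f x + g x))\<^sup>2) \<le> norm (2 * (cmod (f x))\<^sup>2 + 2 * (cmod (g x))\<^sup>2)" by simp
    qed
  qed measurable
  with m show ?thesis by (simp add: l2_funs_def)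
qed

lemma l2_funs_diff:
  assumes "f \<in> l2_funs N" "g \<in> l2_funs N" shows "(\<lambda>x. f x - g x) \<in> l2_funs N"
  using l2_funs_add[OF assms(1) l2_funs_scale[OF assms(2), of "-1"]] by simp

lemma l2_funs_zero: "(\<lambda>x. 0) \<in> l2_funs N"
  by (simp add: l2_funs_def)

lemma ip_integrable:
  assumes "f \<in> l2_funs N" "g \<in> l2_funs N" shows "integrable N (\<lambda>x. cnj (f x) * g x)"
proof (rule Bochner_Integration.integrable_bound)
  have [measurable]: "f \<in> borel_measurable N" "g \<in> borel_measurable N"
    using assms l2_funs_borel by auto
  show "integrable N (\<lambda>x. (cmod (f x))\<^sup>2 + (cmod (g x))\<^sup>2)"
    using assms by (simp add: l2_funs_def)
  show "(\<lambda>x. cnj (f x) * g x) \<in> borel_measurable N" by measurable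
  show "AE x in N. norm (cnj (f x) * g x) \<le> norm ((cmod (f x))\<^sup>2 + (cmod (g x))\<^sup>2)"
  proof (rule AE_I2)
    fix x
    have "cmod (f x) * cmod (g x) \<le> (cmod (f x))\<^sup>2 + (cmod (g x))\<^sup>2"
      using sum_squares_bound[of "cmod (f x)" "cmod (g x)"]
        mult_nonneg_nonneg[OF norm_ge_zero[of "f x"] norm_ge_zero[of "g x"]] by linarith
    then show "norm (cnj (f x) * g x) \<le> norm ((cmod (f x))\<^sup>2 + (cmod (g x))\<^sup>2)" by (simp add: norm_mult)
  qed
qed

lemma ip_diff_left:
  assumes "f \<in> l2_funs N" "g \<in> l2_funs N" "h \<in> l2_funs N"
  shows "ip N (\<lambda>x. f x - g x) h = ip N f h - ip N g h"
proof -
  have "ip N (\<lambda>x. f x - g x) h = (\<integral>x. cnj (f x) * h x - cnj (g x) * h x \<partial>N)"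
    by (simp add: ip_def left_diff_distrib)
  also have "\<dots> = ip N f h - ip N g h" unfolding ip_def
    by (rule Bochner_Integration.integral_diff) (rule ip_integrable assms)+
  finally show ?thesis .
qed

lemma ip_add_right:
  assumes "f \<in> l2_funs N" "g \<in> l2_funs N" "h \<in> l2_funs N"
  shows "ip N f (\<lambda>x. g x + h x) = ip N f g + ip N f h"
proof -
  have "ip N f (\<lambda>x. g x + h x) = (\<integral>x. cnj (f x) * g x + cnj (f x) * h x \<partial>N)"
    by (simp add: ip_def distrib_left)
  also have "\<dots> = ip N f g + ip N f h" unfolding ip_def
    by (rule Bochner_Integration.integral_add) (rule ip_integrable assms)+
  finally show ?thesis .
qed

lemma ip_scale_left: "ip N (\<lambda>x. c * f x) g = cnj c * ip N f g"
  by (simp add: ip_def mult.assoc)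

lemma ip_scale_right: "ip N f (\<lambda>x. c * g x) = c * ip N f g"
  by (simp add: ip_def mult.left_commute)

lemma ip_cong:
  assumes "f \<in> l2_funs N" "f' \<in> l2_funs N" "g \<in> l2_funs N" "g' \<in> l2_funs N"
    and "AE x in N. f x = f' x" "AE x in N. g x = g' x"
  shows "ip N f g = ip N f' g'"
  unfolding ip_def
proof (rule integral_cong_AE)
  show "(\<lambda>x. cnj (f x) * g x) \<in> borel_measurable N" "(\<lambda>x. cnj (f' x) * g' x) \<in> borel_measurable N"
    by (rule borel_measurable_integrable[OF ip_integrable]; rule assms)+
  show "AE x in N. cnj (f x) * g x = cnj (f' x) * g' x"
    using assms(5,6) by eventually_elim simp
qed

lemma ip_self_zero:
  assumes f: "f \<in> l2_funs N" and z: "ip N f f = 0" shows "AE x in N. f x = 0"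
proof -
  have "ip N f f = (\<integral>x. of_real ((cmod (f x))\<^sup>2) \<partial>N)"
    unfolding ip_def by (simp only: complex_norm_square mult.commute)
  also have "\<dots> = of_real (\<integral>x. (cmod (f x))\<^sup>2 \<partial>N)" by (rule integral_complex_of_real)
  finally have "(\<integral>x. (cmod (f x))\<^sup>2 \<partial>N) = 0" using z by simp
  moreover have "integrable N (\<lambda>x. (cmod (f x))\<^sup>2)" using f by (simp add: l2_funs_def)
  ultimately have "AE x in N. (cmod (f x))\<^sup>2 = 0"
    by (subst (asm) integral_nonneg_eq_0_iff_AE) auto
  then show ?thesis by (rule eventually_mono) simp
qed

section \<open>Equivalence classes and their representatives\<close>

lemma l2_class_eq_iff:
  assumes "f \<in> l2_funs N" "g \<in> l2_funs N"
  shows "l2_class N f = l2_class N g \<longleftrightarrow> (AE x in N. f x = g x)"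
proof -
  have "l2_class N f = l2_class N g \<longleftrightarrow> (f, g) \<in> l2_rel N"
    unfolding l2_class_def using eq_equiv_class_iff[OF equiv_l2_rel assms] .
  then show ?thesis using assms by (simp add: l2_rel_def)
qed

lemma l2_class_in_space: "f \<in> l2_funs N \<Longrightarrow> l2_class N f \<in> l2_space N"
  unfolding l2_class_def l2_space_def by (rule quotientI)

lemma l2_rep:
  assumes "X \<in> l2_space N" shows "l2_rep X \<in> l2_funs N" "l2_class N (l2_rep X) = X"
proof -
  obtain f where f: "f \<in> l2_funs N" "X = l2_class N f"
    using assms unfolding l2_space_def l2_class_def by (rule quotientE) blast
  have "f \<in> X" using f by (simp add: l2_class_def l2_rel_def)
  then have "l2_rep X \<in> X" unfolding l2_rep_def by (rule someI[of "\<lambda>f. f \<in> X"])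
  then have r: "(f, l2_rep X) \<in> l2_rel N" using f(2) by (simp add: l2_class_def)
  then show m: "l2_rep X \<in> l2_funs N" by (simp add: l2_rel_def)
  have "AE x in N. l2_rep X x = f x" using r by (auto simp: l2_rel_def elim: eventually_mono)
  then show "l2_class N (l2_rep X) = X" unfolding f(2) using l2_class_eq_iff m f by blast
qed

lemma l2_rep_class:
  assumes "f \<in> l2_funs N"
  shows "l2_rep (l2_class N f) \<in> l2_funs N" "AE x in N. l2_rep (l2_class N f) x = f x"
proof -
  note r = l2_rep[OF l2_class_in_space[OF assms]]
  show "l2_rep (l2_class N f) \<in> l2_funs N" by (rule r(1))
  show "AE x in N. l2_rep (l2_class N f) x = f x"
    using r l2_class_eq_iff[OF r(1) assms] by blast
qed

lemma l2_inner_class: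
  assumes "f \<in> l2_funs N" "g \<in> l2_funs N"
  shows "l2_inner N (l2_class N f) (l2_class N g) = ip N f g"
  unfolding l2_inner_def ip_def[symmetric]
  by (rule ip_cong) (rule l2_rep_class assms)+

lemma l2_scale_class:
  assumes "f \<in> l2_funs N" shows "l2_scale N c (l2_class N f) = l2_class N (\<lambda>x. c * f x)"
  unfolding l2_scale_def
  by (subst l2_class_eq_iff)
     (auto intro: l2_funs_scale l2_rep_class(1) assms eventually_mono[OF l2_rep_class(2)[OF assms]])

lemma l2_diff_class:
  assumes "f \<in> l2_funs N" "g \<in> l2_funs N"
  shows "l2_diff N (l2_class N f) (l2_class N g) = l2_class N (\<lambda>x. f x - g x)"
proof -
  have "AE x in N. l2_rep (l2_class N f) x - l2_rep (l2_class N g) x = f x - g x"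
    using l2_rep_class(2)[OF assms(1)] l2_rep_class(2)[OF assms(2)] by eventually_elim simp
  then show ?thesis unfolding l2_diff_def
    using l2_class_eq_iff[OF l2_funs_diff[OF l2_rep_class(1)[OF assms(1)] l2_rep_class(1)[OF assms(2)]] l2_funs_diff[OF assms]]
    by blast
qed

text \<open>\<open>S\<close> relates functions, and the equations for \<open>f\<close> are asked
  only almost everywhere, since this is all that the classes can see. Non-real and real parameters
  are separated because the former are to belong to the resolvent set and the latter to the
  spectrum.\<close>

locale symmetric_relation =
  fixes N :: "'a measure" and S :: "('a \<Rightarrow> complex) \<Rightarrow> ('a \<Rightarrow> complex) \<Rightarrow> bool"
  assumes S_l2: "S u f \<Longrightarrow> u \<in> l2_funs N" "S u f \<Longrightarrow> f \<in> l2_funs N"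
    and S_zero: "S (\<lambda>x. 0) (\<lambda>x. 0)"
    and S_symmetric: "S u f \<Longrightarrow> S v g \<Longrightarrow> ip N v f = ip N g u"
    and S_range: "Im z \<noteq> 0 \<Longrightarrow> g \<in> l2_funs N \<Longrightarrow> \<exists>u f. S u f \<and> (AE x in N. f x = z * u x + g x)"
    and S_no_real_eigen: "S u f \<Longrightarrow> AE x in N. f x = of_real l * u x \<Longrightarrow> AE x in N. u x = 0"
    and S_real_range: "\<exists>g\<in>l2_funs N. \<not> (\<exists>u f. S u f \<and> (AE x in N. f x = of_real l * u x + g x))"
begin

definition T where "T = {(l2_class N u, l2_class N f) | u f. S u f}"

lemma kernel_trivial:
  assumes s: "S u f" and e: "AE x in N. f x = z * u x" shows "AE x in N. u x = 0"
proof (cases "Im z = 0")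
  case True
  then have "z = of_real (Re z)" by (simp add: complex_eq_iff)
  then show ?thesis using S_no_real_eigen[OF s, of "Re z"] e by simp
next
  case False
  note u = S_l2(1)[OF s] and f = S_l2(2)[OF s]
  have 1: "ip N u f = z * ip N u u"
    using ip_cong[OF u u f l2_funs_scale[OF u] _ e] unfolding ip_scale_right by simp
  have 2: "ip N f u = cnj z * ip N u u"
    using ip_cong[OF f l2_funs_scale[OF u] u u e] unfolding ip_scale_left by simp
  have "(z - cnj z) * ip N u u = 0" using S_symmetric[OF s s] unfolding 1 2 by (simp add: left_diff_distrib)
  moreover have "z - cnj z \<noteq> 0" using False by (simp add: complex_eq_iff)
  ultimately have "ip N u u = 0" using mult_eq_0_iff[of "z - cnj z" "ip N u u"] by blast
  then show ?thesis by (rule ip_self_zero[OF u])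
qed

text \<open>For \<open>(v, g)\<close> in the adjoint, surjectivity of \<open>T - \<i>\<close> gives
  \<open>(u, f)\<close> in \<open>T\<close> with \<open>f - \<i> u = g - \<i> v\<close>. The
  difference \<open>d = u - v\<close> is then orthogonal to the range of \<open>T + \<i>\<close>;
  since \<open>d\<close> itself is of the form \<open>h + \<i> y\<close> with \<open>(y, h)\<close>
  in \<open>T\<close>, it has norm 0.\<close>

lemma self_adjoint_T: "self_adjoint N T"
  unfolding self_adjoint_def
proof (rule equalityI; rule subrelI)
  fix V G assume "(V, G) \<in> T"
  then obtain v g where vg: "S v g" "V = l2_class N v" "G = l2_class N g" unfolding T_def by blast
  have "l2_inner N G U = l2_inner N V F" if UF: "(U, F) \<in> T" for U F
  proof -
    obtain u f where uf: "S u f" "U = l2_class N u" "F = l2_class N f" using UF unfolding T_def by blast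
    show ?thesis unfolding uf vg
      using S_symmetric[OF uf(1) vg(1)] by (simp add: l2_inner_class S_l2[OF uf(1)] S_l2[OF vg(1)])
  qed
  then show "(V, G) \<in> adjoint_relation N T"
    unfolding adjoint_relation_def using S_l2[OF vg(1)] vg(2,3) by (auto intro: l2_class_in_space)
next
  fix V G assume "(V, G) \<in> adjoint_relation N T"
  then have VG: "V \<in> l2_space N" "G \<in> l2_space N" and adj: "\<And>U F. (U, F) \<in> T \<Longrightarrow> l2_inner N G U = l2_inner N V F"
    unfolding adjoint_relation_def by auto
  define v where "v = l2_rep V"
  define g where "g = l2_rep G"
  have v: "v \<in> l2_funs N" "l2_class N v = V" and g: "g \<in> l2_funs N" "l2_class N g = G"
    by (simp_all add: v_def g_def l2_rep VG)
  have "(\<lambda>x. g x - \<i> * v x) \<in> l2_funs N" by (intro l2_funs_diff l2_funs_scale v g)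
  then obtain u f where s: "S u f" and f: "AE x in N. f x = \<i> * u x + (g x - \<i> * v x)"
    using S_range[of \<i> "\<lambda>x. g x - \<i> * v x"] by auto
  note ul = S_l2(1)[OF s] and fl = S_l2(2)[OF s]
  let ?d = "\<lambda>x. u x - v x"
  have d: "?d \<in> l2_funs N" by (rule l2_funs_diff[OF ul v(1)])
  obtain y h where t: "S y h" and h: "AE x in N. h x = - \<i> * y x + ?d x"
    using S_range[of "- \<i>" ?d] d by auto
  note yl = S_l2(1)[OF t] and hl = S_l2(2)[OF t]
  have "(l2_class N y, l2_class N h) \<in> T" using t unfolding T_def by blast
  from adj[OF this] have "l2_inner N (l2_class N g) (l2_class N y) = l2_inner N (l2_class N v) (l2_class N h)"
    unfolding v(2) g(2) .
  then have 1: "ip N g y = ip N v h"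
    unfolding l2_inner_class[OF g(1) yl] l2_inner_class[OF v(1) hl] .
  have 2: "ip N u h = ip N f y" by (rule S_symmetric[OF t s])
  have 3: "ip N ?d h = ip N (\<lambda>x. f x - g x) y"
    unfolding ip_diff_left[OF ul v(1) hl] ip_diff_left[OF fl g(1) yl] 1 2 ..
  have fg: "AE x in N. f x - g x = \<i> * ?d x" using f by eventually_elim (simp add: algebra_simps)
  have 4: "ip N (\<lambda>x. f x - g x) y = - \<i> * ip N ?d y"
    using ip_cong[OF l2_funs_diff[OF fl g(1)] l2_funs_scale[OF d, of \<i>] yl yl fg] unfolding ip_scale_left by simp
  have "ip N ?d h = ip N ?d (\<lambda>x. - \<i> * y x + ?d x)"
    by (rule ip_cong[OF d d hl l2_funs_add[OF l2_funs_scale[OF yl] d] _ h]) simp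
  also have "\<dots> = - \<i> * ip N ?d y + ip N ?d ?d"
    unfolding ip_add_right[OF d l2_funs_scale[OF yl] d] ip_scale_right ..
  finally have "ip N ?d ?d = 0" using 3 4 by simp
  then have dz: "AE x in N. ?d x = 0" by (rule ip_self_zero[OF d])
  have "AE x in N. u x = v x" using dz by eventually_elim simp
  then have "l2_class N u = V" unfolding v(2)[symmetric] using l2_class_eq_iff[OF ul v(1)] by blast
  moreover have "AE x in N. f x = g x" using dz fg by eventually_elim simp
  then have "l2_class N f = G" unfolding g(2)[symmetric] using l2_class_eq_iff[OF fl g(1)] by blast
  ultimately show "(V, G) \<in> T" using s unfolding T_def by blast
qed

lemma no_eigenvalue: "\<not> eigenvalue N T z"
proof
  assume "eigenvalue N T z"
  then obtain U where U: "U \<in> l2_space N" "U \<noteq> l2_zero N" "(U, l2_scale N z U) \<in> T"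
    unfolding eigenvalue_def by blast
  obtain u f where s: "S u f" "U = l2_class N u" "l2_scale N z U = l2_class N f"
    using U(3) unfolding T_def by blast
  note ul = S_l2(1)[OF s(1)] and fl = S_l2(2)[OF s(1)]
  have "l2_class N f = l2_class N (\<lambda>x. z * u x)" using s(2,3) l2_scale_class[OF ul] by simp
  then have "AE x in N. f x = z * u x" using l2_class_eq_iff[OF fl l2_funs_scale[OF ul]] by blast
  then have "AE x in N. u x = 0" by (rule kernel_trivial[OF s(1)])
  then have "U = l2_zero N" unfolding s(2) l2_zero_def using l2_class_eq_iff[OF ul l2_funs_zero] by blast
  then show False using U(2) by simp
qed

lemma shift_class:
  assumes "S u f"
  shows "l2_diff N (l2_class N f) (l2_scale N z (l2_class N u)) = l2_class N (\<lambda>x. f x - z * u x)"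
  using S_l2[OF assms] by (simp add: l2_scale_class l2_diff_class l2_funs_scale)

lemma shift_T: "relation_shift N T z = {(l2_class N u, l2_class N (\<lambda>x. f x - z * u x)) | u f. S u f}"
proof (rule equalityI; rule subrelI)
  fix X Y assume "(X, Y) \<in> relation_shift N T z"
  then have "\<exists>F. (X, F) \<in> T \<and> Y = l2_diff N F (l2_scale N z X)" by (auto simp: relation_shift_def)
  then obtain F where F: "(X, F) \<in> T" "Y = l2_diff N F (l2_scale N z X)" by (elim exE conjE)
  have "\<exists>u f. S u f \<and> X = l2_class N u \<and> F = l2_class N f" using F(1) by (auto simp: T_def)
  then obtain u f where uf: "S u f" "X = l2_class N u" "F = l2_class N f" by (elim exE conjE)
  have "Y = l2_class N (\<lambda>x. f x - z * u x)" unfolding F(2) uf(2,3) by (rule shift_class[OF uf(1)])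
  then show "(X, Y) \<in> {(l2_class N u, l2_class N (\<lambda>x. f x - z * u x)) | u f. S u f}"
    unfolding mem_Collect_eq using uf(1,2) by (intro exI[of _ u] exI[of _ f]) simp
next
  fix X Y assume "(X, Y) \<in> {(l2_class N u, l2_class N (\<lambda>x. f x - z * u x)) | u f. S u f}"
  then have "\<exists>u f. S u f \<and> X = l2_class N u \<and> Y = l2_class N (\<lambda>x. f x - z * u x)" by auto
  then obtain u f where uf: "S u f" "X = l2_class N u" "Y = l2_class N (\<lambda>x. f x - z * u x)" by (elim exE conjE)
  have "(X, l2_class N f) \<in> T" unfolding T_def mem_Collect_eq uf(2) using uf(1) by (intro exI[of _ u] exI[of _ f]) simp
  moreover have "Y = l2_diff N (l2_class N f) (l2_scale N z X)"
    unfolding uf(2,3) by (rule shift_class[OF uf(1), symmetric])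
  ultimately show "(X, Y) \<in> relation_shift N T z" unfolding relation_shift_def mem_Collect_eq
    by (intro exI[of _ X] exI[of _ "l2_class N f"]) simp
qed

lemma shift_mem:
  "(X, Y) \<in> relation_shift N T z \<longleftrightarrow> (\<exists>u f. S u f \<and> X = l2_class N u \<and> Y = l2_class N (\<lambda>x. f x - z * u x))"
  unfolding shift_T by auto

lemma kernel_shift: "relation_ker N (relation_shift N T z) = {l2_zero N}"
proof (rule equalityI; rule subsetI)
  fix U assume "U \<in> relation_ker N (relation_shift N T z)"
  then obtain u f where s: "S u f" "U = l2_class N u" "l2_zero N = l2_class N (\<lambda>x. f x - z * u x)"
    by (auto simp: relation_ker_def shift_mem)
  note ul = S_l2(1)[OF s(1)] and fl = S_l2(2)[OF s(1)]
  have "AE x in N. f x - z * u x = 0"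
    using s(3)[symmetric] l2_class_eq_iff[OF l2_funs_diff[OF fl l2_funs_scale[OF ul]] l2_funs_zero]
    unfolding l2_zero_def by blast
  then have "AE x in N. f x = z * u x" by eventually_elim simp
  then have "AE x in N. u x = 0" by (rule kernel_trivial[OF s(1)])
  then show "U \<in> {l2_zero N}" unfolding s(2) l2_zero_def using l2_class_eq_iff[OF ul l2_funs_zero] by blast
next
  fix U assume "U \<in> {l2_zero N}"
  then have U: "U = l2_class N (\<lambda>x. 0)" by (simp add: l2_zero_def)
  have "(l2_class N (\<lambda>x. 0), l2_class N (\<lambda>x. 0 - z * 0)) \<in> relation_shift N T z"
    unfolding shift_mem using S_zero by (intro exI[of _ "\<lambda>x. 0"]) simp
  then show "U \<in> relation_ker N (relation_shift N T z)"
    unfolding relation_ker_def U l2_zero_def by simp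
qed

lemma range_shift:
  "Range (relation_shift N T z) = l2_space N \<longleftrightarrow> (\<forall>g\<in>l2_funs N. \<exists>u f. S u f \<and> (AE x in N. f x = z * u x + g x))"
proof -
  have sub: "Range (relation_shift N T z) \<subseteq> l2_space N"
  proof
    fix X assume "X \<in> Range (relation_shift N T z)"
    then obtain u f where "S u f" "X = l2_class N (\<lambda>x. f x - z * u x)"
      by (auto simp: Range_iff shift_mem)
    then show "X \<in> l2_space N"
      by (simp add: l2_class_in_space l2_funs_diff l2_funs_scale S_l2)
  qed
  have mem: "l2_class N g \<in> Range (relation_shift N T z) \<longleftrightarrow> (\<exists>u f. S u f \<and> (AE x in N. f x = z * u x + g x))"
    if g: "g \<in> l2_funs N" for g
  proof -
    have "l2_class N g = l2_class N (\<lambda>x. f x - z * u x) \<longleftrightarrow> (AE x in N. f x = z * u x + g x)" if "S u f" for u f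
    proof -
      have "l2_class N g = l2_class N (\<lambda>x. f x - z * u x) \<longleftrightarrow> (AE x in N. g x = f x - z * u x)"
        by (rule l2_class_eq_iff[OF g l2_funs_diff[OF S_l2(2)[OF that] l2_funs_scale[OF S_l2(1)[OF that]]]])
      also have "\<dots> \<longleftrightarrow> (AE x in N. f x = z * u x + g x)"
        by (intro iffI; erule eventually_mono; simp)
      finally show ?thesis .
    qed
    then show ?thesis unfolding Range_iff shift_mem by (auto; blast)
  qed
  show ?thesis
  proof
    assume "Range (relation_shift N T z) = l2_space N"
    then show "\<forall>g\<in>l2_funs N. \<exists>u f. S u f \<and> (AE x in N. f x = z * u x + g x)"
      using mem l2_class_in_space[of _ N] by blast
  next
    assume a: "\<forall>g\<in>l2_funs N. \<exists>u f. S u f \<and> (AE x in N. f x = z * u x + g x)"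
    have "X \<in> Range (relation_shift N T z)" if "X \<in> l2_space N" for X
      using mem[OF l2_rep(1)[OF that]] a l2_rep(1)[OF that] unfolding l2_rep(2)[OF that] by blast
    then show "Range (relation_shift N T z) = l2_space N" using sub by blast
  qed
qed

lemma spectrum_T: "spectrum N T = \<real>"
proof -
  have "z \<in> resolvent_set N T \<longleftrightarrow> z \<notin> \<real>" for z
  proof (cases "Im z = 0")
    case True
    then have z: "z = of_real (Re z)" by (simp add: complex_eq_iff)
    have "z \<notin> resolvent_set N T"
      unfolding resolvent_set_def using range_shift[of z] S_real_range[of "Re z"] z by auto
    moreover have "z \<in> \<real>" by (subst z) (rule Reals_of_real)
    ultimately show ?thesis by simp
  next
    case False
    then have "z \<in> resolvent_set N T"
      unfolding resolvent_set_def using range_shift[of z] S_range[OF False] kernel_shift by auto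
    moreover have "z \<notin> \<real>" using False by (auto simp: complex_is_Real_iff)
    ultimately show ?thesis by simp
  qed
  then show ?thesis unfolding spectrum_def by blast
qed

end

section \<open>The maximal relation\<close>

lemma local_measure_polar:
  assumes "local_measure r M h" shows "local_measure r (fst (polar r)) (snd (polar r))"
  unfolding polar_def by (rule someI[of "\<lambda>p. local_measure r (fst p) (snd p)" "(M, h)"]) (use assms in simp)

lemma AE_atom:
  assumes P: "locally_finite P" and ae: "AE x in P. Q x" and "atom P c \<noteq> 0" shows "Q c"
proof (rule ccontr)
  assume "\<not> Q c"
  have "AE x in P. x \<notin> {c}" using ae by (rule eventually_mono) (use \<open>\<not> Q c\<close> in auto)
  moreover have "{c} \<in> sets P" using locally_finiteD(1)[OF P] by simp
  ultimately have "{c} \<in> null_sets P" by (simp only: AE_iff_null_sets)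
  then have "measure P {c} = 0" by (simp add: measure_def null_setsD1)
  then show False using \<open>atom P c \<noteq> 0\<close> by (simp add: atom_def)
qed

lemma completion_borel_representative:
  fixes f :: "'a \<Rightarrow> complex"
  assumes [measurable]: "f \<in> borel_measurable (completion M)"
  obtains f' where "f' \<in> borel_measurable M" "AE x in M. f x = f' x"
proof -
  have "(\<lambda>x. Re (f x)) \<in> borel_measurable (completion M)" "(\<lambda>x. Im (f x)) \<in> borel_measurable (completion M)"
    by measurable
  then obtain a b where ab: "a \<in> borel_measurable M" "AE x in M. Re (f x) = a x"
    "b \<in> borel_measurable M" "AE x in M. Im (f x) = b x"
    using completion_ex_borel_measurable_real by metis
  note [measurable] = ab(1,3)
  have "(\<lambda>x. of_real (a x) + \<i> * of_real (b x)) \<in> borel_measurable M" by measurable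
  moreover have "AE x in M. f x = of_real (a x) + \<i> * of_real (b x)"
    using ab(2,4) by eventually_elim (simp add: complex_eq_iff)
  ultimately show thesis by (rule that)
qed

lemma integral_completion_cong:
  fixes f g :: "'a \<Rightarrow> complex"
  assumes f: "f \<in> borel_measurable (completion M)" and g: "g \<in> borel_measurable M" and ae: "AE x in M. f x = g x"
  shows "integral\<^sup>L (completion M) f = integral\<^sup>L M g"
proof -
  have "integral\<^sup>L (completion M) f = integral\<^sup>L (completion M) g"
    using f measurable_completion[OF g] AE_completion[OF ae] by (rule integral_cong_AE)
  then show ?thesis by (simp only: integral_completion[OF g])
qed

section \<open>The measure with density \<open>w\<close> and passage between its completion and
  Borel functions\<close>

context system
begin

definition W :: "real measure" where "W = density P (\<lambda>x. ennreal (w x))"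

lemma W_borel: "borel_measurable W = borel_measurable borel"
  unfolding W_def by (rule measurable_cong_sets) (simp_all add: setsP)

lemma W_integral:
  fixes f :: "real \<Rightarrow> 'b::{banach, second_countable_topology}"
  assumes "f \<in> borel_measurable borel"
  shows "integral\<^sup>L W f = (\<integral>x. w x *\<^sub>R f x \<partial>P)" "integrable W f \<longleftrightarrow> integrable P (\<lambda>x. w x *\<^sub>R f x)"
  unfolding W_def by (rule integral_real_density'[OF setsP w_borel w_ge assms])+

lemma l2_funs_W:
  assumes f: "f \<in> borel_measurable borel" shows "f \<in> l2_funs (completion W) \<longleftrightarrow> l2w f"
proof -
  have m: "(\<lambda>x. (cmod (f x))\<^sup>2) \<in> borel_measurable borel" using f by measurable
  have "f \<in> borel_measurable (completion W)" by (rule measurable_completion) (simp add: W_borel f)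
  moreover have "integrable (completion W) (\<lambda>x. (cmod (f x))\<^sup>2) \<longleftrightarrow> integrable P (\<lambda>x. w x * (cmod (f x))\<^sup>2)"
    using m by (simp add: integrable_completion W_borel W_integral(2))
  ultimately show ?thesis using f by (simp add: l2_funs_def l2w_def)
qed

lemma l2w_l2_funs: "l2w f \<Longrightarrow> f \<in> l2_funs (completion W)"
  using l2_funs_W[OF l2w_borel] by blast

lemma l2w_representative:
  assumes f: "f \<in> l2_funs (completion W)"
  obtains f' where "l2w f'" "AE x in W. f x = f' x"
proof -
  obtain f' where f': "f' \<in> borel_measurable W" "AE x in W. f x = f' x"
    by (rule completion_borel_representative[OF l2_funs_borel[OF f]]) (rule that)
  have ae: "AE x in completion W. f x = f' x" by (rule AE_completion[OF f'(2)])
  have m: "f' \<in> borel_measurable (completion W)" by (rule measurable_completion[OF f'(1)])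
  have "integrable (completion W) (\<lambda>x. (cmod (f' x))\<^sup>2)"
  proof (rule integrable_cong_AE_imp)
    show "integrable (completion W) (\<lambda>x. (cmod (f x))\<^sup>2)" using f by (simp add: l2_funs_def)
    show "(\<lambda>x. (cmod (f' x))\<^sup>2) \<in> borel_measurable (completion W)" using m by measurable
    show "AE x in completion W. (cmod (f x))\<^sup>2 = (cmod (f' x))\<^sup>2" using ae by (rule eventually_mono) simp
  qed
  then have "f' \<in> l2_funs (completion W)" using m by (simp add: l2_funs_def)
  then have "l2w f'" using l2_funs_W f'(1) unfolding W_borel by blast
  then show thesis using f'(2) by (rule that)
qed

lemma ip_W:
  assumes "l2w f" "l2w g"
  shows "ip (completion W) f g = (\<integral>x. of_real (w x) * (cnj (f x) * g x) \<partial>P)"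
proof -
  note [measurable] = l2w_borel[OF assms(1)] l2w_borel[OF assms(2)]
  have m: "(\<lambda>x. cnj (f x) * g x) \<in> borel_measurable borel" by measurable
  have "ip (completion W) f g = (\<integral>x. cnj (f x) * g x \<partial>W)"
    unfolding ip_def by (rule integral_completion) (simp add: W_borel m)
  then show ?thesis using W_integral(1)[OF m] by (simp add: scaleR_conv_of_real)
qed

lemma AE_W: "(AE x in W. Q x) \<longleftrightarrow> (AE x in P. w x \<noteq> 0 \<longrightarrow> Q x)"
proof -
  have m: "(\<lambda>x. ennreal (w x)) \<in> borel_measurable P" by measurable
  have "0 < ennreal (w x) \<longleftrightarrow> w x \<noteq> 0" for x using w_ge[of x] by (auto simp: less_le)
  then show ?thesis unfolding W_def AE_density[OF m] by simp
qed

lemma dens_loc_int: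
  assumes "u \<in> borel_measurable borel" "loc_bounded u" "l2w f" shows "loc_int P (dens u f)"
proof -
  have "loc_bounded (\<lambda>x. complex_of_real (q x))" using q_le by (auto simp: loc_bounded_def)
  then have "loc_int P (\<lambda>x. of_real (q x) * u x)"
    using assms(1) by (intro loc_int_loc_bounded[OF P] loc_bounded_mult assms(2)) measurable
  from loc_int_diff[OF l2w_loc_int[OF assms(3)] this] show ?thesis
    unfolding loc_int_def dens_def[abs_def] by auto
qed

text \<open>\<open>f\<close> enters \<open>dens u f\<close> with the factor \<open>w\<close>, so a
  change on a \<open>w\<close>-null set alters the density only on a \<open>P\<close>-null set. Such
  a set contains no atom, whence the balance condition continues to hold at every point.\<close>

lemma sol_cong_AE:
  assumes s: "sol v u f" and g: "g \<in> borel_measurable borel" and ae: "AE x in W. f x = g x"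
  shows "sol v u g"
proof -
  have [measurable]: "u \<in> borel_measurable borel" "f \<in> borel_measurable borel" "g \<in> borel_measurable borel"
    using s g by (simp_all add: sol_def)
  have dm: "dens u f \<in> borel_measurable borel" "dens u g \<in> borel_measurable borel"
    unfolding dens_def[abs_def] by measurable
  then have dP: "dens u f \<in> borel_measurable P" "dens u g \<in> borel_measurable P" by simp_all
  have d: "AE x in P. dens u f x = dens u g x"
    using ae unfolding AE_W by eventually_elim (auto simp: dens_def)
  have "prim P v (dens u g)"
  proof -
    have "set_integrable P {a..<b} (dens u g)" for a b
    proof -
      have "set_integrable P {a..<b} (dens u f) = set_integrable P {a..<b} (dens u g)"
        by (rule set_integrable_cong_AE[OF dP]) (use d in \<open>auto elim: eventually_mono\<close>)
      then show ?thesis using loc_intD[OF prim_loc_int[OF sol_prim[OF s]]] by blast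
    qed
    moreover have "(LINT x:{a..<b}|P. dens u f x) = (LINT x:{a..<b}|P. dens u g x)" for a b
      by (rule set_lebesgue_integral_cong_AE[OF _ dP]) (use d in \<open>auto elim: eventually_mono\<close>)
    ultimately show ?thesis using sol_prim[OF s] dm(2) by (simp add: prim_def loc_int_def)
  qed
  moreover have "bal P v (dens u g) = bal P v (dens u f)"
  proof
    fix x
    show "bal P v (dens u g) x = bal P v (dens u f) x"
      using AE_atom[OF P d, of x] by (cases "atom P x = 0") (auto simp: bal_def)
  qed
  ultimately show ?thesis using s unfolding sol_def by simp
qed

text \<open>\<open>T_max\<close> on the level of Borel representatives. That \<open>u\<close> is
  balanced and of locally bounded variation is implicit in \<open>sol\<close>, by
  \<open>bal_balanced\<close> and \<open>bal_bv_loc\<close>.\<close>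

definition max_rel :: "(real \<Rightarrow> complex) \<Rightarrow> (real \<Rightarrow> complex) \<Rightarrow> bool" where
  "max_rel u f \<longleftrightarrow> l2w u \<and> l2w f \<and> (\<exists>v. sol v u f)"

lemma sol_zero: "sol (\<lambda>x. 0) (\<lambda>x. 0) (\<lambda>x. 0)"
  unfolding sol_def dens_def[abs_def] bal_def[abs_def] prim_def loc_int_def by (simp add: set_integrable_def)

lemma max_rel_symmetric_relation: "symmetric_relation (completion W) max_rel"
proof
  show "u \<in> l2_funs (completion W)" if "max_rel u f" for u f
    using that by (simp add: max_rel_def l2w_l2_funs)
  show "f \<in> l2_funs (completion W)" if "max_rel u f" for u f
    using that by (simp add: max_rel_def l2w_l2_funs)
  show "max_rel (\<lambda>x. 0) (\<lambda>x. 0)" using sol_zero by (auto simp: max_rel_def l2w_def)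
  show "ip (completion W) v f = ip (completion W) g u" if "max_rel u f" "max_rel v g" for u f v g
    using that sol_symmetric by (auto simp: max_rel_def ip_W)
  show "\<exists>u f. max_rel u f \<and> (AE x in completion W. f x = z * u x + g x)"
    if z: "Im z \<noteq> 0" and g: "g \<in> l2_funs (completion W)" for z g
  proof -
    obtain g' where g': "l2w g'" "AE x in W. g x = g' x" by (rule l2w_representative[OF g]) (rule that)
    obtain v u where s: "sol v u (\<lambda>x. z * u x + g' x)" "l2w u" using range_nonreal[OF z g'(1)] by blast
    have "AE x in completion W. z * u x + g' x = z * u x + g x"
      using AE_completion[OF g'(2)] by (rule eventually_mono) simp
    moreover have "max_rel u (\<lambda>x. z * u x + g' x)"
      unfolding max_rel_def using s l2w_add[OF l2w_cmult[OF s(2)] g'(1)] by blast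
    ultimately show ?thesis by blast
  qed
  show "AE x in completion W. u x = 0" if uf: "max_rel u f" and ae: "AE x in completion W. f x = of_real l * u x" for u f l
  proof -
    obtain v where s: "sol v u f" and u: "l2w u" using uf by (auto simp: max_rel_def)
    have ae': "AE x in W. f x = of_real l * u x" using ae unfolding AE_completion_iff .
    have "sol v u (\<lambda>x. of_real l * u x)"
      by (rule sol_cong_AE[OF s l2w_borel[OF l2w_cmult[OF u]] ae'])
    from sol_real_zero[OF this u] show ?thesis by simp
  qed
  show "\<exists>g\<in>l2_funs (completion W). \<not> (\<exists>u f. max_rel u f \<and> (AE x in completion W. f x = of_real l * u x + g x))" for l
  proof -
    obtain g where g: "l2w g" "\<not> (\<exists>v u. l2w u \<and> sol v u (\<lambda>x. of_real l * u x + g x))"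
      using real_not_surjective by blast
    have False if uf: "max_rel u f" and ae: "AE x in completion W. f x = of_real l * u x + g x" for u f
    proof -
      obtain v where s: "sol v u f" and u: "l2w u" using uf by (auto simp: max_rel_def)
      have ae': "AE x in W. f x = of_real l * u x + g x" using ae unfolding AE_completion_iff .
      have "sol v u (\<lambda>x. of_real l * u x + g x)"
        by (rule sol_cong_AE[OF s l2w_borel[OF l2w_add[OF l2w_cmult[OF u] g(1)]] ae'])
      then show False using g(2) u by blast
    qed
    then show ?thesis using l2w_l2_funs[OF g(1)] by blast
  qed
qed

lemma test_fun_integrable:
  assumes d: "loc_int P d" and \<phi>: "test_fun \<phi>"
  shows "integrable P (\<lambda>x. \<phi> x * d x)"
proof -
  obtain a b where ab: "a < b" "\<And>x. x \<notin> {a<..<b} \<Longrightarrow> \<phi> x = 0" by (rule test_fun_support[OF \<phi>]) (rule that)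
  obtain B where B: "\<And>x. cmod (\<phi> x) \<le> B" "B \<ge> 0" by (rule test_fun_bounded[OF \<phi>]) (rule that)
  have "loc_int P (\<lambda>x. \<phi> x * d x)"
    by (rule loc_int_mult[OF P d test_fun_borel[OF \<phi>]]) (use B in \<open>auto simp: loc_bounded_def\<close>)
  from loc_intD[OF this, of a b] have "integrable P (\<lambda>x. indicator {a..<b} x *\<^sub>R (\<phi> x * d x))"
    unfolding set_integrable_def .
  moreover have "(\<lambda>x. indicator {a..<b} x *\<^sub>R (\<phi> x * d x)) = (\<lambda>x. \<phi> x * d x)"
  proof
    show "indicator {a..<b} x *\<^sub>R (\<phi> x * d x) = \<phi> x * d x" for x
      using ab(2)[of x] by (cases "x \<in> {a..<b}") auto
  qed
  ultimately show ?thesis by simp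
qed

text \<open>Here \<open>rq\<close> and \<open>rw\<close> are the distributions with densities \<open>q\<close> and \<open>w\<close> with respect to \<open>P\<close>; the
  polar decomposition of \<open>rq\<close> has modulus \<open>m P\<close> and phase \<open>h\<close>.\<close>

lemma dist_eq_iff:
  assumes rq: "polar rq = (density P (\<lambda>x. ennreal (m x)), h)" and m: "m \<in> borel_measurable borel" "\<And>x. 0 \<le> m x"
    and h: "h \<in> borel_measurable borel" "AE x in P. of_real (m x) * h x = of_real (q x)"
    and rw: "polar rw = (W, k)" and k: "k \<in> borel_measurable borel" "AE x in W. k x = 1"
    and u: "u \<in> borel_measurable borel" "loc_bounded u"
    and f: "f \<in> borel_measurable (completion W)" "l2w f'" "AE x in W. f x = f' x"
  shows "dist_eq (dist_add (dist_scale J (dist_deriv (dist_of_fun u))) (dist_mult rq u)) (dist_mult rw f) \<longleftrightarrow>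
    (\<forall>\<phi>. test_fun \<phi> \<longrightarrow> (\<integral>x. u x * vector_derivative \<phi> (at x) \<partial>lborel) = - (\<integral>x. \<phi> x * dens u f' x \<partial>P))"
proof -
  note [measurable] = m(1) h(1) k(1) u(1) l2w_borel[OF f(2)]
  have "(dist_add (dist_scale J (dist_deriv (dist_of_fun u))) (dist_mult rq u)) \<phi> = dist_mult rw f \<phi> \<longleftrightarrow>
    (\<integral>x. u x * vector_derivative \<phi> (at x) \<partial>lborel) = - (\<integral>x. \<phi> x * dens u f' x \<partial>P)" if \<phi>: "test_fun \<phi>" for \<phi>
  proof -
    note [measurable] = test_fun_borel[OF \<phi>]
    let ?I = "\<integral>x. u x * vector_derivative \<phi> (at x) \<partial>lborel"
    have "dist_mult rw f \<phi> = (\<integral>x. f x * \<phi> x * k x \<partial>completion W)"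
      by (simp add: dist_mult_def abs_measure_def rw)
    also have "\<dots> = (\<integral>x. f' x * \<phi> x \<partial>W)"
    proof (rule integral_completion_cong)
      have "\<phi> \<in> borel_measurable (completion W)" "k \<in> borel_measurable (completion W)"
        by (rule measurable_completion, simp add: W_borel)+
      then show "(\<lambda>x. f x * \<phi> x * k x) \<in> borel_measurable (completion W)" using f(1) by measurable
      show "(\<lambda>x. f' x * \<phi> x) \<in> borel_measurable W" unfolding W_borel by measurable
      show "AE x in W. f x * \<phi> x * k x = f' x * \<phi> x" using f(3) k(2) by eventually_elim simp
    qed
    also have "\<dots> = (\<integral>x. \<phi> x * (of_real (w x) * f' x) \<partial>P)"
      by (subst W_integral(1)) (simp_all add: scaleR_conv_of_real mult_ac)
    finally have 1: "dist_mult rw f \<phi> = (\<integral>x. \<phi> x * (of_real (w x) * f' x) \<partial>P)" .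
    let ?Q = "density P (\<lambda>x. ennreal (m x))"
    have Qb: "borel_measurable ?Q = borel_measurable borel"
      by (rule measurable_cong_sets) (simp_all add: setsP)
    have um: "(\<lambda>x. u x * \<phi> x * h x) \<in> borel_measurable borel" by measurable
    have "dist_mult rq u \<phi> = (\<integral>x. u x * \<phi> x * h x \<partial>completion ?Q)"
      by (simp add: dist_mult_def abs_measure_def rq)
    also have "\<dots> = (\<integral>x. u x * \<phi> x * h x \<partial>?Q)" by (rule integral_completion) (simp only: Qb um)
    also have "\<dots> = (\<integral>x. m x *\<^sub>R (u x * \<phi> x * h x) \<partial>P)" by (rule integral_real_density'(1)[OF setsP m um])
    also have "\<dots> = (\<integral>x. \<phi> x * (of_real (q x) * u x) \<partial>P)"
    proof (rule integral_cong_AE)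
      show "AE x in P. m x *\<^sub>R (u x * \<phi> x * h x) = \<phi> x * (of_real (q x) * u x)"
        using h(2)
      proof eventually_elim
        case (elim x)
        have "m x *\<^sub>R (u x * \<phi> x * h x) = u x * \<phi> x * (of_real (m x) * h x)" by (simp add: scaleR_conv_of_real)
        then show ?case unfolding elim by simp
      qed
    qed measurable
    finally have 2: "dist_mult rq u \<phi> = (\<integral>x. \<phi> x * (of_real (q x) * u x) \<partial>P)" .
    have qu: "loc_int P (\<lambda>x. of_real (q x) * u x)"
    proof -
      have "loc_bounded (\<lambda>x. complex_of_real (q x))" using q_le by (auto simp: loc_bounded_def)
      then show ?thesis
        by (intro loc_int_loc_bounded[OF P] loc_bounded_mult u(2)) measurable
    qed
    have "J * (\<integral>x. \<phi> x * dens u f' x \<partial>P) = (\<integral>x. J * (\<phi> x * dens u f' x) \<partial>P)" by simp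
    also have "\<dots> = (\<integral>x. \<phi> x * (of_real (w x) * f' x) - \<phi> x * (of_real (q x) * u x) \<partial>P)"
    proof (rule Bochner_Integration.integral_cong[OF refl])
      fix x
      have "J * dens u f' x = of_real (w x) * f' x - of_real (q x) * u x" by (simp add: dens_def J(2))
      then show "J * (\<phi> x * dens u f' x) = \<phi> x * (of_real (w x) * f' x) - \<phi> x * (of_real (q x) * u x)"
        by (simp only: mult.left_commute[of J] right_diff_distrib)
    qed
    also have "\<dots> = (\<integral>x. \<phi> x * (of_real (w x) * f' x) \<partial>P) - (\<integral>x. \<phi> x * (of_real (q x) * u x) \<partial>P)"
      by (rule Bochner_Integration.integral_diff[OF test_fun_integrable[OF l2w_loc_int[OF f(2)] \<phi>] test_fun_integrable[OF qu \<phi>]])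
    finally have 3: "dist_mult rw f \<phi> = J * (\<integral>x. \<phi> x * dens u f' x \<partial>P) + dist_mult rq u \<phi>"
      unfolding 1 2 by simp
    have "(dist_add (dist_scale J (dist_deriv (dist_of_fun u))) (dist_mult rq u)) \<phi> = J * (- ?I) + dist_mult rq u \<phi>"
      by (simp add: dist_add_def dist_scale_def dist_deriv_def dist_of_fun_def)
    then have "(dist_add (dist_scale J (dist_deriv (dist_of_fun u))) (dist_mult rq u)) \<phi> = dist_mult rw f \<phi> \<longleftrightarrow>
      J * (- ?I) = J * (\<integral>x. \<phi> x * dens u f' x \<partial>P)" unfolding 3 by simp
    also have "\<dots> \<longleftrightarrow> - ?I = (\<integral>x. \<phi> x * dens u f' x \<partial>P)"
      using mult_cancel_left[of J "- ?I"] J(2) by blast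
    also have "\<dots> \<longleftrightarrow> ?I = - (\<integral>x. \<phi> x * dens u f' x \<partial>P)" by (rule minus_equation_iff[THEN trans]) auto
    finally show ?thesis .
  qed
  then show ?thesis unfolding dist_eq_def by blast
qed

text \<open>In \<open>T_max\<close> the function \<open>f\<close> is merely measurable for the
  completion and is exchanged for a Borel representative of its class; \<open>u\<close> is Borel
  already because it is balanced. By \<open>balanced_prim\<close> and
  \<open>bal_integrate_by_parts\<close> the distributional equation amounts to
  \<open>sol\<close>.\<close>

lemma T_max_eq:
  assumes rq: "polar rq = (density P (\<lambda>x. ennreal (m x)), h)" and m: "m \<in> borel_measurable borel" "\<And>x. 0 \<le> m x"
    and h: "h \<in> borel_measurable borel" "AE x in P. of_real (m x) * h x = of_real (q x)"
    and rw: "polar rw = (W, k)" and k: "k \<in> borel_measurable borel" "AE x in W. k x = 1"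
  shows "T_max J rq rw = symmetric_relation.T (completion W) max_rel"
proof -
  interpret symmetric_relation "completion W" max_rel by (rule max_rel_symmetric_relation)
  have abs: "abs_measure rw = completion W" by (simp add: abs_measure_def rw)
  note iff = dist_eq_iff[OF rq m h rw k]
  show ?thesis
  proof (rule equalityI; rule subrelI)
    fix U F assume "(U, F) \<in> T_max J rq rw"
    then obtain u f where uf: "U = l2_class (completion W) u" "F = l2_class (completion W) f"
      "u \<in> l2_funs (completion W)" "f \<in> l2_funs (completion W)" "bv_loc u" "balanced u"
      "dist_eq (dist_add (dist_scale J (dist_deriv (dist_of_fun u))) (dist_mult rq u)) (dist_mult rw f)"
      unfolding T_max_def abs by blast
    obtain f' where f': "l2w f'" "AE x in W. f x = f' x" by (rule l2w_representative[OF uf(4)]) (rule that)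
    have ub: "u \<in> borel_measurable borel" by (rule balanced_one_sided[OF uf(6)])
    have ul: "loc_bounded u" by (rule bv_loc_loc_bounded[OF uf(5)])
    have eq: "(\<integral>x. u x * vector_derivative \<phi> (at x) \<partial>lborel) = - (\<integral>x. \<phi> x * dens u f' x \<partial>P)" if "test_fun \<phi>" for \<phi>
      using iff[OF ub ul l2_funs_borel[OF uf(4)] f'] uf(7) that by blast
    obtain v where "prim P v (dens u f')" "u = bal P v (dens u f')"
      by (rule balanced_prim[OF P uf(5,6) dens_loc_int[OF ub ul f'(1)]], rule eq, assumption, rule that)
    then have "sol v u f'" using ub l2w_borel[OF f'(1)] by (simp add: sol_def)
    moreover have "l2w u" using l2_funs_W[OF ub] uf(3) by blast
    ultimately have "max_rel u f'" using f'(1) by (auto simp: max_rel_def)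
    moreover have "F = l2_class (completion W) f'"
      unfolding uf(2) using l2_class_eq_iff[OF uf(4) l2w_l2_funs[OF f'(1)]] AE_completion[OF f'(2)] by blast
    ultimately show "(U, F) \<in> T" unfolding T_def using uf(1) by blast
  next
    fix U F assume "(U, F) \<in> T"
    then obtain u f where uf: "max_rel u f" "U = l2_class (completion W) u" "F = l2_class (completion W) f"
      unfolding T_def by blast
    then obtain v where s: "sol v u f" and l2: "l2w u" "l2w f" by (auto simp: max_rel_def)
    have ub: "u \<in> borel_measurable borel" by (rule l2w_borel[OF l2(1)])
    have ul: "loc_bounded u" by (rule sol_loc_bounded[OF s])
    have "bv_loc u" "balanced u"
      using bal_bv_loc[OF P sol_prim[OF s]] bal_balanced[OF P sol_prim[OF s]] unfolding sol_bal[OF s] by auto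
    moreover have "(\<integral>x. u x * vector_derivative \<phi> (at x) \<partial>lborel) = - (\<integral>x. \<phi> x * dens u f x \<partial>P)" if "test_fun \<phi>" for \<phi>
      using bal_integrate_by_parts[OF P sol_prim[OF s] that] unfolding sol_bal[OF s] .
    then have "dist_eq (dist_add (dist_scale J (dist_deriv (dist_of_fun u))) (dist_mult rq u)) (dist_mult rw f)"
      using iff[OF ub ul l2_funs_borel[OF l2w_l2_funs[OF l2(2)]] l2(2)] by simp
    ultimately show "(U, F) \<in> T_max J rq rw"
      unfolding T_max_def abs using uf(2,3) l2w_l2_funs l2 by blast
  qed
qed

end

theorem theorem5p2:
  fixes \<omega> :: real and J :: complex and q w :: dist
  assumes "\<omega> > 0"
    and "Re J = 0" and "J \<noteq> 0"
    and "order0 q" and "real_dist q" and "periodic_dist \<omega> q"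
    and "order0 w" and "nonneg_dist w" and "\<not> dist_eq w (\<lambda>_. 0)" and "periodic_dist \<omega> w"
  shows "self_adjoint (abs_measure w) (T_max J q w)
    \<and> purely_continuous_spectrum (abs_measure w) (T_max J q w)
    \<and> spectrum (abs_measure w) (T_max J q w) = \<real>"
proof -
  obtain M0 h0 where q0: "local_measure q M0 h0" "\<And>x. h0 x \<in> \<real>" using \<open>real_dist q\<close> unfolding real_dist_def by blast
  obtain N0 where w0: "local_measure w N0 (\<lambda>_. 1)" using \<open>nonneg_dist w\<close> unfolding nonneg_dist_def by blast
  define M where "M = fst (polar q)"
  define h where "h = snd (polar q)"
  define N where "N = fst (polar w)"
  define k where "k = snd (polar w)"
  have lq: "local_measure q M h" unfolding M_def h_def by (rule local_measure_polar[OF q0(1)])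
  have lw: "local_measure w N k" unfolding N_def k_def by (rule local_measure_polar[OF w0])
  have pq: "polar q = (M, h)" and pw: "polar w = (N, k)" by (simp_all add: M_def h_def N_def k_def)
  have hm: "h \<in> borel_measurable borel" and h1: "\<And>x. cmod (h x) = 1" and km: "k \<in> borel_measurable borel"
    using lq lw by (simp_all add: local_measure_def)
  have hR: "AE x in M. Im (h x) = 0" by (rule local_measure_real_AE[OF lq q0])
  have k1: "AE x in N. k x = 1" by (rule local_measure_nonneg_AE[OF lw w0])
  \<comment> \<open>Replacing the phase by 1 while keeping the measure \<open>N\<close> makes
    \<open>mass_infinite\<close> applicable to the very measure that underlies
    \<open>abs_measure w\<close>.\<close>
  have lN1: "local_measure w N (\<lambda>_. 1)"
  proof -
    note Nd = locally_finiteD[OF local_measure_locally_finite[OF lw]]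
    have "w \<phi> = (\<integral>x. \<phi> x * 1 \<partial>N)" if "test_fun \<phi>" for \<phi>
    proof -
      have "w \<phi> = (\<integral>x. \<phi> x * k x \<partial>N)" using lw that by (simp add: local_measure_def)
      also have "\<dots> = (\<integral>x. \<phi> x * 1 \<partial>N)"
      proof (rule integral_cong_AE)
        show "(\<lambda>x. \<phi> x * k x) \<in> borel_measurable N" "(\<lambda>x. \<phi> x * 1) \<in> borel_measurable N"
          unfolding Nd(6) using test_fun_borel[OF that] km by simp_all
        show "AE x in N. \<phi> x * k x = \<phi> x * 1" using k1 by eventually_elim simp
      qed
      finally show ?thesis .
    qed
    then show ?thesis using lw by (simp add: local_measure_def)
  qed
  note lM = local_measure_locally_finite[OF lq] and lN = local_measure_locally_finite[OF lw]
  define P where "P = sum_measure M N"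
  obtain m ww where mw: "M = density P (\<lambda>x. ennreal (m x))" "N = density P (\<lambda>x. ennreal (ww x))"
    "m \<in> borel_measurable borel" "ww \<in> borel_measurable borel"
    "\<And>x. 0 \<le> m x" "\<And>x. m x \<le> 1" "\<And>x. 0 \<le> ww x" "\<And>x. ww x \<le> 1"
    by (rule densities_exist[OF lM lN, folded P_def]) (rule that)
  have lP: "locally_finite P" unfolding P_def by (rule sum_measure_locally_finite[OF lM lN])
  note Pd = locally_finiteD[OF lP]
  \<comment> \<open>The phase chosen by \<open>polar\<close> is real only almost everywhere; taking
    the real part makes the density real at every point.\<close>
  define qq where "qq x = m x * Re (h x)" for x
  obtain CM where CM: "\<And>x. atom M x \<le> CM" using atoms_bounded[OF lq assms(6,1)] by blast
  obtain CN where CN: "\<And>x. atom N x \<le> CN" using atoms_bounded[OF lw assms(10,1)] by blast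
  have massN: "(LINT x:{a..<b}|P. ww x) = measure N {a..<b}" for a b
  proof -
    have "measure N {a..<b} = (\<integral>x. indicator {a..<b} x \<partial>N)"
      using locally_finiteD[OF lN] by simp
    also have "\<dots> = (\<integral>x. ww x *\<^sub>R indicator {a..<b} x \<partial>P)"
      unfolding mw(2) by (rule integral_real_density'(1)[OF Pd(1) mw(4,7)]) simp
    finally show ?thesis unfolding set_lebesgue_integral_def by (simp add: mult.commute)
  qed
  interpret S: system P J qq ww
  proof
    show "locally_finite P" by (rule lP)
    show "qq \<in> borel_measurable borel" unfolding qq_def[abs_def] using mw(3) hm by measurable
    show "ww \<in> borel_measurable borel" by (rule mw(4))
    show "\<bar>qq x\<bar> \<le> 1" for x
    proof -
      have "\<bar>Re (h x)\<bar> \<le> 1" using abs_Re_le_cmod[of "h x"] h1[of x] by simp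
      then have "m x * \<bar>Re (h x)\<bar> \<le> 1 * 1" using mw(5,6)[of x] by (intro mult_mono) auto
      then show ?thesis using mw(5)[of x] by (simp add: qq_def abs_mult)
    qed
    show "0 \<le> ww x" "ww x \<le> 1" for x by (rule mw)+
    show "Re J = 0" "J \<noteq> 0" by fact+
    have "atom P x \<le> CM + CN" for x
    proof -
      have "emeasure P {x} = emeasure M {x} + emeasure N {x}"
        unfolding P_def by (rule sum_measure(2)) (use locally_finiteD(1)[OF lM] locally_finiteD(1)[OF lN] in auto)
      then have "measure P {x} = measure M {x} + measure N {x}"
        using locally_finiteD(5)[OF lM, of x] locally_finiteD(5)[OF lN, of x]
        by (simp add: measure_def enn2real_plus)
      then show ?thesis using CM[of x] CN[of x] by (simp add: atom_def)
    qed
    then show "\<exists>C. \<forall>x. atom P x \<le> C" by blast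
    show "\<exists>b\<ge>c. K \<le> (LINT x:{c..<b}|P. ww x)" "\<exists>a\<le>c. K \<le> (LINT x:{a..<c}|P. ww x)" for K c
      unfolding massN by (rule mass_infinite[OF lN1 assms(10,1,9)])+
  qed
  have NW: "N = S.W" unfolding S.W_def by (rule mw(2))
  have hq: "AE x in P. of_real (m x) * h x = of_real (qq x)"
  proof -
    have "(\<lambda>x. ennreal (m x)) \<in> borel_measurable P" using mw(3) unfolding Pd(6) by measurable
    then have "AE x in P. 0 < ennreal (m x) \<longrightarrow> Im (h x) = 0"
      using hR unfolding mw(1) by (subst (asm) AE_density)
    then show ?thesis
    proof eventually_elim
      case (elim x)
      then show ?case using mw(5)[of x] by (cases "m x = 0") (auto simp: qq_def complex_eq_iff)
    qed
  qed
  interpret R: symmetric_relation "completion S.W" S.max_rel by (rule S.max_rel_symmetric_relation)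
  have T: "T_max J q w = R.T"
    by (rule S.T_max_eq[OF _ mw(3,5) hm hq _ km]) (use pq pw mw(1) NW k1 in auto)
  have A: "abs_measure w = completion S.W" by (simp add: abs_measure_def pw NW)
  show ?thesis unfolding T A purely_continuous_spectrum_def
    using R.self_adjoint_T R.no_eigenvalue R.spectrum_T by blast
qed

end
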